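(* Let $r,\mu,\rho\in\mathbb{R}$, $\sigma>0$, $\lambda=\frac{\mu-r}{\sigma}$, $\gamma>1$, and assume $\rho>(1-\gamma)\left(r+\frac{\lambda^2}{2\gamma}\right)$. Set $$a=\left(\frac{\rho-(1-\gamma)\left(r+\frac{\lambda^2}{2\gamma}\right)}{\gamma}\right)^{-\gamma}.$$ Let $x>0$, let $\widehat X$ be the unique strong solution of the closed loop equation $$\mathrm{d}X_t=\left(r+\frac{\lambda^2}{\gamma}-a^{-1/\gamma}\right)X_t\,\mathrm{d}t+\frac{\lambda}{\gamma}X_t\,\mathrm{d}W_t,\qquad X_0=x,$$ and define the feedback strategy $$\widehat c_t:=a^{-1/\gamma}\,\widehat X_t,\qquad \widehat\pi_t:=\frac{\lambda}{\sigma\gamma}\,\widehat X_t,\qquad t\ge 0.$$ Then $(\widehat c,\widehat\pi)\in\mathcal{A}(x)$ and $(\widehat c,\widehat\pi)$ is optimal, i.e. $$V(x)=\mathbb{E}\left[\int_0^\infty e^{-\rho s}\frac{\widehat c_s^{\,1-\gamma}}{1-\gamma}\,\mathrm{d}s\right].$$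
   Context: $W$ is a standard one-dimensional Brownian motion on a filtered probability space $(\Omega,\mathcal{F},\mathbb{F}=(\mathcal{F}_t)_{t\ge0},\mathbb{P})$ satisfying the usual conditions. $\mathbb{R}^+$ denotes the set of nonnegative reals. $L^{2,\mathbb{F}}_{\mathrm{loc}}(\Omega\times[0,\infty);\mathbb{R})$ is the space of $\mathbb{F}$-adapted real-valued (measurable in $(\omega,t)$) processes $Z$ with $\mathbb{E}\left[\int_0^R|Z_t|^2\mathrm{d}t\right]<\infty$ for every $R>0$; $L^{1,\mathbb{F}}_{\mathrm{loc}}(\Omega\times[0,\infty);\mathbb{R}^+)$ is the space of $\mathbb{F}$-adapted $\mathbb{R}^+$-valued (measurable) processes $Z$ with $\mathbb{E}\left[\int_0^R|Z_t|\mathrm{d}t\right]<\infty$ for every $R>0$. For $x>0$, $c\in L^{1,\mathbb{F}}_{\mathrm{loc}}(\Omega\times[0,\infty);\mathbb{R}^+)$ and $\pi\in L^{2,\mathbb{F}}_{\mathrm{loc}}(\Omega\times[0,\infty);\mathbb{R})$, the wealth process $X=X^{x;c,\pi}$ is the unique strong solution of $$\mathrm{d}X_t=(rX_t+\sigma\lambda\pi_t)\,\mathrm{d}t+\sigma\pi_t\,\mathrm{d}W_t-c_t\,\mathrm{d}t,\qquad X_0=x.$$ The set of admissible strategies is $$\mathcal{A}(x)=\{(c,\pi)\in L^{1,\mathbb{F}}_{\mathrm{loc}}(\Omega\times[0,\infty);\mathbb{R}^+)\times L^{2,\mathbb{F}}_{\mathrm{loc}}(\Omega\times[0,\infty);\mathbb{R}):\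 X^{x;c,\pi}\ge0\}.$$ The objective functional is $J(c)=\mathbb{E}\left[\int_0^\infty e^{-\rho s}\frac{c_s^{1-\gamma}}{1-\gamma}\,\mathrm{d}s\right]\in[-\infty,0]$ (with the convention that $\frac{0^{1-\gamma}}{1-\gamma}=-\infty$), and the value function is $V(x)=\sup_{(c,\pi)\in\mathcal{A}(x)}J(c)\in[-\infty,0]$. *)

theory Defs
  imports "HOL-Probability.Probability"
begin

text \<open>Time is \<^typ>\<open>real\<close>; a process \<open>Z\<close> is written \<open>Z t \<omega>\<close>, and only its values at \<open>t \<ge> 0\<close>
  matter. The same goes for filtrations.\<close>

locale usual_filtered_prob_space = prob_space M
  for M :: "'a measure" and F :: "real \<Rightarrow> 'a measure" +
  assumes subalg: "0 \<le> t \<Longrightarrow> subalgebra M (F t)"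
    and filtration_mono: "0 \<le> s \<Longrightarrow> s \<le> t \<Longrightarrow> sets (F s) \<subseteq> sets (F t)"
    and right_continuous: "0 \<le> t \<Longrightarrow> sets (F t) = (\<Inter>s\<in>{t<..}. sets (F s))"
    and complete: "N \<in> null_sets M \<Longrightarrow> A \<subseteq> N \<Longrightarrow> A \<in> sets (F 0)"

definition adapted :: "(real \<Rightarrow> 'a measure) \<Rightarrow> (real \<Rightarrow> 'a \<Rightarrow> real) \<Rightarrow> bool" where
  "adapted F Z \<longleftrightarrow> (\<forall>t\<ge>0. Z t \<in> borel_measurable (F t))"

definition measurable_process :: "'a measure \<Rightarrow> (real \<Rightarrow> 'a \<Rightarrow> real) \<Rightarrow> bool" where
  "measurable_process M Z \<longleftrightarrow>
     (\<lambda>(\<omega>, t). Z t \<omega>) \<in> borel_measurable (M \<Otimes>\<^sub>M restrict_space borel {0..})"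

definition continuous_paths :: "'a measure \<Rightarrow> (real \<Rightarrow> 'a \<Rightarrow> real) \<Rightarrow> bool" where
  "continuous_paths M Z \<longleftrightarrow> (AE \<omega> in M. continuous_on {0..} (\<lambda>t. Z t \<omega>))"

locale brownian_motion = usual_filtered_prob_space M F
  for M :: "'a measure" and F :: "real \<Rightarrow> 'a measure" +
  fixes W :: "real \<Rightarrow> 'a \<Rightarrow> real"
  assumes W_adapted: "adapted F W"
    and W_zero: "AE \<omega> in M. W 0 \<omega> = 0"
    and W_continuous: "continuous_paths M W"
    and W_normal: "0 \<le> s \<Longrightarrow> s < t \<Longrightarrow>
      distributed M lborel (\<lambda>\<omega>. W t \<omega> - W s \<omega>) (normal_density 0 (sqrt (t - s)))"
    and W_indep: "0 \<le> s \<Longrightarrow> s < t \<Longrightarrow>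
      indep_set (sets (F s)) (sets (vimage_algebra (space M) (\<lambda>\<omega>. W t \<omega> - W s \<omega>) borel))"

definition L2_loc :: "'a measure \<Rightarrow> (real \<Rightarrow> 'a measure) \<Rightarrow> (real \<Rightarrow> 'a \<Rightarrow> real) set" where
  "L2_loc M F = {Z. measurable_process M Z \<and> adapted F Z \<and>
     (\<forall>R>0. (\<integral>\<^sup>+\<omega>. (\<integral>\<^sup>+t\<in>{0..R}. ennreal (\<bar>Z t \<omega>\<bar>\<^sup>2) \<partial>lborel) \<partial>M) < \<infinity>)}"

text \<open>Elements of the Lebesgue spaces are processes up to \<open>\<P> \<otimes> dt\<close>-null sets, hence the
  constraint of being \<open>\<real>\<^sup>+\<close>-valued is imposed almost everywhere.\<close>

definition L1_loc_nonneg :: "'a measure \<Rightarrow> (real \<Rightarrow> 'a measure) \<Rightarrow> (real \<Rightarrow> 'a \<Rightarrow> real) set" where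
  "L1_loc_nonneg M F = {Z. measurable_process M Z \<and> adapted F Z \<and>
     (AE \<omega> in M. AE t in lborel. 0 \<le> t \<longrightarrow> 0 \<le> Z t \<omega>) \<and>
     (\<forall>R>0. (\<integral>\<^sup>+\<omega>. (\<integral>\<^sup>+t\<in>{0..R}. ennreal \<bar>Z t \<omega>\<bar> \<partial>lborel) \<partial>M) < \<infinity>)}"

text \<open>The Ito integral: first of step processes
  \<open>\<Sum>i<n. \<xi>\<^sub>i 1\<^bsub>(u\<^sub>i, u\<^sub>i\<^sub>+\<^sub>1]\<^esub>\<close>, then as an \<open>L\<^sup>2\<close>-limit, then by localisation.\<close>

definition step_integrand ::
  "'a measure \<Rightarrow> (real \<Rightarrow> 'a measure) \<Rightarrow> nat \<Rightarrow> (nat \<Rightarrow> real) \<Rightarrow> (nat \<Rightarrow> 'a \<Rightarrow> real) \<Rightarrow> bool" where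
  "step_integrand M F n u \<xi> \<longleftrightarrow> 0 \<le> u 0 \<and>
     (\<forall>i<n. u i \<le> u (Suc i) \<and> \<xi> i \<in> borel_measurable (F (u i)) \<and> bounded (\<xi> i ` space M))"

definition step_process ::
  "nat \<Rightarrow> (nat \<Rightarrow> real) \<Rightarrow> (nat \<Rightarrow> 'a \<Rightarrow> real) \<Rightarrow> real \<Rightarrow> 'a \<Rightarrow> real" where
  "step_process n u \<xi> t \<omega> = (\<Sum>i<n. \<xi> i \<omega> * indicator {u i<..u (Suc i)} t)"

definition step_integral ::
  "(real \<Rightarrow> 'a \<Rightarrow> real) \<Rightarrow> nat \<Rightarrow> (nat \<Rightarrow> real) \<Rightarrow> (nat \<Rightarrow> 'a \<Rightarrow> real) \<Rightarrow> real \<Rightarrow> 'a \<Rightarrow> real" where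
  "step_integral W n u \<xi> t \<omega> = (\<Sum>i<n. \<xi> i \<omega> * (W (min t (u (Suc i))) \<omega> - W (min t (u i)) \<omega>))"

definition ito_integral_L2 ::
  "'a measure \<Rightarrow> (real \<Rightarrow> 'a measure) \<Rightarrow> (real \<Rightarrow> 'a \<Rightarrow> real) \<Rightarrow> (real \<Rightarrow> 'a \<Rightarrow> real) \<Rightarrow>
   (real \<Rightarrow> 'a \<Rightarrow> real) \<Rightarrow> bool" where
  "ito_integral_L2 M F W H I \<longleftrightarrow>
     H \<in> L2_loc M F \<and> adapted F I \<and> continuous_paths M I \<and>
     (\<forall>T\<ge>0. \<exists>n u \<xi>. (\<forall>k. step_integrand M F (n k) (u k) (\<xi> k)) \<and>
        (\<lambda>k. \<integral>\<^sup>+\<omega>. (\<integral>\<^sup>+t\<in>{0..T}. ennreal ((step_process (n k) (u k) (\<xi> k) t \<omega> - H t \<omega>)\<^sup>2) \<partial>lborel) \<partial>M)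
          \<longlonglongrightarrow> 0 \<and>
        (\<lambda>k. \<integral>\<^sup>+\<omega>. ennreal ((step_integral W (n k) (u k) (\<xi> k) T \<omega> - I T \<omega>)\<^sup>2) \<partial>M)
          \<longlonglongrightarrow> 0)"

text \<open>\<open>I\<close> is the stochastic integral process \<open>\<integral>\<^sub>0\<^sup>t H dW\<close>. The localising sequence makes
  \<open>\<integral>\<^sub>0\<^sup>T H\<^sup>2 dt < \<infinity>\<close> almost surely, for every \<open>T\<close>, automatic.\<close>

definition ito_integral ::
  "'a measure \<Rightarrow> (real \<Rightarrow> 'a measure) \<Rightarrow> (real \<Rightarrow> 'a \<Rightarrow> real) \<Rightarrow> (real \<Rightarrow> 'a \<Rightarrow> real) \<Rightarrow>
   (real \<Rightarrow> 'a \<Rightarrow> real) \<Rightarrow> bool" where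
  "ito_integral M F W H I \<longleftrightarrow>
     measurable_process M H \<and> adapted F H \<and> adapted F I \<and> continuous_paths M I \<and>
     (\<exists>\<tau> :: nat \<Rightarrow> 'a \<Rightarrow> real.
        (\<forall>n. stopping_time F (\<tau> n) \<and> (\<forall>\<omega>\<in>space M. 0 \<le> \<tau> n \<omega>)) \<and>
        (AE \<omega> in M. incseq (\<lambda>n. \<tau> n \<omega>) \<and> filterlim (\<lambda>n. \<tau> n \<omega>) at_top sequentially) \<and>
        (\<forall>n. ito_integral_L2 M F W (\<lambda>t \<omega>. if t \<le> \<tau> n \<omega> then H t \<omega> else 0)
               (\<lambda>t \<omega>. I (min t (\<tau> n \<omega>)) \<omega>)))"

text \<open>\<open>X\<close> satisfies \<open>dX\<^sub>t = b\<^sub>t dt + H\<^sub>t dW\<^sub>t\<close>, \<open>X\<^sub>0 = x\<close>. In a stochastic differential equation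
  the processes \<open>b\<close> and \<open>H\<close> are themselves expressed through \<open>X\<close>.\<close>

definition solves_SDE ::
  "'a measure \<Rightarrow> (real \<Rightarrow> 'a measure) \<Rightarrow> (real \<Rightarrow> 'a \<Rightarrow> real) \<Rightarrow> real \<Rightarrow>
   (real \<Rightarrow> 'a \<Rightarrow> real) \<Rightarrow> (real \<Rightarrow> 'a \<Rightarrow> real) \<Rightarrow> (real \<Rightarrow> 'a \<Rightarrow> real) \<Rightarrow> bool" where
  "solves_SDE M F W x b H X \<longleftrightarrow>
     measurable_process M X \<and> adapted F X \<and> continuous_paths M X \<and>
     (AE \<omega> in M. \<forall>T\<ge>0. set_integrable lborel {0..T} (\<lambda>s. b s \<omega>)) \<and>
     (\<exists>I. ito_integral M F W H I \<and>
        (AE \<omega> in M. \<forall>t\<ge>0. X t \<omega> = x + (LBINT s:{0..t}. b s \<omega>) + I t \<omega>))"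

definition wealth_process ::
  "'a measure \<Rightarrow> (real \<Rightarrow> 'a measure) \<Rightarrow> (real \<Rightarrow> 'a \<Rightarrow> real) \<Rightarrow> real \<Rightarrow> real \<Rightarrow> real \<Rightarrow> real \<Rightarrow>
   (real \<Rightarrow> 'a \<Rightarrow> real) \<Rightarrow> (real \<Rightarrow> 'a \<Rightarrow> real) \<Rightarrow> (real \<Rightarrow> 'a \<Rightarrow> real) \<Rightarrow> bool" where
  "wealth_process M F W r \<sigma> lam x c \<pi> X \<longleftrightarrow>
     solves_SDE M F W x (\<lambda>t \<omega>. r * X t \<omega> + \<sigma> * lam * \<pi> t \<omega> - c t \<omega>) (\<lambda>t \<omega>. \<sigma> * \<pi> t \<omega>) X"

definition admissible ::
  "'a measure \<Rightarrow> (real \<Rightarrow> 'a measure) \<Rightarrow> (real \<Rightarrow> 'a \<Rightarrow> real) \<Rightarrow> real \<Rightarrow> real \<Rightarrow> real \<Rightarrow> real \<Rightarrow>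
   ((real \<Rightarrow> 'a \<Rightarrow> real) \<times> (real \<Rightarrow> 'a \<Rightarrow> real)) set" where
  "admissible M F W r \<sigma> lam x =
     {(c, \<pi>). c \<in> L1_loc_nonneg M F \<and> \<pi> \<in> L2_loc M F \<and>
        (\<exists>X. wealth_process M F W r \<sigma> lam x c \<pi> X \<and> (AE \<omega> in M. \<forall>t\<ge>0. 0 \<le> X t \<omega>))}"

definition crra_utility :: "real \<Rightarrow> real \<Rightarrow> ereal" where
  "crra_utility \<gamma> y = (if y \<le> 0 then -\<infinity> else ereal (y powr (1 - \<gamma>) / (1 - \<gamma>)))"

text \<open>For \<open>\<gamma> > 1\<close> the integrand \<open>e\<^sup>-\<^sup>\<rho>\<^sup>s u(c\<^sub>s)\<close> is nonpositive, so that the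
  \<open>[-\<infinity>, 0]\<close>-valued integral is minus the nonnegative integral of its negation.\<close>

definition objective :: "'a measure \<Rightarrow> real \<Rightarrow> real \<Rightarrow> (real \<Rightarrow> 'a \<Rightarrow> real) \<Rightarrow> ereal" where
  "objective M \<rho> \<gamma> c = - enn2ereal (\<integral>\<^sup>+\<omega>. (\<integral>\<^sup>+s\<in>{0..}.
      e2ennreal (- (ereal (exp (- \<rho> * s)) * crra_utility \<gamma> (c s \<omega>))) \<partial>lborel) \<partial>M)"

definition value_function ::
  "'a measure \<Rightarrow> (real \<Rightarrow> 'a measure) \<Rightarrow> (real \<Rightarrow> 'a \<Rightarrow> real) \<Rightarrow> real \<Rightarrow> real \<Rightarrow> real \<Rightarrow> real \<Rightarrow> real \<Rightarrow>
   real \<Rightarrow> ereal" where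
  "value_function M F W r \<sigma> lam \<rho> \<gamma> x =
     (SUP (c, \<pi>) \<in> admissible M F W r \<sigma> lam x. objective M \<rho> \<gamma> c)"

end

theory Submission
  imports Defs
begin

text \<open>The proof is by convex duality and needs no Ito formula. Let \<open>M\<^sup>\<alpha>\<^sub>t = exp (\<alpha> W\<^sub>t - \<alpha>\<^sup>2 t / 2)\<close>.
  On step processes one checks directly the isometry \<open>E[I\<^sub>s I\<^sub>t] = E \<integral>\<^sub>0\<^sup>s H\<^sup>2 dv\<close> and the Girsanov identity
  \<open>E[M\<^sup>\<alpha>\<^sub>T I\<^sub>t] = \<alpha> E \<integral>\<^sub>0\<^sup>t M\<^sup>\<alpha>\<^sub>v H\<^sub>v dv\<close>; both pass to \<open>L\<^sup>2\<close>-limits.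

  With \<open>\<alpha> = - lam\<close> the Girsanov identity, applied along a localising sequence, gives the budget inequality
  \<open>E \<integral>\<^sub>0\<^sup>T Z\<^sub>s c\<^sub>s ds \<le> x\<close> for every admissible consumption \<open>c\<close>, where \<open>Z\<^sub>s = exp (- r s) M\<^sup>\<alpha>\<^sub>s\<close>.
  With \<open>\<alpha> = lam / \<gamma>\<close> the two identities together compute the \<open>L\<^sup>2\<close>-distance between a stopped solution of
  the closed loop equation and the explicit geometric Brownian motion, and Gronwall's lemma shows that it
  vanishes in the limit. Finally \<open>e\<^sup>-\<^sup>\<rho>\<^sup>s u'(c)\<close> at the candidate is a constant multiple of \<open>Z\<^sub>s\<close>, so that the
  tangent inequality of the concave utility and the budget inequality bound every admissible payoff by
  that of the candidate, for which the budget is exhausted as \<open>T \<rightarrow> \<infinity>\<close>.\<close>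

subsection \<open>Square-integrable functions and Gaussian increments\<close>

text \<open>Ito integrals are given only through a localising sequence, so no moment of a solution
  at a fixed time is known in advance, and expectations can be taken only of stopped quantities. Two
  devices deal with this. \<open>disc\<close> is a linear pathwise functional that commutes with
  stopping: it makes discounting of the equation deterministic calculus on each path, and Fubini
  reduces every expectation of a discounted integral to expectations of the integral at fixed times.
  Removing the localisation then needs only Fatou's lemma, because what passes to the limit is
  nonnegative: consumption in the budget inequality, the squared error in the uniqueness argument.
  The explicit process is never shown to solve the closed loop equation; only its distance to the
  given solution is estimated. The rate \<open>k\<close>, which is \<open>a\<close> to the power
  \<open>- 1 / \<gamma>\<close>, has a price interpretation: consumption of the candidate at time
  \<open>s\<close> costs \<open>x * k * exp (- k * s)\<close> in state prices. The assumption on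
  \<open>\<rho>\<close> says that \<open>k\<close> is positive, so these costs add up to exactly the
  initial wealth.\<close>

definition sq_integrable :: "'b measure \<Rightarrow> ('b \<Rightarrow> real) \<Rightarrow> bool" where
  "sq_integrable N f \<longleftrightarrow> f \<in> borel_measurable N \<and> integrable N (\<lambda>x. (f x)\<^sup>2)"

lemma sq_integrableD:
  assumes "sq_integrable N f"
  shows "f \<in> borel_measurable N" "integrable N (\<lambda>x. (f x)\<^sup>2)"
  using assms by (auto simp: sq_integrable_def)

lemma sq_integrable_mult_integrable:
  assumes "sq_integrable N f" "sq_integrable N g"
  shows "integrable N (\<lambda>x. f x * g x)"
proof (rule Bochner_Integration.integrable_bound)
  show "integrable N (\<lambda>x. (f x)\<^sup>2 + (g x)\<^sup>2)"
    using assms by (auto simp: sq_integrable_def)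
  have "\<bar>a * b\<bar> \<le> a\<^sup>2 + b\<^sup>2" for a b :: real
    using sum_squares_bound[of "\<bar>a\<bar>" "\<bar>b\<bar>"] mult_nonneg_nonneg[of "\<bar>a\<bar>" "\<bar>b\<bar>"]
    unfolding abs_mult power2_abs by linarith
  then show "AE x in N. norm (f x * g x) \<le> norm ((f x)\<^sup>2 + (g x)\<^sup>2)"
    by (intro AE_I2) (metis abs_ge_self order_trans real_norm_def)
  show "(\<lambda>x. f x * g x) \<in> borel_measurable N"
    using assms by (auto simp: sq_integrable_def)
qed

lemma sq_integrable_add:
  assumes "sq_integrable N f" "sq_integrable N g"
  shows "sq_integrable N (\<lambda>x. f x + g x)"
  using assms sq_integrable_mult_integrable[OF assms]
  by (auto simp: sq_integrable_def power2_sum mult.assoc)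

lemma sq_integrable_cmult:
  assumes "sq_integrable N f"
  shows "sq_integrable N (\<lambda>x. c * f x)"
  using assms by (auto simp: sq_integrable_def power_mult_distrib)

lemma sq_integrable_diff:
  assumes "sq_integrable N f" "sq_integrable N g"
  shows "sq_integrable N (\<lambda>x. f x - g x)"
  using sq_integrable_add[OF assms(1) sq_integrable_cmult[OF assms(2), of "-1"]] by simp

lemma sq_integrable_zero [simp]: "sq_integrable N (\<lambda>x. 0)"
  by (auto simp: sq_integrable_def)

lemma sq_integrable_sum:
  assumes "\<And>i. i \<in> A \<Longrightarrow> sq_integrable N (f i)"
  shows "sq_integrable N (\<lambda>x. \<Sum>i\<in>A. f i x)"
  using assms by (induction A rule: infinite_finite_induct) (auto intro!: sq_integrable_add)

lemma sq_integrable_bounded_mult: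
  assumes f: "sq_integrable N f" and g: "g \<in> borel_measurable N" and b: "\<And>x. x \<in> space N \<Longrightarrow> \<bar>g x\<bar> \<le> B"
  shows "sq_integrable N (\<lambda>x. g x * f x)"
  unfolding sq_integrable_def
proof
  note [measurable] = g sq_integrableD(1)[OF f]
  show "(\<lambda>x. g x * f x) \<in> borel_measurable N" by measurable
  show "integrable N (\<lambda>x. (g x * f x)\<^sup>2)"
  proof (rule Bochner_Integration.integrable_bound)
    show "integrable N (\<lambda>x. B\<^sup>2 * (f x)\<^sup>2)"
      using f by (auto simp: sq_integrable_def)
    show "AE x in N. norm ((g x * f x)\<^sup>2) \<le> norm (B\<^sup>2 * (f x)\<^sup>2)"
    proof (rule AE_I2)
      fix x assume "x \<in> space N"
      then have "\<bar>g x\<bar>\<^sup>2 \<le> B\<^sup>2" using b by (intro power_mono) auto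
      then show "norm ((g x * f x)\<^sup>2) \<le> norm (B\<^sup>2 * (f x)\<^sup>2)"
        by (auto simp: power_mult_distrib intro!: mult_right_mono)
    qed
  qed measurable
qed

text \<open>Cauchy-Schwarz, transferred from its extended nonnegative form. The second version, with
  the absolute value inside, supplies bounds uniform in time for Fubini arguments.\<close>

lemma abs_integral_mult_le:
  assumes f: "sq_integrable N f" and g: "sq_integrable N g"
  shows "\<bar>\<integral>x. f x * g x \<partial>N\<bar> \<le> sqrt (\<integral>x. (f x)\<^sup>2 \<partial>N) * sqrt (\<integral>x. (g x)\<^sup>2 \<partial>N)"
    and "(\<integral>x. \<bar>f x * g x\<bar> \<partial>N) \<le> sqrt (\<integral>x. (f x)\<^sup>2 \<partial>N) * sqrt (\<integral>x. (g x)\<^sup>2 \<partial>N)"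
proof -
  note [measurable] = sq_integrableD(1)[OF f] sq_integrableD(1)[OF g]
  let ?A = "\<integral>x. \<bar>f x * g x\<bar> \<partial>N"
  have i: "integrable N (\<lambda>x. \<bar>f x * g x\<bar>)"
    using sq_integrable_mult_integrable[OF f g] by simp
  have "(ennreal ?A)\<^sup>2 = (\<integral>\<^sup>+x. ennreal \<bar>f x\<bar> * ennreal \<bar>g x\<bar> \<partial>N)\<^sup>2"
    by (subst nn_integral_eq_integral[symmetric, OF i]) (auto simp: abs_mult ennreal_mult)
  also have "\<dots> \<le> (\<integral>\<^sup>+x. (ennreal \<bar>f x\<bar>)\<^sup>2 \<partial>N) * (\<integral>\<^sup>+x. (ennreal \<bar>g x\<bar>)\<^sup>2 \<partial>N)"
    by (rule Cauchy_Schwarz_nn_integral) auto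
  also have "\<dots> = ennreal (\<integral>x. (f x)\<^sup>2 \<partial>N) * ennreal (\<integral>x. (g x)\<^sup>2 \<partial>N)"
    using sq_integrableD(2)[OF f] sq_integrableD(2)[OF g]
    by (simp add: ennreal_power nn_integral_eq_integral)
  finally have "ennreal (?A\<^sup>2) \<le> ennreal ((\<integral>x. (f x)\<^sup>2 \<partial>N) * (\<integral>x. (g x)\<^sup>2 \<partial>N))"
    by (simp add: ennreal_power ennreal_mult)
  then have "?A\<^sup>2 \<le> (\<integral>x. (f x)\<^sup>2 \<partial>N) * (\<integral>x. (g x)\<^sup>2 \<partial>N)"
    by (subst (asm) ennreal_le_iff) auto
  then have "?A \<le> sqrt ((\<integral>x. (f x)\<^sup>2 \<partial>N) * (\<integral>x. (g x)\<^sup>2 \<partial>N))"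
    by (rule real_le_rsqrt)
  then show 1: "?A \<le> sqrt (\<integral>x. (f x)\<^sup>2 \<partial>N) * sqrt (\<integral>x. (g x)\<^sup>2 \<partial>N)"
    by (simp add: real_sqrt_mult)
  show "\<bar>\<integral>x. f x * g x \<partial>N\<bar> \<le> sqrt (\<integral>x. (f x)\<^sup>2 \<partial>N) * sqrt (\<integral>x. (g x)\<^sup>2 \<partial>N)"
    using 1 integral_abs_bound[of N "\<lambda>x. f x * g x"] by linarith
qed

text \<open>The device by which both identities for step processes pass to the limit. The difference
  of the products splits into three terms, each containing a factor that tends to 0 in
  \<open>L^2\<close>.\<close>

lemma tendsto_integral_mult_L2:
  assumes f: "\<And>k. sq_integrable N (f k)" "sq_integrable N f0"
    and g: "\<And>k. sq_integrable N (g k)" "sq_integrable N g0"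
    and fl: "(\<lambda>k. \<integral>x. (f k x - f0 x)\<^sup>2 \<partial>N) \<longlonglongrightarrow> 0"
    and gl: "(\<lambda>k. \<integral>x. (g k x - g0 x)\<^sup>2 \<partial>N) \<longlonglongrightarrow> 0"
  shows "(\<lambda>k. \<integral>x. f k x * g k x \<partial>N) \<longlonglongrightarrow> (\<integral>x. f0 x * g0 x \<partial>N)"
proof -
  have fd: "sq_integrable N (\<lambda>x. f k x - f0 x)" and gd: "sq_integrable N (\<lambda>x. g k x - g0 x)" for k
    using f g by (auto intro: sq_integrable_diff)
  note fl' = tendsto_real_sqrt[OF fl] and gl' = tendsto_real_sqrt[OF gl]
  have 1: "(\<lambda>k. \<integral>x. (f k x - f0 x) * (g k x - g0 x) \<partial>N) \<longlonglongrightarrow> 0"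
    by (rule Lim_null_comparison[OF always_eventually tendsto_eq_rhs[OF tendsto_mult[OF fl' gl']]])
       (use abs_integral_mult_le(1)[OF fd gd] in auto)
  have 2: "(\<lambda>k. \<integral>x. (f k x - f0 x) * g0 x \<partial>N) \<longlonglongrightarrow> 0"
    by (rule Lim_null_comparison[OF always_eventually tendsto_eq_rhs[OF tendsto_mult[OF fl' tendsto_const]]])
       (use abs_integral_mult_le(1)[OF fd g(2)] in auto)
  have 3: "(\<lambda>k. \<integral>x. f0 x * (g k x - g0 x) \<partial>N) \<longlonglongrightarrow> 0"
    by (rule Lim_null_comparison[OF always_eventually tendsto_eq_rhs[OF tendsto_mult[OF tendsto_const gl']]])
       (use abs_integral_mult_le(1)[OF f(2) gd] in auto)
  have "(\<integral>x. f k x * g k x \<partial>N) = (\<integral>x. (f k x - f0 x) * (g k x - g0 x) \<partial>N)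
      + (\<integral>x. (f k x - f0 x) * g0 x \<partial>N) + (\<integral>x. f0 x * (g k x - g0 x) \<partial>N) + (\<integral>x. f0 x * g0 x \<partial>N)" for k
  proof -
    note i = sq_integrable_mult_integrable[OF fd gd, of k k] sq_integrable_mult_integrable[OF fd g(2), of k]
       sq_integrable_mult_integrable[OF f(2) gd, of k] sq_integrable_mult_integrable[OF f(2) g(2)]
    have "(\<integral>x. f k x * g k x \<partial>N) = (\<integral>x. ((f k x - f0 x) * (g k x - g0 x) + (f k x - f0 x) * g0 x)
        + f0 x * (g k x - g0 x) + f0 x * g0 x \<partial>N)"
      by (intro Bochner_Integration.integral_cong) (auto simp: algebra_simps)
    then show ?thesis
      by (simp only: Bochner_Integration.integral_add Bochner_Integration.integrable_add i)
  qed
  moreover have "(\<lambda>k. (\<integral>x. (f k x - f0 x) * (g k x - g0 x) \<partial>N)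
      + (\<integral>x. (f k x - f0 x) * g0 x \<partial>N) + (\<integral>x. f0 x * (g k x - g0 x) \<partial>N) + (\<integral>x. f0 x * g0 x \<partial>N))
     \<longlonglongrightarrow> 0 + 0 + 0 + (\<integral>x. f0 x * g0 x \<partial>N)"
    by (intro tendsto_add 1 2 3 tendsto_const)
  ultimately show ?thesis by simp
qed

text \<open>Square-integrability of the limit is a conclusion: once its distance to some
  \<open>f k\<close> is finite, it is a difference of square-integrable functions. This turns the
  \<open>ennreal\<close> convergences in the definition of the Ito integral into real ones.\<close>

lemma L2_limit_from_nn_integral:
  assumes f: "\<And>k. f k \<in> borel_measurable N" and g: "g \<in> borel_measurable N"
    and lim: "(\<lambda>k. \<integral>\<^sup>+x. ennreal ((f k x - g x)\<^sup>2) \<partial>N) \<longlonglongrightarrow> 0"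
    and fi: "\<And>k. sq_integrable N (f k)"
  shows "sq_integrable N g" "(\<lambda>k. \<integral>x. (f k x - g x)\<^sup>2 \<partial>N) \<longlonglongrightarrow> 0"
proof -
  note [measurable] = f g
  have "eventually (\<lambda>k. (\<integral>\<^sup>+x. ennreal ((f k x - g x)\<^sup>2) \<partial>N) < 1) sequentially"
    using order_tendstoD(2)[OF lim, of 1] by simp
  then obtain k where k: "(\<integral>\<^sup>+x. ennreal ((f k x - g x)\<^sup>2) \<partial>N) < 1"
    using eventually_sequentially by auto
  have "sq_integrable N (\<lambda>x. f k x - g x)"
    unfolding sq_integrable_def using k
    by (auto intro!: integrableI_nonneg order.strict_trans[OF k] simp: less_top)
  from sq_integrable_diff[OF fi[of k] this] show sg: "sq_integrable N g" by simp
  have "integrable N (\<lambda>x. (f k x - g x)\<^sup>2)" for k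
    using sq_integrable_diff[OF fi sg] by (auto simp: sq_integrable_def)
  then have "(\<lambda>k. ennreal (\<integral>x. (f k x - g x)\<^sup>2 \<partial>N)) \<longlonglongrightarrow> ennreal 0"
    using lim by (simp add: nn_integral_eq_integral)
  then show "(\<lambda>k. \<integral>x. (f k x - g x)\<^sup>2 \<partial>N) \<longlonglongrightarrow> 0"
    by (subst (asm) tendsto_ennreal_iff) auto
qed

text \<open>Completing the square: tilting a centred Gaussian density by \<open>exp (al * x)\<close>
  moves its mean to \<open>al * s\<^sup>2\<close>. This is the seed of the Girsanov
  identity.\<close>

lemma normal_density_exp_mult:
  assumes "s > 0"
  shows "normal_density 0 s x * exp (al * x) = exp (al\<^sup>2 * s\<^sup>2 / 2) * normal_density (al * s\<^sup>2) s x"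
proof -
  have "- (x - 0)\<^sup>2 / (2 * s\<^sup>2) + al * x = al\<^sup>2 * s\<^sup>2 / 2 + - (x - al * s\<^sup>2)\<^sup>2 / (2 * s\<^sup>2)"
    using assms by (simp add: field_simps power2_eq_square)
  then have "exp (- (x - 0)\<^sup>2 / (2 * s\<^sup>2)) * exp (al * x) = exp (al\<^sup>2 * s\<^sup>2 / 2) * exp (- (x - al * s\<^sup>2)\<^sup>2 / (2 * s\<^sup>2))"
    by (simp only: exp_add[symmetric])
  then show ?thesis unfolding normal_density_def by (simp add: mult_ac)
qed

lemma (in prob_space) indep_var_of_indep_set:
  assumes i: "indep_set (sets A) (sets B)" and A: "subalgebra M A" and B: "subalgebra M B"
    and X: "X \<in> A \<rightarrow>\<^sub>M S" and Y: "Y \<in> B \<rightarrow>\<^sub>M T"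
  shows "indep_var S X T Y"
  unfolding indep_var_eq
proof (intro conjI)
  show "X \<in> M \<rightarrow>\<^sub>M S" "Y \<in> M \<rightarrow>\<^sub>M T"
    using measurable_from_subalg[OF A X] measurable_from_subalg[OF B Y] by auto
  have sp: "space A = space M" "space B = space M" using A B by (auto simp: subalgebra_def)
  have *: "sigma_sets (space M) {X -` C \<inter> space M |C. C \<in> sets S} \<subseteq> sets A"
    using measurable_sets[OF X] sp sets.top[of A]
    by (intro sets.sigma_sets_subset') auto
  have **: "sigma_sets (space M) {Y -` C \<inter> space M |C. C \<in> sets T} \<subseteq> sets B"
    using measurable_sets[OF Y] sp sets.top[of B]
    by (intro sets.sigma_sets_subset') auto
  show "indep_set (sigma_sets (space M) {X -` A \<inter> space M |A. A \<in> sets S})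
     (sigma_sets (space M) {Y -` A \<inter> space M |A. A \<in> sets T})"
    using i * ** unfolding indep_sets2_eq by blast
qed

lemma (in prob_space) indep_var_nn_integral_mult:
  fixes X Y :: "'a \<Rightarrow> ennreal"
  assumes "indep_var borel X borel Y"
  shows "(\<integral>\<^sup>+w. X w * Y w \<partial>M) = (\<integral>\<^sup>+w. X w \<partial>M) * (\<integral>\<^sup>+w. Y w \<partial>M)"
proof -
  have *: "indep_vars (\<lambda>_. borel) (case_bool X Y) UNIV"
    using assms unfolding indep_var_def
    by (rule subst[where P="\<lambda>B. indep_vars B _ _", rotated]) (auto split: bool.split)
  show ?thesis
    using indep_vars_nn_integral[OF _ *] by (simp add: UNIV_bool mult.commute)
qed

section \<open>Independence and moments of Brownian increments\<close>

context brownian_motion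
begin

lemma space_F [simp]: "0 \<le> t \<Longrightarrow> space (F t) = space M"
  using subalg[of t] by (auto simp: subalgebra_def)

lemma F_measurable_M: "0 \<le> t \<Longrightarrow> f \<in> F t \<rightarrow>\<^sub>M S \<Longrightarrow> f \<in> M \<rightarrow>\<^sub>M S"
  using subalg by (rule measurable_from_subalg)

lemma F_measurable_mono:
  assumes "0 \<le> s" "s \<le> t" "f \<in> F s \<rightarrow>\<^sub>M S" shows "f \<in> F t \<rightarrow>\<^sub>M S"
proof (rule measurable_from_subalg[OF _ assms(3)])
  show "subalgebra (F t) (F s)"
    using assms filtration_mono by (auto simp: subalgebra_def)
qed

lemma W_F: "0 \<le> t \<Longrightarrow> W t \<in> borel_measurable (F t)"
  using W_adapted by (auto simp: adapted_def)

lemma W_M [measurable]: "0 \<le> t \<Longrightarrow> W t \<in> borel_measurable M"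
  using W_F F_measurable_M by blast

lemma increment_indep_var:
  assumes st: "0 \<le> s" "s < t" and Y: "Y \<in> F s \<rightarrow>\<^sub>M S" and g: "g \<in> borel \<rightarrow>\<^sub>M T"
  shows "indep_var S Y T (\<lambda>w. g (W t w - W s w))"
proof (rule indep_var_of_indep_set[OF W_indep[OF st] subalg[OF st(1)] _ Y])
  show "subalgebra M (vimage_algebra (space M) (\<lambda>w. W t w - W s w) borel)"
    using st W_indep[OF st] unfolding indep_sets2_eq by (auto simp: subalgebra_def)
  show "(\<lambda>w. g (W t w - W s w)) \<in> vimage_algebra (space M) (\<lambda>w. W t w - W s w) borel \<rightarrow>\<^sub>M T"
    by (rule measurable_compose[OF measurable_vimage_algebra1 g]) auto
qed

lemma increment_expectation_mult:
  fixes Y :: "'a \<Rightarrow> real"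
  assumes "0 \<le> s" "s < t" "Y \<in> borel_measurable (F s)" "g \<in> borel_measurable borel"
    and "integrable M Y" "integrable M (\<lambda>w. g (W t w - W s w))"
  shows "integrable M (\<lambda>w. Y w * g (W t w - W s w))"
    and "expectation (\<lambda>w. Y w * g (W t w - W s w)) = expectation Y * expectation (\<lambda>w. g (W t w - W s w))"
  using indep_var_integrable[OF increment_indep_var[OF assms(1-4)] assms(5,6)]
    indep_var_lebesgue_integral[OF increment_indep_var[OF assms(1-4)] assms(5,6)] by auto

lemma increment_moments:
  assumes st: "0 \<le> s" "s < t"
  shows "integrable M (\<lambda>w. W t w - W s w)" "expectation (\<lambda>w. W t w - W s w) = 0"
    and "integrable M (\<lambda>w. (W t w - W s w)\<^sup>2)" "expectation (\<lambda>w. (W t w - W s w)\<^sup>2) = t - s"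
    and "integrable M (\<lambda>w. exp (al * (W t w - W s w)))"
      "expectation (\<lambda>w. exp (al * (W t w - W s w))) = exp (al\<^sup>2 * (t - s) / 2)"
    and "integrable M (\<lambda>w. (W t w - W s w) * exp (al * (W t w - W s w)))"
      "expectation (\<lambda>w. (W t w - W s w) * exp (al * (W t w - W s w))) = al * (t - s) * exp (al\<^sup>2 * (t - s) / 2)"
proof -
  define d where "d = sqrt (t - s)"
  have d: "d > 0" "d\<^sup>2 = t - s" using st by (auto simp: d_def)
  note D = W_normal[OF st, folded d_def]
  note int = distributed_integrable[OF D, THEN iffD1] and eq = distributed_integral[OF D, symmetric]
  have n[simp]: "\<And>x. 0 \<le> normal_density 0 d x" by simp
  show "integrable M (\<lambda>w. W t w - W s w)"
    by (rule int[of "\<lambda>x. x"]) (use integrable_normal_moment_nz_1[OF d(1), of 0] in auto)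
  show "expectation (\<lambda>w. W t w - W s w) = 0"
    by (subst eq[of "\<lambda>x. x"]) (use integral_normal_moment_nz_1[OF d(1), of 0] in auto)
  show "integrable M (\<lambda>w. (W t w - W s w)\<^sup>2)"
    by (rule int[of "\<lambda>x. x\<^sup>2"]) (use integrable_normal_moment[OF d(1), of 0 2] in auto)
  show "expectation (\<lambda>w. (W t w - W s w)\<^sup>2) = t - s"
    by (subst eq[of "\<lambda>x. x\<^sup>2"]) (use integral_normal_moment_even[OF d(1), of 0 1] d in \<open>auto simp: fact_numeral\<close>)
  show "integrable M (\<lambda>w. exp (al * (W t w - W s w)))"
    by (rule int[of "\<lambda>x. exp (al * x)"]) (use d in \<open>auto simp: normal_density_exp_mult\<close>)
  show "expectation (\<lambda>w. exp (al * (W t w - W s w))) = exp (al\<^sup>2 * (t - s) / 2)"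
    by (subst eq[of "\<lambda>x. exp (al * x)"]) (use d in \<open>auto simp: normal_density_exp_mult\<close>)
  \<comment> \<open>The tilt turns this moment into the mean of a Gaussian centred at
    \<open>al * d\<^sup>2\<close>, up to the factor from completing the square.\<close>
  have *: "normal_density 0 d x * (x * exp (al * x)) = exp (al\<^sup>2 * d\<^sup>2 / 2) * (normal_density (al * d\<^sup>2) d x * x)" for x
    using normal_density_exp_mult[OF d(1), of x al] by (simp add: mult_ac)
  show "integrable M (\<lambda>w. (W t w - W s w) * exp (al * (W t w - W s w)))"
    by (rule int[of "\<lambda>x. x * exp (al * x)"])
       (use integrable_normal_moment_nz_1[OF d(1)] in \<open>auto simp: *\<close>)
  show "expectation (\<lambda>w. (W t w - W s w) * exp (al * (W t w - W s w))) = al * (t - s) * exp (al\<^sup>2 * (t - s) / 2)"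
    by (subst eq[of "\<lambda>x. x * exp (al * x)"])
       (use d integral_normal_moment_nz_1[OF d(1)] in \<open>auto simp: *\<close>)
qed

end

subsection \<open>Integration over a time interval and discounting\<close>

text \<open>Encoding the horizon as a finite measure gives integrability of bounded functions and
  Fubini on products with \<open>M\<close> without set-integral notation.\<close>

definition leb :: "real \<Rightarrow> real measure" where
  "leb T = restrict_space lborel {0..T}"

lemma space_leb [simp]: "space (leb T) = {0..T}"
  by (simp add: leb_def space_restrict_space)

lemma sets_leb [measurable_cong]: "sets (leb T) = sets (restrict_space borel {0..T})"
  by (simp add: leb_def sets_restrict_space)

lemma finite_measure_leb: "finite_measure (leb T)"
  by (rule finite_measureI) (simp add: leb_def space_restrict_space emeasure_restrict_space emeasure_lborel_Icc_eq)

interpretation leb: finite_measure "leb T" for T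
  by (rule finite_measure_leb)

lemma borel_measurable_leb: "f \<in> borel_measurable borel \<Longrightarrow> f \<in> borel_measurable (leb T)"
  by (simp add: leb_def measurable_restrict_space1)

lemma LBINT_leb: "(LBINT s:{0..T}. f s) = (\<integral>s. f s \<partial>leb T)" for f :: "real \<Rightarrow> real"
  by (simp add: leb_def set_lebesgue_integral_def integral_restrict_space)

lemma set_integrable_leb: "set_integrable lborel {0..T} f \<longleftrightarrow> integrable (leb T) f" for f :: "real \<Rightarrow> real"
  by (simp add: leb_def set_integrable_def integrable_restrict_space)

lemma nn_integral_leb: "(\<integral>\<^sup>+s\<in>{0..T}. f s \<partial>lborel) = (\<integral>\<^sup>+s. f s \<partial>leb T)"
  by (simp add: leb_def nn_integral_restrict_space)

text \<open>Moves the varying upper limit from the measure into an indicator, so that integrals up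
  to different times can be compared and exchanged over one fixed measure.\<close>

lemma
  fixes f :: "real \<Rightarrow> real"
  assumes "s \<le> T"
  shows integral_leb_mono: "(\<integral>v. f v \<partial>leb s) = (\<integral>v. indicator {..s} v * f v \<partial>leb T)"
    and integrable_leb_mono_iff: "integrable (leb s) f \<longleftrightarrow> integrable (leb T) (\<lambda>v. indicator {..s} v * f v)"
proof -
  show "(\<integral>v. f v \<partial>leb s) = (\<integral>v. indicator {..s} v * f v \<partial>leb T)"
    unfolding leb_def by (subst (1 2) integral_restrict_space)
      (use assms in \<open>auto simp: indicator_def intro!: Bochner_Integration.integral_cong\<close>)
  show "integrable (leb s) f \<longleftrightarrow> integrable (leb T) (\<lambda>v. indicator {..s} v * f v)"
    unfolding leb_def by (subst (1 2) integrable_restrict_space)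
      (use assms in \<open>auto simp: indicator_def intro!: Bochner_Integration.integrable_cong\<close>)
qed

lemma nn_integral_leb_mono:
  assumes "s \<le> T"
  shows "(\<integral>\<^sup>+v. f v \<partial>leb s) = (\<integral>\<^sup>+v. indicator {..s} v * f v \<partial>leb T)"
proof -
  have "f v * indicator {0..s} v = (indicator {..s} v * f v) * indicator {0..T} v" for v
    using assms by (auto simp: indicator_def)
  then show ?thesis by (simp add: leb_def nn_integral_restrict_space)
qed

lemma integrable_leb_subset:
  fixes f :: "real \<Rightarrow> real"
  assumes "integrable (leb T) f" "s \<le> T" shows "integrable (leb s) f"
  unfolding integrable_leb_mono_iff[OF assms(2)]
proof (rule Bochner_Integration.integrable_bound[OF assms(1)])
  show "(\<lambda>v. indicator {..s} v * f v) \<in> borel_measurable (leb T)"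
    by (intro borel_measurable_times borel_measurable_leb borel_measurable_integrable[OF assms(1)]) measurable
qed (auto simp: indicator_def)

lemma integrable_leb_continuous:
  fixes f :: "real \<Rightarrow> real"
  assumes "continuous_on {0..T} f" shows "integrable (leb T) f"
  using borel_integrable_atLeastAtMost'[OF assms] by (simp add: set_integrable_leb)

lemma mult_le_abs_mult:
  fixes c :: real
  assumes "0 \<le> s" "s \<le> T" shows "c * s \<le> \<bar>c\<bar> * T"
proof -
  have "c * s \<le> \<bar>c\<bar> * s" using assms by (intro mult_right_mono) auto
  also have "\<dots> \<le> \<bar>c\<bar> * T" using assms by (intro mult_left_mono) auto
  finally show ?thesis .
qed

lemma integrable_leb_exp_mult:
  assumes f: "integrable (leb T) f"
  shows "integrable (leb T) (\<lambda>s. exp (c * s) * f s :: real)"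
proof (rule Bochner_Integration.integrable_bound)
  show "integrable (leb T) (\<lambda>s. exp (\<bar>c\<bar> * T) * f s)" using f by simp
  show "(\<lambda>s. exp (c * s) * f s) \<in> borel_measurable (leb T)"
    by (intro borel_measurable_times borel_measurable_leb borel_measurable_integrable[OF f]) measurable
  show "AE s in leb T. norm (exp (c * s) * f s) \<le> norm (exp (\<bar>c\<bar> * T) * f s)"
    using mult_le_abs_mult[of _ T c] by (intro AE_I2) (auto simp: abs_mult intro!: mult_right_mono)
qed

text \<open>The factor \<open>b\<close> stays on the left, so there is no division and
  \<open>b\<close> may be zero or negative.\<close>

lemma integral_leb_exp:
  assumes "0 \<le> v" "v \<le> T"
  shows "b * (\<integral>s. indicator {v..} s * exp (- b * s) \<partial>leb T) = exp (- b * v) - exp (- b * T)"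
proof -
  have "(\<integral>s. b * exp (- b * s) * indicator {v..T} s \<partial>lborel) = - exp (- b * T) - (- exp (- b * v))"
    by (rule integral_FTC_Icc_real) (use assms in \<open>auto intro!: derivative_eq_intros continuous_intros\<close>)
  moreover have "b * exp (- b * s) * indicator {v..T} s = b * (indicator {0..T} s * (indicator {v..} s * exp (- b * s)))" for s
    using assms by (auto simp: indicator_def)
  ultimately have "(\<integral>s. b * (indicator {0..T} s * (indicator {v..} s * exp (- b * s))) \<partial>lborel) = exp (- b * v) - exp (- b * T)"
    by (simp only:)
  then show ?thesis
    by (simp add: leb_def integral_restrict_space)
qed

text \<open>\<open>disc b T f\<close> is \<open>\<integral>\<^sub>0\<^sup>T exp (- b s) df(s)\<close> for \<open>f 0 = 0\<close>, integrated by parts so that it makes sense for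
  paths of unbounded variation.\<close>

definition disc :: "real \<Rightarrow> real \<Rightarrow> (real \<Rightarrow> real) \<Rightarrow> real" where
  "disc b T f = exp (- b * T) * f T + b * (\<integral>s. exp (- b * s) * f s \<partial>leb T)"

text \<open>The parts formula does not subtract \<open>f 0\<close>, so \<open>disc\<close> counts
  the initial value as a jump at time 0. Constants can therefore be split off a path
  unchanged.\<close>

lemma disc_const:
  assumes "0 \<le> T" shows "disc b T (\<lambda>s. c) = c"
proof -
  have "(\<integral>s. indicator {0..} s * exp (- b * s) \<partial>leb T) = (\<integral>s. exp (- b * s) \<partial>leb T)"
    by (intro Bochner_Integration.integral_cong) auto
  with integral_leb_exp[of 0 T b] assms have "b * (\<integral>s. exp (- b * s) \<partial>leb T) = 1 - exp (- b * T)" by simp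
  then have "b * (\<integral>s. exp (- b * s) * c \<partial>leb T) = (1 - exp (- b * T)) * c"
    by (simp add: mult.assoc[symmetric])
  then show ?thesis by (simp add: disc_def algebra_simps)
qed

lemma disc_add:
  assumes "integrable (leb T) f" "integrable (leb T) g"
  shows "disc b T (\<lambda>s. f s + g s) = disc b T f + disc b T g"
  using integrable_leb_exp_mult[OF assms(1), of "-b"] integrable_leb_exp_mult[OF assms(2), of "-b"]
  by (simp add: disc_def algebra_simps)

lemma disc_cmult: "disc b T (\<lambda>s. c * f s) = c * disc b T f"
proof -
  have "(\<integral>s. exp (- b * s) * (c * f s) \<partial>leb T) = (\<integral>s. c * (exp (- b * s) * f s) \<partial>leb T)"
    by (intro Bochner_Integration.integral_cong) auto
  then show ?thesis by (simp add: disc_def algebra_simps)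
qed

lemma disc_cong:
  assumes "\<And>s. 0 \<le> s \<Longrightarrow> s \<le> T \<Longrightarrow> f s = g s" "0 \<le> T"
  shows "disc b T f = disc b T g"
  unfolding disc_def using assms by (auto intro!: Bochner_Integration.integral_cong)

text \<open>Fubini on the triangle \<open>v \<le> s\<close>: integrating
  \<open>b * exp (- b * s)\<close> from \<open>v\<close> to \<open>T\<close> leaves
  \<open>exp (- b * v) - exp (- b * T)\<close>, and the second part cancels the boundary term of
  \<open>disc\<close>.\<close>

lemma disc_integral:
  assumes g: "integrable (leb T) g" and T: "0 \<le> T"
  shows "disc b T (\<lambda>t. \<integral>v. g v \<partial>leb t) = (\<integral>v. exp (- b * v) * g v \<partial>leb T)"
proof -
  interpret P: pair_sigma_finite "leb T" "leb T" by (simp add: pair_sigma_finite_def leb.sigma_finite_measure_axioms)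
  note [measurable] = borel_measurable_integrable[OF g]
  have id[measurable]: "(\<lambda>x. x) \<in> borel_measurable (leb T)" by (intro borel_measurable_leb) auto
  let ?k = "\<lambda>s v. (indicator {v..} s * exp (- b * s)) * g v"
  have m1: "(\<lambda>p. exp (- b * fst p)) \<in> borel_measurable (leb T \<Otimes>\<^sub>M leb T)" 
    by (rule measurable_compose[OF measurable_fst]) measurable
  have m2: "(\<lambda>p. g (snd p)) \<in> borel_measurable (leb T \<Otimes>\<^sub>M leb T)"
    by measurable
  have fs: "fst \<in> borel_measurable (leb T \<Otimes>\<^sub>M leb T)" "snd \<in> borel_measurable (leb T \<Otimes>\<^sub>M leb T)"
    using measurable_compose[OF measurable_fst id] measurable_compose[OF measurable_snd id] by auto
  have m3: "(\<lambda>p. indicator {snd p..} (fst p) :: real) \<in> borel_measurable (leb T \<Otimes>\<^sub>M leb T)"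
  proof -
    have eq: "(\<lambda>p. indicator {snd p..} (fst p) :: real) = (\<lambda>p. if snd p \<le> fst p then 1 else 0)"
      by (auto simp: indicator_def)
    have "Measurable.pred (leb T \<Otimes>\<^sub>M leb T) (\<lambda>p. snd p \<le> fst p)"
      using fs by measurable
    then show ?thesis by (subst eq, intro measurable_If) auto
  qed
  \<comment> \<open>The dominating function: \<open>exp (\<bar>b\<bar> * T)\<close> bounds the
    discount factor on the interval for either sign of \<open>b\<close>.\<close>
  have "integrable (leb T \<Otimes>\<^sub>M leb T) (\<lambda>(s, v). exp (\<bar>b\<bar> * T) * g v)"
  proof -
    have "integrable (leb T \<Otimes>\<^sub>M leb T) (\<lambda>(s, v). g v)"
      by (rule P.Fubini_integrable) (use g in auto)
    then show ?thesis by (simp add: split_beta')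
  qed
  then have int: "integrable (leb T \<Otimes>\<^sub>M leb T) (case_prod ?k)"
  proof (rule Bochner_Integration.integrable_bound)
    show "case_prod ?k \<in> borel_measurable (leb T \<Otimes>\<^sub>M leb T)"
      using m1 m2 m3 unfolding split_beta' by (intro borel_measurable_times)
    have "- (b * s) \<le> \<bar>b\<bar> * T" if "0 \<le> s" "s \<le> T" for s
      using mult_le_abs_mult[OF that, of "- b"] by simp
    then show "AE p in leb T \<Otimes>\<^sub>M leb T. norm (case_prod ?k p) \<le> norm (case p of (s, v) \<Rightarrow> exp (\<bar>b\<bar> * T) * g v)"
      by (intro AE_I2) (auto simp: space_pair_measure indicator_def abs_mult intro!: mult_right_mono)
  qed
  have "b * (\<integral>s. exp (- b * s) * (\<integral>v. g v \<partial>leb s) \<partial>leb T) = b * (\<integral>s. \<integral>v. ?k s v \<partial>leb T \<partial>leb T)"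
  proof -
    have "exp (- b * s) * (\<integral>v. g v \<partial>leb s) = (\<integral>v. ?k s v \<partial>leb T)" if "s \<in> {0..T}" for s
    proof -
      have "exp (- b * s) * (\<integral>v. g v \<partial>leb s) = (\<integral>v. exp (- b * s) * (indicator {..s} v * g v) \<partial>leb T)"
        using that by (subst integral_leb_mono[of s T]) auto
      also have "\<dots> = (\<integral>v. ?k s v \<partial>leb T)"
        by (intro Bochner_Integration.integral_cong) (auto simp: indicator_def)
      finally show ?thesis .
    qed
    then show ?thesis by (intro arg_cong[where f="\<lambda>z. b * z"] Bochner_Integration.integral_cong) auto
  qed
  also have "\<dots> = b * (\<integral>v. \<integral>s. ?k s v \<partial>leb T \<partial>leb T)"
    by (subst P.Fubini_integral[OF int]) simp
  also have "\<dots> = (\<integral>v. (b * (\<integral>s. indicator {v..} s * exp (- b * s) \<partial>leb T)) * g v \<partial>leb T)"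
    by (simp only: integral_mult_left_zero) (simp add: mult.assoc)
  also have "\<dots> = (\<integral>v. exp (- b * v) * g v - exp (- b * T) * g v \<partial>leb T)"
    by (intro Bochner_Integration.integral_cong refl) (subst integral_leb_exp, auto simp: left_diff_distrib)
  also have "\<dots> = (\<integral>v. exp (- b * v) * g v \<partial>leb T) - exp (- b * T) * (\<integral>v. g v \<partial>leb T)"
    using g integrable_leb_exp_mult[OF g, of "-b"] by simp
  finally show ?thesis by (simp add: disc_def)
qed

text \<open>After \<open>\<tau>\<close> the stopped path is constant and has no increments to
  discount. This trades a random horizon for the deterministic one at which the Ito identities are
  available.\<close>

lemma disc_stopped:
  assumes N: "continuous_on {0..} N" and T: "0 \<le> T" "0 \<le> \<tau>"
  shows "disc b T (\<lambda>s. N (min s \<tau>)) = disc b (min T \<tau>) N"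
proof (cases "T \<le> \<tau>")
  case True
  then show ?thesis using T by (auto intro!: disc_cong simp: min_def)
next
  case False
  have c: "continuous_on {0..T} (\<lambda>s. N (min s \<tau>))"
    using T by (intro continuous_on_compose2[OF N] continuous_intros) auto
  have i: "integrable (leb T) (\<lambda>s. N (min s \<tau>))" "integrable (leb \<tau>) N"
    using integrable_leb_continuous[OF c] integrable_leb_continuous[OF continuous_on_subset[OF N], of \<tau>] by auto
  \<comment> \<open>Subtracting the value at \<open>\<tau>\<close> makes the stopped path vanish
    beyond \<open>\<tau>\<close>, which removes the boundary term and cuts the integral off
    there.\<close>
  have "disc b T (\<lambda>s. N (min s \<tau>)) - N \<tau> = disc b T (\<lambda>s. N (min s \<tau>) + - N \<tau>)"
    using T by (subst disc_add) (auto simp: disc_const i)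
  also have "\<dots> = b * (\<integral>s. exp (- b * s) * (N (min s \<tau>) - N \<tau>) \<partial>leb T)"
    using False by (simp add: disc_def)
  also have "\<dots> = b * (\<integral>s. indicator {..\<tau>} s * (exp (- b * s) * (N s - N \<tau>)) \<partial>leb T)"
    by (intro arg_cong[where f="\<lambda>z. b * z"] Bochner_Integration.integral_cong) (auto simp: indicator_def)
  also have "\<dots> = b * (\<integral>s. exp (- b * s) * (N s - N \<tau>) \<partial>leb \<tau>)"
    using False by (subst integral_leb_mono[of \<tau> T]) auto
  also have "\<dots> = disc b \<tau> (\<lambda>s. N s + - N \<tau>)"
    by (simp add: disc_def)
  also have "\<dots> = disc b \<tau> N - N \<tau>"
    using T by (subst disc_add) (auto simp: disc_const i)
  finally show ?thesis using False by (simp add: min_def)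
qed

text \<open>A pathwise product rule for \<open>exp (- b * t) * f t\<close>. When
  \<open>disc b T\<close> is applied to the equation solved for \<open>N\<close>, the drift part
  \<open>b * f\<close> reproduces the integral term of \<open>disc b T f\<close> and cancels
  it.\<close>

lemma disc_path:
  assumes f: "continuous_on {0..T} f" and h: "integrable (leb T) (\<lambda>s. b * f s + g s)" and T: "0 \<le> T"
    and eq: "\<And>t. 0 \<le> t \<Longrightarrow> t \<le> T \<Longrightarrow> f t = x + (\<integral>s. b * f s + g s \<partial>leb t) + N t"
  shows "exp (- b * T) * f T = x + (\<integral>s. exp (- b * s) * g s \<partial>leb T) + disc b T N"
    and "integrable (leb T) g"
proof -
  have fi: "integrable (leb T) f" using f by (rule integrable_leb_continuous)
  from Bochner_Integration.integrable_diff[OF h integrable_mult_right[OF fi, of b]]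
  show gi: "integrable (leb T) g" by simp
  define G where "G t = (\<integral>s. b * f s + g s \<partial>leb t)" for t
  have GN: "G t = f t - x - N t" if "t \<in> {0..T}" for t using eq[of t] that by (simp add: G_def)
  \<comment> \<open>Continuity of the primitive makes it integrable in time, as is needed to split
    \<open>disc\<close> over the sum.\<close>
  have Gc: "continuous_on {0..T} G"
  proof -
    have hb: "(\<lambda>s. b * f s + g s) integrable_on {0..T}" 
      using h by (auto simp: set_integrable_leb[symmetric] intro: set_borel_integral_eq_integral(1))
    have "G t = integral {0..t} (\<lambda>s. b * f s + g s)" if "t \<in> {0..T}" for t
      unfolding G_def LBINT_leb[symmetric]
      by (rule set_borel_integral_eq_integral(2)) (use integrable_leb_subset[OF h, of t] that in \<open>auto simp: set_integrable_leb\<close>)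
    with indefinite_integral_continuous_1[OF hb] show ?thesis
      by (subst continuous_on_cong[OF refl]) auto
  qed
  have Gi: "integrable (leb T) G" by (rule integrable_leb_continuous[OF Gc])
  have "disc b T N = disc b T (\<lambda>s. (f s + - x) + -1 * G s)"
    using GN T by (intro disc_cong) (auto simp: algebra_simps)
  also have "\<dots> = disc b T f - x - disc b T G"
    using fi Gi T by (subst disc_add, simp, simp, subst disc_add) (auto simp: disc_const disc_cmult[of _ _ "-1", simplified])
  also have "disc b T G = (\<integral>v. exp (- b * v) * (b * f v + g v) \<partial>leb T)"
    unfolding G_def by (rule disc_integral[OF h T])
  also have "\<dots> = b * (\<integral>v. exp (- b * v) * f v \<partial>leb T) + (\<integral>v. exp (- b * v) * g v \<partial>leb T)"
    using integrable_leb_exp_mult[OF fi, of "-b"] integrable_leb_exp_mult[OF gi, of "-b"]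
    by (simp add: algebra_simps)
  finally show "exp (- b * T) * f T = x + (\<integral>s. exp (- b * s) * g s \<partial>leb T) + disc b T N"
    by (simp add: disc_def)
qed

subsection \<open>Continuous versions and exponential martingales\<close>

lemma measurable_process_leb:
  assumes "measurable_process M Z"
  shows "(\<lambda>(w, t). Z t w) \<in> borel_measurable (M \<Otimes>\<^sub>M leb T)"
proof -
  have "(\<lambda>p. (fst p, snd p)) \<in> M \<Otimes>\<^sub>M leb T \<rightarrow>\<^sub>M M \<Otimes>\<^sub>M restrict_space borel {0..}"
  proof (rule measurable_Pair)
    have "(\<lambda>t. t) \<in> leb T \<rightarrow>\<^sub>M restrict_space borel {0..}"
      by (rule measurable_restrict_space2) (auto intro: borel_measurable_leb)
    then show "snd \<in> M \<Otimes>\<^sub>M leb T \<rightarrow>\<^sub>M restrict_space borel {0..}"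
      by (rule measurable_compose[OF measurable_snd])
  qed simp
  from measurable_compose[OF this assms[unfolded measurable_process_def]] show ?thesis
    by (simp add: split_beta')
qed

lemma measurable_processI:
  assumes "(\<lambda>(w, t). Z t w) \<in> borel_measurable (M \<Otimes>\<^sub>M borel)"
  shows "measurable_process M Z"
proof -
  have "(\<lambda>p. (fst p, snd p)) \<in> M \<Otimes>\<^sub>M restrict_space borel {0..} \<rightarrow>\<^sub>M M \<Otimes>\<^sub>M (borel :: real measure)"
  proof (rule measurable_Pair)
    have "(\<lambda>t. t) \<in> restrict_space borel {0..} \<rightarrow>\<^sub>M (borel :: real measure)"
      by (rule measurable_restrict_space1) auto
    then show "snd \<in> M \<Otimes>\<^sub>M restrict_space borel {0..} \<rightarrow>\<^sub>M (borel :: real measure)"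
      by (rule measurable_compose[OF measurable_snd])
  qed simp
  from measurable_compose[OF this assms] show ?thesis
    by (simp add: split_beta' measurable_process_def)
qed

lemma measurable_process_section:
  assumes "measurable_process M Z" "0 \<le> t"
  shows "Z t \<in> borel_measurable M"
proof -
  have "(\<lambda>w. (w, t)) \<in> M \<rightarrow>\<^sub>M M \<Otimes>\<^sub>M restrict_space borel {0..}"
    using assms(2) by (intro measurable_Pair) (auto simp: space_restrict_space)
  from measurable_compose[OF this assms(1)[unfolded measurable_process_def]] show ?thesis by simp
qed

text \<open>Paths are only almost surely continuous. Setting the exceptional paths to \<open>0\<close> preserves
  adaptedness, since the filtration is complete, and gives joint measurability.\<close>

definition cv :: "(real \<Rightarrow> 'a \<Rightarrow> real) \<Rightarrow> real \<Rightarrow> 'a \<Rightarrow> real" where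
  "cv Z t w = (if continuous_on {0..} (\<lambda>t. Z t w) then Z t w else 0)"

lemma continuous_on_cv: "continuous_on {0..} (\<lambda>t. cv Z t w)"
  by (cases "continuous_on {0..} (\<lambda>t. Z t w)") (auto simp: cv_def)

lemma AE_cv: "continuous_paths M Z \<Longrightarrow> AE w in M. \<forall>t. cv Z t w = Z t w"
  unfolding continuous_paths_def by (erule eventually_mono) (auto simp: cv_def)

text \<open>A path is the limit of its values at grid points of mesh \<open>1 / Suc n\<close> just
  below \<open>t\<close>. Each approximant depends on \<open>t\<close> only through an integer, so a
  countable case split makes it jointly measurable.\<close>

lemma measurable_process_continuous:
  assumes m: "\<And>t. 0 \<le> t \<Longrightarrow> Z t \<in> borel_measurable M"
    and c: "\<And>w. continuous_on {0..} (\<lambda>t. Z t w)"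
  shows "measurable_process M Z"
proof -
  let ?q = "\<lambda>n t. real_of_int \<lfloor>real (Suc n) * max 0 t\<rfloor> / real (Suc n)"
  have q0: "0 \<le> ?q n t" for n t by auto
  have ql: "(\<lambda>n. ?q n t) \<longlonglongrightarrow> max 0 t" for t
  proof (rule tendsto_sandwich)
    let ?m = "max 0 t"
    have "real (Suc n) * ?m - 1 \<le> real_of_int \<lfloor>real (Suc n) * ?m\<rfloor>" for n by linarith
    then have "(real (Suc n) * ?m - 1) / real (Suc n) \<le> ?q n t" for n
      by (intro divide_right_mono) auto
    moreover have "(real (Suc n) * ?m - 1) / real (Suc n) = ?m - inverse (real (Suc n))" for n
      by (simp add: field_simps)
    ultimately show "\<forall>\<^sub>F n in sequentially. ?m - inverse (real (Suc n)) \<le> ?q n t" by simp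
    have "?q n t \<le> (real (Suc n) * ?m) / real (Suc n)" for n
      by (intro divide_right_mono) auto
    then show "\<forall>\<^sub>F n in sequentially. ?q n t \<le> ?m" by simp
    show "(\<lambda>n. ?m - inverse (real (Suc n))) \<longlonglongrightarrow> ?m"
      using tendsto_diff[OF tendsto_const LIMSEQ_inverse_real_of_nat] by simp
  qed auto
  have "(\<lambda>p. Z (max 0 (snd p)) (fst p)) \<in> borel_measurable (M \<Otimes>\<^sub>M borel)"
  proof (rule borel_measurable_LIMSEQ_real)
    fix p :: "'a \<times> real"
    show "(\<lambda>n. Z (?q n (snd p)) (fst p)) \<longlonglongrightarrow> Z (max 0 (snd p)) (fst p)"
      by (rule continuous_on_tendsto_compose[OF c ql]) (use q0 in auto)
  next
    fix n
    \<comment> \<open>The clamp \<open>max 0 i\<close> keeps the grid time nonnegative for every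
      integer, since \<open>Z\<close> is known to be measurable only at such times.\<close>
    have "(\<lambda>p. (\<lambda>i p. Z (real_of_int (max 0 i) / real (Suc n)) (fst p)) \<lfloor>real (Suc n) * max 0 (snd p)\<rfloor> p) \<in> borel_measurable (M \<Otimes>\<^sub>M borel)"
    proof (rule measurable_compose_countable[where f="\<lambda>i p. Z (real_of_int (max 0 i) / real (Suc n)) (fst p)" and
          g="\<lambda>p. \<lfloor>real (Suc n) * max 0 (snd p)\<rfloor>"])
      fix i :: int show "(\<lambda>p. Z (real_of_int (max 0 i) / real (Suc n)) (fst p)) \<in> borel_measurable (M \<Otimes>\<^sub>M borel)"
        by (rule measurable_compose[OF measurable_fst m]) auto
      show "(\<lambda>p. \<lfloor>real (Suc n) * max 0 (snd p)\<rfloor>) \<in> measurable (M \<Otimes>\<^sub>M borel) (count_space UNIV)"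
        by measurable
    qed
    moreover have "max 0 \<lfloor>real (Suc n) * max 0 (t::real)\<rfloor> = \<lfloor>real (Suc n) * max 0 t\<rfloor>" for t by auto
    ultimately show "(\<lambda>p. Z (?q n (snd p)) (fst p)) \<in> borel_measurable (M \<Otimes>\<^sub>M borel)" by simp
  qed
  then have "measurable_process M (\<lambda>t. Z (max 0 t))"
    by (intro measurable_processI) (simp add: split_beta')
  then show ?thesis
    unfolding measurable_process_def
    by (subst (asm) measurable_cong[where g="\<lambda>(w, t). Z t w"]) (auto simp: space_pair_measure space_restrict_space)
qed

context brownian_motion
begin

lemma pair_sigma_finite_leb: "pair_sigma_finite M (leb T)"
  by (simp add: pair_sigma_finite_def leb.sigma_finite_measure_axioms sigma_finite_measure_axioms)

abbreviation "PM T \<equiv> M \<Otimes>\<^sub>M leb T"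

lemma integrable_pairI:
  fixes f :: "real \<Rightarrow> 'a \<Rightarrow> real"
  assumes m: "(\<lambda>(w, s). f s w) \<in> borel_measurable (PM T)"
    and b: "\<And>s. 0 \<le> s \<Longrightarrow> s \<le> T \<Longrightarrow> (\<integral>\<^sup>+w. ennreal (norm (f s w)) \<partial>M) \<le> ennreal C"
  shows "integrable (PM T) (\<lambda>(w, s). f s w)"
proof (rule integrableI_bounded[OF m])
  interpret P: pair_sigma_finite M "leb T" by (rule pair_sigma_finite_leb)
  have "(\<integral>\<^sup>+p. ennreal (norm (case p of (w, s) \<Rightarrow> f s w)) \<partial>PM T) = (\<integral>\<^sup>+s. \<integral>\<^sup>+w. ennreal (norm (f s w)) \<partial>M \<partial>leb T)"
    using m by (subst P.nn_integral_snd[symmetric]) auto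
  also have "\<dots> \<le> (\<integral>\<^sup>+s. ennreal C \<partial>leb T)" using b by (intro nn_integral_mono) auto
  also have "\<dots> < \<infinity>" using leb.emeasure_finite[of T "{0..T}"] by (simp add: ennreal_mult_eq_top_iff less_top[symmetric])
  finally show "(\<integral>\<^sup>+p. ennreal (norm (case p of (w, s) \<Rightarrow> f s w)) \<partial>PM T) < \<infinity>" .
qed

lemma adapted_cv:
  assumes Z: "adapted F Z" and c: "continuous_paths M Z"
  shows "adapted F (cv Z)"
  unfolding adapted_def
proof (intro allI impI)
  fix t :: real assume t: "0 \<le> t"
  obtain N where N: "N \<in> null_sets M" "{w\<in>space M. \<not> continuous_on {0..} (\<lambda>t. Z t w)} \<subseteq> N"
    using c unfolding continuous_paths_def eventually_ae_filter by blast
  have "{w\<in>space M. \<not> continuous_on {0..} (\<lambda>t. Z t w)} \<in> sets (F 0)"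
    by (rule complete[OF N])
  then have "{w\<in>space M. \<not> continuous_on {0..} (\<lambda>t. Z t w)} \<in> sets (F t)"
    using filtration_mono[of 0 t] t by auto
  then have s: "Measurable.pred (F t) (\<lambda>w. \<not> continuous_on {0..} (\<lambda>t. Z t w))"
    using t by (simp add: pred_def)
  have [measurable]: "Measurable.pred (F t) (\<lambda>w. continuous_on {0..} (\<lambda>t. Z t w))"
    using pred_intros_logic(2)[OF s] by simp
  have [measurable]: "Z t \<in> borel_measurable (F t)" using Z t by (auto simp: adapted_def)
  show "cv Z t \<in> borel_measurable (F t)"
    unfolding cv_def by measurable
qed

lemma measurable_process_cv:
  assumes Z: "adapted F Z" and c: "continuous_paths M Z"
  shows "measurable_process M (cv Z)"
  using adapted_cv[OF assms] F_measurable_M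
  by (intro measurable_process_continuous continuous_on_cv) (auto simp: adapted_def)

text \<open>Built on \<open>cv W\<close> so that every path is continuous and the process is jointly
  measurable; in return, relations with the increments of \<open>W\<close> hold only almost
  surely.\<close>

definition mart :: "real \<Rightarrow> real \<Rightarrow> 'a \<Rightarrow> real" where
  "mart al t w = exp (al * cv W t w - al\<^sup>2 * t / 2)"

lemma mart_pos [simp]: "0 < mart al t w" "0 \<le> mart al t w" "mart al t w \<noteq> 0" "\<bar>mart al t w\<bar> = mart al t w"
  by (auto simp: mart_def)

lemma mart_F:
  assumes "0 \<le> t" shows "mart al t \<in> borel_measurable (F t)"
proof -
  have [measurable]: "cv W t \<in> borel_measurable (F t)"
    using adapted_cv[OF W_adapted W_continuous] assms by (auto simp: adapted_def)
  show ?thesis unfolding mart_def by measurable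
qed

lemma mart_M [measurable]: "0 \<le> t \<Longrightarrow> mart al t \<in> borel_measurable M"
  using mart_F F_measurable_M by blast

lemma measurable_process_mart: "measurable_process M (mart al)"
  by (intro measurable_process_continuous mart_M) (auto simp: mart_def intro!: continuous_intros continuous_on_cv)

text \<open>The family is closed under products up to a deterministic factor, so all mixed moments
  reduce to the expectation 1 of a single member.\<close>

lemma mart_mult: "mart al t w * mart be t w = exp (al * be * t) * mart (al + be) t w"
  by (simp add: mart_def exp_add[symmetric] algebra_simps power2_eq_square add_divide_distrib)

lemma mart_square: "(mart al t w)\<^sup>2 = exp (al\<^sup>2 * t) * mart (2 * al) t w"
  using mart_mult[of al t w al] by (simp add: power2_eq_square)

lemma AE_cvW: "AE w in M. \<forall>t. cv W t w = W t w"
  by (rule AE_cv[OF W_continuous])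

lemma AE_mart_ratio:
  "AE w in M. mart al t w = mart al s w * (exp (al * (W t w - W s w)) * exp (- al\<^sup>2 * (t - s) / 2))"
  using AE_cvW by eventually_elim (simp add: mart_def exp_add[symmetric] algebra_simps diff_divide_distrib)

lemma AE_mart_0: "AE w in M. mart al 0 w = 1"
  using AE_cvW W_zero by eventually_elim (simp add: mart_def)

text \<open>The martingale property, tested against an \<open>F s\<close>-measurable factor in place
  of a conditional expectation: the ratio of \<open>mart\<close> at \<open>t\<close> and
  \<open>s\<close> is independent of \<open>F s\<close> and has mean 1.\<close>

lemma mart_expectation_mult:
  assumes st: "0 \<le> s" "s \<le> t" and Y: "Y \<in> borel_measurable (F s)" and i: "integrable M (\<lambda>w. mart al s w * Y w)"
  shows "integrable M (\<lambda>w. mart al t w * Y w)"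
    and "expectation (\<lambda>w. mart al t w * Y w) = expectation (\<lambda>w. mart al s w * Y w)"
proof -
  have "integrable M (\<lambda>w. mart al t w * Y w) \<and> expectation (\<lambda>w. mart al t w * Y w) = expectation (\<lambda>w. mart al s w * Y w)"
  proof (cases "s = t")
    case False
    then have st': "s < t" using st by auto
    let ?g = "\<lambda>x. exp (al * x) * exp (- al\<^sup>2 * (t - s) / 2)"
    let ?Y = "\<lambda>w. mart al s w * Y w"
    have Ym: "?Y \<in> borel_measurable (F s)" using mart_F[OF st(1)] Y by measurable
    have gi: "integrable M (\<lambda>w. ?g (W t w - W s w))" using increment_moments(5)[OF st(1) st'] by simp
    have [measurable]: "Y \<in> borel_measurable M" using Y F_measurable_M st by blast
    have g1: "expectation (\<lambda>w. ?g (W t w - W s w)) = 1"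
      using increment_moments(5,6)[OF st(1) st', of al] by (simp add: exp_minus)
    have gm: "?g \<in> borel_measurable borel" by measurable
    note A = increment_expectation_mult[OF st(1) st' Ym gm i gi]
    have eq: "AE w in M. ?Y w * ?g (W t w - W s w) = mart al t w * Y w"
      using AE_mart_ratio[of al t s] by eventually_elim simp
    have m: "(\<lambda>w. mart al t w * Y w) \<in> borel_measurable M"
      using st by (intro borel_measurable_times mart_M) auto
    have "integrable M (\<lambda>w. mart al t w * Y w)"
      using A(1) eq m by (subst integrable_cong_AE[symmetric, OF _ _ eq]) auto
    moreover have "expectation (\<lambda>w. mart al t w * Y w) = expectation (\<lambda>w. mart al s w * Y w)"
    proof -
      have "expectation (\<lambda>w. mart al t w * Y w) = expectation (\<lambda>w. ?Y w * ?g (W t w - W s w))"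
        using A(1) m by (intro integral_cong_AE[OF _ _ eq, symmetric]) auto
      then show ?thesis unfolding A(2) g1 by simp
    qed
    ultimately show ?thesis by simp
  qed (use i in simp)
  then show "integrable M (\<lambda>w. mart al t w * Y w)"
    "expectation (\<lambda>w. mart al t w * Y w) = expectation (\<lambda>w. mart al s w * Y w)" by auto
qed

text \<open>The martingale property for extended nonnegative factors, without integrability. It is
  applied to consumption, whose product with \<open>mart\<close> is not known to be integrable
  beforehand.\<close>

lemma mart_nn_integral_mult:
  assumes st: "0 \<le> s" "s \<le> t" and Y: "Y \<in> borel_measurable (F s)"
  shows "(\<integral>\<^sup>+w. ennreal (mart al t w) * Y w \<partial>M) = (\<integral>\<^sup>+w. ennreal (mart al s w) * Y w \<partial>M)"
proof (cases "s = t")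
  case False
  then have st': "s < t" using st by auto
  let ?g = "\<lambda>x. ennreal (exp (al * x) * exp (- al\<^sup>2 * (t - s) / 2))"
  let ?Y = "\<lambda>w. ennreal (mart al s w) * Y w"
  have Ym: "?Y \<in> borel_measurable (F s)" using mart_F[OF st(1)] Y by measurable
  have gm: "?g \<in> borel_measurable borel" by measurable
  have g1: "(\<integral>\<^sup>+w. ?g (W t w - W s w) \<partial>M) = 1"
    using increment_moments(5,6)[OF st(1) st', of al]
    by (subst nn_integral_eq_integral) (auto simp: exp_minus)
  have "(\<integral>\<^sup>+w. ennreal (mart al t w) * Y w \<partial>M) = (\<integral>\<^sup>+w. ?Y w * ?g (W t w - W s w) \<partial>M)"
  proof (rule nn_integral_cong_AE)
    show "AE w in M. ennreal (mart al t w) * Y w = ?Y w * ?g (W t w - W s w)"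
      using AE_mart_ratio[of al t s] by eventually_elim (simp add: ennreal_mult mult_ac)
  qed
  also have "\<dots> = (\<integral>\<^sup>+w. ?Y w \<partial>M)"
    by (subst indep_var_nn_integral_mult[OF increment_indep_var[OF st(1) st' Ym gm]]) (simp only: g1 mult_1_right)
  finally show ?thesis .
qed simp

lemma mart_moments:
  assumes "0 \<le> t"
  shows "integrable M (mart al t)" "expectation (mart al t) = 1"
    and "sq_integrable M (mart al t)" "expectation (\<lambda>w. (mart al t w)\<^sup>2) = exp (al\<^sup>2 * t)"
proof -
  \<comment> \<open>General in \<open>be\<close> because the second moment calls it with
    \<open>2 * al\<close>. The start is time 0, where \<open>mart\<close> is 1 almost
    surely.\<close>
  have *: "integrable M (mart be t) \<and> expectation (mart be t) = 1" for be
  proof -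
    have e: "AE w in M. 1 = mart be 0 w * 1" using AE_mart_0[of be] by eventually_elim simp
    have i: "integrable M (\<lambda>w. mart be 0 w * 1)"
      using integrable_cong_AE[THEN iffD1, OF _ _ e] by auto
    have "expectation (\<lambda>w. mart be 0 w * 1) = 1"
      using integral_cong_AE[OF _ _ e] by (simp add: prob_space)
    with mart_expectation_mult[OF _ assms _ i] show ?thesis by simp
  qed
  then show "integrable M (mart al t)" "expectation (mart al t) = 1" by auto
  show "sq_integrable M (mart al t)" "expectation (\<lambda>w. (mart al t w)\<^sup>2) = exp (al\<^sup>2 * t)"
    using *[of "2 * al"] assms by (auto simp: sq_integrable_def mart_square)
qed

text \<open>The random weight \<open>K\<close> does not depend on time, so Fubini carries the
  expectation inside \<open>disc\<close>; the bound uniform in \<open>s\<close> gives integrability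
  on the product space.\<close>

lemma disc_expectation:
  assumes N: "measurable_process M N" and K[measurable]: "K \<in> borel_measurable M" and T: "0 \<le> T"
    and i: "\<And>s. 0 \<le> s \<Longrightarrow> s \<le> T \<Longrightarrow> integrable M (\<lambda>w. K w * N s w)"
    and b: "\<And>s. 0 \<le> s \<Longrightarrow> s \<le> T \<Longrightarrow> expectation (\<lambda>w. \<bar>K w * N s w\<bar>) \<le> C"
  shows "integrable M (\<lambda>w. K w * disc b T (\<lambda>s. N s w))"
    and "expectation (\<lambda>w. K w * disc b T (\<lambda>s. N s w)) = disc b T (\<lambda>s. expectation (\<lambda>w. K w * N s w))"
proof -
  interpret P: pair_sigma_finite M "leb T" by (rule pair_sigma_finite_leb)
  note Nm[measurable] = measurable_process_leb[OF N, of T]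
  have em: "(\<lambda>p. exp (- b * snd p)) \<in> borel_measurable (PM T)"
    by (rule measurable_compose[OF measurable_snd]) (intro borel_measurable_leb; measurable)
  let ?k = "\<lambda>w s. exp (- b * s) * (K w * N s w)"
  have km: "(\<lambda>(w, s). ?k w s) \<in> borel_measurable (PM T)"
    using em Nm unfolding split_beta' by measurable
  have int: "integrable (PM T) (\<lambda>(w, s). ?k w s)"
  proof (rule integrable_pairI[OF km])
    fix s assume s: "0 \<le> s" "s \<le> T"
    have "norm (?k w s) = exp (- b * s) * \<bar>K w * N s w\<bar>" for w by (simp add: abs_mult)
    moreover have "integrable M (\<lambda>w. exp (- b * s) * \<bar>K w * N s w\<bar>)"
      using integrable_abs[OF i[OF s]] by (rule integrable_mult_right)
    ultimately have "(\<integral>\<^sup>+w. ennreal (norm (?k w s)) \<partial>M) = ennreal (exp (- b * s) * expectation (\<lambda>w. \<bar>K w * N s w\<bar>))"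
      by (simp only:) (subst nn_integral_eq_integral, auto)
    also have "\<dots> \<le> ennreal (exp (\<bar>b\<bar> * T) * C)"
      using mult_le_abs_mult[OF s, of "- b"] b[OF s] by (intro ennreal_leI mult_mono) auto
    finally show "(\<integral>\<^sup>+w. ennreal (norm (?k w s)) \<partial>M) \<le> ennreal (exp (\<bar>b\<bar> * T) * C)" .
  qed
  have eq: "K w * disc b T (\<lambda>s. N s w) = exp (- b * T) * (K w * N T w) + b * (\<integral>s. ?k w s \<partial>leb T)" for w
  proof -
    have "(\<integral>s. ?k w s \<partial>leb T) = (\<integral>s. K w * (exp (- b * s) * N s w) \<partial>leb T)"
      by (intro Bochner_Integration.integral_cong) auto
    then show ?thesis by (simp add: disc_def algebra_simps)
  qed
  have i1: "integrable M (\<lambda>w. exp (- b * T) * (K w * N T w))" using i[of T] T by simp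
  have i2: "integrable M (\<lambda>w. b * (\<integral>s. ?k w s \<partial>leb T))" using P.integrable_fst[OF int] by simp
  show "integrable M (\<lambda>w. K w * disc b T (\<lambda>s. N s w))"
    unfolding eq by (rule Bochner_Integration.integrable_add[OF i1 i2])
  have "expectation (\<lambda>w. K w * disc b T (\<lambda>s. N s w)) =
      exp (- b * T) * expectation (\<lambda>w. K w * N T w) + b * expectation (\<lambda>w. \<integral>s. ?k w s \<partial>leb T)"
    unfolding eq by (subst Bochner_Integration.integral_add[OF i1 i2]) simp
  also have "expectation (\<lambda>w. \<integral>s. ?k w s \<partial>leb T) = (\<integral>s. expectation (\<lambda>w. ?k w s) \<partial>leb T)"
    by (rule P.Fubini_integral[OF int, symmetric])
  finally show "expectation (\<lambda>w. K w * disc b T (\<lambda>s. N s w)) = disc b T (\<lambda>s. expectation (\<lambda>w. K w * N s w))"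
    by (simp add: disc_def)
qed

end

subsection \<open>The isometry and the Girsanov identity for step processes\<close>

lemma integral_double_sum:
  fixes f :: "nat \<Rightarrow> nat \<Rightarrow> 'b \<Rightarrow> real"
  assumes "\<And>i j. i < n \<Longrightarrow> j < m \<Longrightarrow> integrable N (f i j)"
  shows "(\<integral>x. (\<Sum>i<n. \<Sum>j<m. f i j x) \<partial>N) = (\<Sum>i<n. \<Sum>j<m. \<integral>x. f i j x \<partial>N)"
proof -
  have "(\<integral>x. (\<Sum>i<n. \<Sum>j<m. f i j x) \<partial>N) = (\<Sum>i<n. \<integral>x. (\<Sum>j<m. f i j x) \<partial>N)"
    using assms by (intro Bochner_Integration.integral_sum) auto
  also have "\<dots> = (\<Sum>i<n. \<Sum>j<m. \<integral>x. f i j x \<partial>N)"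
    using assms by (intro sum.cong Bochner_Integration.integral_sum) auto
  finally show ?thesis .
qed

context brownian_motion
begin

definition bdd_meas :: "real \<Rightarrow> ('a \<Rightarrow> real) \<Rightarrow> bool" where
  "bdd_meas t Y \<longleftrightarrow> Y \<in> borel_measurable (F t) \<and> (\<exists>B. \<forall>w\<in>space M. \<bar>Y w\<bar> \<le> B)"

lemma bdd_meas_mono: "0 \<le> s \<Longrightarrow> s \<le> t \<Longrightarrow> bdd_meas s Y \<Longrightarrow> bdd_meas t Y"
  unfolding bdd_meas_def using F_measurable_mono by blast

lemma bdd_meas_mult:
  assumes "bdd_meas t Y" "bdd_meas t Z" shows "bdd_meas t (\<lambda>w. Y w * Z w)"
proof -
  obtain B C where "\<forall>w\<in>space M. \<bar>Y w\<bar> \<le> B" "\<forall>w\<in>space M. \<bar>Z w\<bar> \<le> C"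
    using assms by (auto simp: bdd_meas_def)
  then have "\<forall>w\<in>space M. \<bar>Y w * Z w\<bar> \<le> B * C"
    by (auto simp: abs_mult intro!: mult_mono order_trans[OF abs_ge_zero])
  then show ?thesis using assms unfolding bdd_meas_def by auto
qed

lemma bdd_meas_M: "0 \<le> t \<Longrightarrow> bdd_meas t Y \<Longrightarrow> Y \<in> borel_measurable M"
  unfolding bdd_meas_def using F_measurable_M by blast

lemma bdd_meas_sq_integrable:
  assumes "0 \<le> t" "bdd_meas t Y" "sq_integrable M f"
  shows "sq_integrable M (\<lambda>w. Y w * f w)"
proof -
  obtain B where "\<And>w. w \<in> space M \<Longrightarrow> \<bar>Y w\<bar> \<le> B" using assms(2) by (auto simp: bdd_meas_def)
  then show ?thesis by (rule sq_integrable_bounded_mult[OF assms(3) bdd_meas_M[OF assms(1,2)]])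
qed

lemma bdd_meas_integrable:
  assumes "0 \<le> t" "bdd_meas t Y" shows "integrable M Y"
proof -
  obtain B where B: "\<forall>w\<in>space M. \<bar>Y w\<bar> \<le> B" using assms by (auto simp: bdd_meas_def)
  show ?thesis
    by (rule integrable_const_bound[of _ B]) (use B bdd_meas_M[OF assms] in auto)
qed

lemma increment_sq_integrable:
  assumes "0 \<le> a" "a \<le> b" shows "sq_integrable M (\<lambda>w. W b w - W a w)"
  using assms increment_moments(3)[of a b] by (cases "a = b") (auto simp: sq_integrable_def)

lemma increment_mean_zero:
  assumes "0 \<le> c" "c \<le> d" "Y \<in> borel_measurable (F c)" "integrable M Y"
  shows "expectation (\<lambda>w. Y w * (W d w - W c w)) = 0"
proof (cases "c = d")
  case False
  then have "c < d" using assms by simp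
  from increment_expectation_mult(2)[OF assms(1) this assms(3) _ assms(4), of "\<lambda>x. x"]
    increment_moments(1,2)[OF assms(1) this] show ?thesis by simp
qed simp

lemma increment_integrable_mult:
  assumes "0 \<le> t" "bdd_meas t Y" "0 \<le> a" "a \<le> b" "0 \<le> c" "c \<le> d"
  shows "integrable M (\<lambda>w. Y w * (W b w - W a w) * (W d w - W c w))"
  by (intro sq_integrable_mult_integrable bdd_meas_sq_integrable[OF assms(1,2)] increment_sq_integrable assms)

lemma bdd_meas_increment_F:
  assumes "0 \<le> a" "a \<le> c" "b \<le> c" "0 \<le> b" "bdd_meas c Y"
  shows "(\<lambda>w. Y w * (W b w - W a w)) \<in> borel_measurable (F c)"
proof -
  have "W b \<in> borel_measurable (F c)" "W a \<in> borel_measurable (F c)"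
    using assms F_measurable_mono[OF _ _ W_F] by auto
  then show ?thesis using assms(5) by (auto simp: bdd_meas_def)
qed

lemma increment_product_disjoint:
  assumes "0 \<le> a" "a \<le> b" "b \<le> c" "c \<le> d" "bdd_meas c Y"
  shows "expectation (\<lambda>w. Y w * (W b w - W a w) * (W d w - W c w)) = 0"
proof (rule increment_mean_zero)
  show "integrable M (\<lambda>w. Y w * (W b w - W a w))"
    using sq_integrable_mult_integrable[OF bdd_meas_sq_integrable[OF _ assms(5), of "\<lambda>_. 1"] increment_sq_integrable[of a b]] assms
    by (simp add: sq_integrable_def)
qed (use assms bdd_meas_increment_F in auto)

lemma increment_product_same_start:
  assumes c: "0 \<le> c" "c \<le> m" "m \<le> d" and Y: "bdd_meas c Y"
  shows "expectation (\<lambda>w. Y w * (W m w - W c w) * (W d w - W c w)) = expectation Y * (m - c)"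
proof (cases "c = m")
  case False
  then have cm: "c < m" using c by simp
  have i: "integrable M Y" using bdd_meas_integrable[OF c(1) Y] .
  have "Y w * (W m w - W c w) * (W d w - W c w) = Y w * (W m w - W c w) * (W m w - W c w)
      + Y w * (W m w - W c w) * (W d w - W m w)" for w by (simp add: algebra_simps)
  then have "expectation (\<lambda>w. Y w * (W m w - W c w) * (W d w - W c w)) =
      expectation (\<lambda>w. Y w * (W m w - W c w) * (W m w - W c w))
      + expectation (\<lambda>w. Y w * (W m w - W c w) * (W d w - W m w))"
    by (simp only:) (intro Bochner_Integration.integral_add increment_integrable_mult[OF c(1) Y], use c in auto)
  also have "expectation (\<lambda>w. Y w * (W m w - W c w) * (W d w - W m w)) = 0"
    using c bdd_meas_mono[OF c(1,2) Y] by (intro increment_product_disjoint) auto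
  also have "expectation (\<lambda>w. Y w * (W m w - W c w) * (W m w - W c w)) = expectation Y * (m - c)"
    using increment_expectation_mult(2)[OF c(1) cm _ _ i, of "\<lambda>x. x\<^sup>2"] increment_moments(3,4)[OF c(1) cm] Y
    by (simp add: bdd_meas_def power2_eq_square mult.assoc)
  finally show ?thesis by simp
qed simp

text \<open>The coefficient is known at the later start \<open>c\<close>, so the part of the first
  increment before \<open>c\<close> is uncorrelated with the second; only the overlap of the two
  intervals contributes.\<close>

lemma increment_product_le:
  assumes a: "0 \<le> a" "a \<le> b" "a \<le> c" "c \<le> d" and Y: "bdd_meas c Y"
  shows "expectation (\<lambda>w. Y w * (W b w - W a w) * (W d w - W c w)) = expectation Y * max 0 (min b d - c)"
proof (cases "b \<le> c")
  case True
  then show ?thesis using increment_product_disjoint[OF a(1,2) True a(4) Y] by simp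
next
  case False
  have eq: "Y w * (W b w - W a w) * (W d w - W c w) = Y w * (W c w - W a w) * (W d w - W c w)
     + Y w * (W b w - W c w) * (W d w - W c w)" for w by (simp add: algebra_simps)
  have c0: "0 \<le> c" using a by simp
  have "expectation (\<lambda>w. Y w * (W b w - W a w) * (W d w - W c w)) =
     expectation (\<lambda>w. Y w * (W c w - W a w) * (W d w - W c w)) + expectation (\<lambda>w. Y w * (W b w - W c w) * (W d w - W c w))"
    unfolding eq
    by (intro Bochner_Integration.integral_add increment_integrable_mult[OF c0 Y]) (use a False in auto)
  also have "expectation (\<lambda>w. Y w * (W c w - W a w) * (W d w - W c w)) = 0"
    using a Y by (intro increment_product_disjoint) auto
  also have "expectation (\<lambda>w. Y w * (W b w - W c w) * (W d w - W c w)) = expectation Y * (min b d - c)"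
  proof (cases "b \<le> d")
    case True
    then show ?thesis using increment_product_same_start[OF c0 _ True Y] False by simp
  next
    case F2: False
    have "expectation (\<lambda>w. Y w * (W b w - W c w) * (W d w - W c w)) = expectation (\<lambda>w. Y w * (W d w - W c w) * (W b w - W c w))"
      by (simp add: mult_ac)
    then show ?thesis using increment_product_same_start[OF c0 a(4) _ Y, of b] F2 by simp
  qed
  finally show ?thesis using False a by simp
qed

text \<open>The product of the coefficients is measurable at the later of the two starting times.
  That time serves as the base point, and the two orders are mirror images.\<close>

lemma increment_product:
  assumes "0 \<le> a" "a \<le> b" "0 \<le> c" "c \<le> d" and \<xi>: "bdd_meas a \<xi>" and \<eta>: "bdd_meas c \<eta>"
  shows "expectation (\<lambda>w. (\<xi> w * (W b w - W a w)) * (\<eta> w * (W d w - W c w)))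
    = expectation (\<lambda>w. \<xi> w * \<eta> w) * max 0 (min b d - max a c)"
proof (cases "a \<le> c")
  case True
  have "bdd_meas c (\<lambda>w. \<xi> w * \<eta> w)" using bdd_meas_mono[OF assms(1) True \<xi>] \<eta> by (rule bdd_meas_mult)
  from increment_product_le[OF assms(1,2) True assms(4) this] True show ?thesis
    by (simp add: mult_ac max_def)
next
  case False
  have "bdd_meas a (\<lambda>w. \<xi> w * \<eta> w)" using \<xi> bdd_meas_mono[OF assms(3) _ \<eta>, of a] False by (auto intro: bdd_meas_mult)
  from increment_product_le[OF assms(3,4) _ assms(2) this] False show ?thesis
    by (simp add: mult_ac max_def min.commute)
qed

lemma
  assumes f: "integrable M f" and g: "integrable (leb T) g"
  shows integrable_pair_mult: "integrable (PM T) (\<lambda>(w, v). f w * g v :: real)"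
    and integral_pair_mult: "(\<integral>(w, v). f w * g v \<partial>PM T) = expectation f * (\<integral>v. g v \<partial>leb T)"
proof -
  interpret P: pair_sigma_finite M "leb T" by (rule pair_sigma_finite_leb)
  have [measurable]: "f \<in> borel_measurable M" "g \<in> borel_measurable (leb T)" using f g by auto
  show i: "integrable (PM T) (\<lambda>(w, v). f w * g v)"
    by (rule P.Fubini_integrable) (use f g in \<open>auto simp: abs_mult\<close>)
  from P.integral_fst[OF i] show "(\<integral>(w, v). f w * g v \<partial>PM T) = expectation f * (\<integral>v. g v \<partial>leb T)"
    by simp
qed

lemma integrable_leb_indicator: "A \<in> sets borel \<Longrightarrow> integrable (leb T) (indicator A :: real \<Rightarrow> real)"
  by (rule leb.integrable_const_bound[of _ 1]) (auto intro!: borel_measurable_leb simp: indicator_def)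

lemma integral_leb_indicator_Ioc:
  assumes "0 \<le> a" shows "(\<integral>v. indicator {a<..b} v \<partial>leb T) = (max 0 (min T b - a) :: real)"
proof -
  have "(\<integral>v. indicator {a<..b} v \<partial>leb T) = (\<integral>v. (indicator {a<..min T b} v :: real) \<partial>lborel)"
  proof -
    have "(\<integral>v. indicator {a<..b} v \<partial>leb T) = (\<integral>v. indicator {0..T} v *\<^sub>R (indicator {a<..b} v :: real) \<partial>lborel)"
      unfolding leb_def by (rule integral_restrict_space) auto
    also have "\<dots> = (\<integral>v. indicator {a<..min T b} v \<partial>lborel)"
      using assms by (intro Bochner_Integration.integral_cong) (auto simp: indicator_def)
    finally show ?thesis .
  qed
  also have "\<dots> = max 0 (min T b - a)" by (cases "a \<le> min T b") auto
  finally show ?thesis .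
qed

text \<open>Both sides are the expectation of \<open>\<xi> w * \<eta> w\<close> times the length of
  the common part of the two intervals and \<open>[0, s]\<close>. Truncation at the larger time
  \<open>t\<close> leaves that common part alone.\<close>

lemma step_term_isometry:
  assumes "0 \<le> a" "a \<le> b" "0 \<le> c" "c \<le> d" "0 \<le> s" "s \<le> t" and \<xi>: "bdd_meas a \<xi>" and \<eta>: "bdd_meas c \<eta>"
  shows "expectation (\<lambda>w. (\<xi> w * (W (min s b) w - W (min s a) w)) * (\<eta> w * (W (min t d) w - W (min t c) w)))
    = (\<integral>(w, v). (\<xi> w * indicator {a<..b} v) * (\<eta> w * indicator {c<..d} v) \<partial>PM s)"
proof -
  have i: "integrable M (\<lambda>w. \<xi> w * \<eta> w)"
    using assms by (intro bdd_meas_integrable[of "max a c"] bdd_meas_mult) (auto intro: bdd_meas_mono)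
  have eq: "(\<lambda>(w, v). (\<xi> w * indicator {a<..b} v) * (\<eta> w * indicator {c<..d} v))
     = (\<lambda>(w, v). (\<xi> w * \<eta> w) * (indicator {max a c<..min b d} v :: real))"
    by (auto simp: indicator_def)
  have "(\<integral>(w, v). (\<xi> w * indicator {a<..b} v) * (\<eta> w * indicator {c<..d} v) \<partial>PM s)
     = expectation (\<lambda>w. \<xi> w * \<eta> w) * (\<integral>v. indicator {max a c<..min b d} v \<partial>leb s)"
    unfolding eq by (rule integral_pair_mult[OF i integrable_leb_indicator]) auto
  also have "\<dots> = expectation (\<lambda>w. \<xi> w * \<eta> w) * max 0 (min s (min b d) - max a c)"
    using assms by (subst integral_leb_indicator_Ioc) auto
  also have "\<dots> = expectation (\<lambda>w. (\<xi> w * (W (min s b) w - W (min s a) w)) * (\<eta> w * (W (min t d) w - W (min t c) w)))"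
  proof -
    \<comment> \<open>In the first two cases a truncated increment is zero and the overlap is empty;
      in the third, truncation leaves both left endpoints alone.\<close>
    consider "s \<le> a" | "t \<le> c" | "a < s" "c < t" by linarith
    then show ?thesis
    proof cases
      case 1
      then have "min s (min b d) \<le> max a c" by (intro min.coboundedI1 max.coboundedI1)
      then have z: "max 0 (min s (min b d) - max a c) = 0" by (intro max_absorb1) (simp only: diff_le_0_iff_le)
      have e: "min s a = s" "min s b = s" using 1 order_trans[OF 1 assms(2)] by (simp_all only: min_absorb1)
      show ?thesis unfolding z e by simp
    next
      case 2
      then have "s \<le> c" using assms(6) by simp
      then have "min s (min b d) \<le> max a c" by (intro min.coboundedI1 max.coboundedI2)
      then have z: "max 0 (min s (min b d) - max a c) = 0" by (intro max_absorb1) (simp only: diff_le_0_iff_le)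
      have e: "min t c = t" "min t d = t" using 2 order_trans[OF 2 assms(4)] by (simp_all only: min_absorb1)
      show ?thesis unfolding z e by simp
    next
      case 3
      then have m: "min s a = a" "min t c = c" by auto
      have mm: "min (min s b) (min t d) = min s (min b d)"
      proof -
        have "min (min s b) (min t d) = min (min s t) (min b d)" by (simp only: min.assoc min.left_commute)
        then show ?thesis by (simp only: min_absorb1[OF assms(6)])
      qed
      have "a \<le> min s b" "c \<le> min t d" using 3 assms(2,4) by auto
      from increment_product[OF assms(1) this(1) assms(3) this(2) \<xi> \<eta>]
      show ?thesis unfolding m mm by simp
    qed
  qed
  finally show ?thesis by simp
qed

lemma step_integrandD:
  assumes "step_integrand M F n u \<xi>" "i < n"
  shows "0 \<le> u i" "u i \<le> u (Suc i)" "bdd_meas (u i) (\<xi> i)"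
proof -
  have *: "j \<le> n \<Longrightarrow> 0 \<le> u j" for j
  proof (induction j)
    case (Suc j)
    then have "u j \<le> u (Suc j)" using assms(1) by (auto simp: step_integrand_def)
    then show ?case using Suc by simp
  qed (use assms in \<open>auto simp: step_integrand_def\<close>)
  then show "0 \<le> u i" using assms(2) by simp
  show "u i \<le> u (Suc i)" using assms by (auto simp: step_integrand_def)
  show "bdd_meas (u i) (\<xi> i)" using assms by (auto simp: step_integrand_def bdd_meas_def bounded_iff)
qed

lemma step_term_sq_integrable:
  assumes "0 \<le> a" "a \<le> b" "bdd_meas a \<xi>" "0 \<le> t"
  shows "sq_integrable M (\<lambda>w. \<xi> w * (W (min t b) w - W (min t a) w))"
    and "sq_integrable (PM s) (\<lambda>(w, v). \<xi> w * indicator {a<..b} v)"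
proof -
  show "sq_integrable M (\<lambda>w. \<xi> w * (W (min t b) w - W (min t a) w))"
    using assms by (intro bdd_meas_sq_integrable[OF assms(1,3)] increment_sq_integrable) auto
  have i: "integrable M (\<lambda>w. (\<xi> w)\<^sup>2)"
    using bdd_meas_integrable[OF assms(1) bdd_meas_mult[OF assms(3) assms(3)]] by (simp add: power2_eq_square)
  have "(\<lambda>p. (case p of (w, v) \<Rightarrow> \<xi> w * indicator {a<..b} v)\<^sup>2) = (\<lambda>(w, v). (\<xi> w)\<^sup>2 * indicator {a<..b} v :: real)"
    by (auto simp: indicator_def)
  moreover have "(\<lambda>(w, v). \<xi> w * indicator {a<..b} v) \<in> borel_measurable (PM s)"
    using integrable_pair_mult[OF bdd_meas_integrable[OF assms(1,3)] integrable_leb_indicator[of "{a<..b}"]] by auto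
  ultimately show "sq_integrable (PM s) (\<lambda>(w, v). \<xi> w * indicator {a<..b} v)"
    unfolding sq_integrable_def using integrable_pair_mult[OF i integrable_leb_indicator[of "{a<..b}"]] by auto
qed

lemma step_sq_integrable:
  assumes "step_integrand M F n u \<xi>" "0 \<le> t"
  shows "sq_integrable M (step_integral W n u \<xi> t)"
    and "sq_integrable (PM s) (\<lambda>(w, v). step_process n u \<xi> v w)"
proof -
  note t = step_term_sq_integrable[OF step_integrandD[OF assms(1)] assms(2)]
  show "sq_integrable M (step_integral W n u \<xi> t)"
    unfolding step_integral_def using t(1) by (intro sq_integrable_sum) auto
  have "sq_integrable (PM s) (\<lambda>p. \<Sum>i<n. case p of (w, v) \<Rightarrow> \<xi> i w * indicator {u i<..u (Suc i)} v)"
    using t(2) by (intro sq_integrable_sum) auto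
  then show "sq_integrable (PM s) (\<lambda>(w, v). step_process n u \<xi> v w)"
    by (simp add: step_process_def split_beta')
qed

text \<open>Polarised, with two unrelated partitions: the definition of the Ito integral lets the
  approximating steps depend on the time, so the integrals at \<open>s\<close> and \<open>t\<close>
  come with different sequences.\<close>

lemma step_isometry:
  assumes A: "step_integrand M F n u \<xi>" and B: "step_integrand M F m u' \<eta>" and s: "0 \<le> s" "s \<le> t"
  shows "expectation (\<lambda>w. step_integral W n u \<xi> s w * step_integral W m u' \<eta> t w)
    = (\<integral>(w, v). step_process n u \<xi> v w * step_process m u' \<eta> v w \<partial>PM s)"
proof -
  have t: "0 \<le> t" using s by simp
  note A' = step_integrandD[OF A] and B' = step_integrandD[OF B]
  let ?X = "\<lambda>i w. \<xi> i w * (W (min s (u (Suc i))) w - W (min s (u i)) w)"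
  let ?Y = "\<lambda>j w. \<eta> j w * (W (min t (u' (Suc j))) w - W (min t (u' j)) w)"
  let ?x = "\<lambda>i (w, v). \<xi> i w * indicator {u i<..u (Suc i)} v"
  let ?y = "\<lambda>j (w, v). \<eta> j w * indicator {u' j<..u' (Suc j)} v"
  have i1: "integrable M (\<lambda>w. ?X i w * ?Y j w)" if "i < n" "j < m" for i j
    using sq_integrable_mult_integrable[OF step_term_sq_integrable(1)[OF A'[OF that(1)] s(1)]
      step_term_sq_integrable(1)[OF B'[OF that(2)] t]] .
  have i2: "integrable (PM s) (\<lambda>p. ?x i p * ?y j p)" if "i < n" "j < m" for i j
    using sq_integrable_mult_integrable[OF step_term_sq_integrable(2)[OF A'[OF that(1)] s(1)]
      step_term_sq_integrable(2)[OF B'[OF that(2)] t]] .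
  have "expectation (\<lambda>w. step_integral W n u \<xi> s w * step_integral W m u' \<eta> t w)
     = expectation (\<lambda>w. \<Sum>i<n. \<Sum>j<m. ?X i w * ?Y j w)"
    by (simp add: step_integral_def sum_product)
  also have "\<dots> = (\<Sum>i<n. \<Sum>j<m. expectation (\<lambda>w. ?X i w * ?Y j w))"
    by (rule integral_double_sum[OF i1])
  also have "\<dots> = (\<Sum>i<n. \<Sum>j<m. \<integral>p. ?x i p * ?y j p \<partial>PM s)"
  proof (intro sum.cong refl)
    fix i j assume ij: "i \<in> {..<n}" "j \<in> {..<m}"
    have "(\<lambda>p. ?x i p * ?y j p) = (\<lambda>(w, v). (\<xi> i w * indicator {u i<..u (Suc i)} v) * (\<eta> j w * indicator {u' j<..u' (Suc j)} v))"
      by auto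
    with step_term_isometry[OF A'(1,2)[of i] B'(1,2)[of j] s A'(3)[of i] B'(3)[of j]] ij
    show "expectation (\<lambda>w. ?X i w * ?Y j w) = (\<integral>p. ?x i p * ?y j p \<partial>PM s)" by simp
  qed
  also have "\<dots> = (\<integral>p. (\<Sum>i<n. \<Sum>j<m. ?x i p * ?y j p) \<partial>PM s)"
    by (rule integral_double_sum[OF i2, symmetric])
  also have "\<dots> = (\<integral>(w, v). step_process n u \<xi> v w * step_process m u' \<eta> v w \<partial>PM s)"
    by (intro Bochner_Integration.integral_cong refl) (simp only: step_process_def sum_product split_beta')
  finally show ?thesis .
qed

text \<open>Lets \<open>mart\<close> enter the \<open>L^2\<close> limit on the product space as a
  constant sequence.\<close>

lemma mart_pair_sq_integrable:
  assumes T: "0 \<le> T" shows "sq_integrable (PM T) (\<lambda>(w, v). mart al v w)"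
proof -
  note m = measurable_process_leb[OF measurable_process_mart, of al T]
  have "integrable (PM T) (\<lambda>(w, v). (mart al v w)\<^sup>2)"
  proof (rule integrable_pairI)
    show "(\<lambda>(w, v). (mart al v w)\<^sup>2) \<in> borel_measurable (PM T)"
      using m unfolding split_beta' by measurable
    fix v assume v: "0 \<le> v" "v \<le> T"
    have "(\<integral>\<^sup>+w. ennreal (norm ((mart al v w)\<^sup>2)) \<partial>M) = ennreal (exp (al\<^sup>2 * v))"
      using mart_moments(3,4)[OF v(1), of al] by (subst nn_integral_eq_integral) (auto simp: sq_integrable_def)
    also have "\<dots> \<le> ennreal (exp (al\<^sup>2 * T))" using v by (auto intro!: ennreal_leI mult_left_mono)
    finally show "(\<integral>\<^sup>+w. ennreal (norm ((mart al v w)\<^sup>2)) \<partial>M) \<le> ennreal (exp (al\<^sup>2 * T))" .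
  qed
  with m show ?thesis by (simp add: sq_integrable_def split_beta')
qed

text \<open>The martingale property lowers \<open>T\<close> to \<open>b\<close>; there
  \<open>mart\<close> factors into its value at \<open>a\<close> and an independent exponential of
  the increment, under which the increment has mean \<open>al * (b - a)\<close>.\<close>

lemma increment_mart_expectation:
  assumes ab: "0 \<le> a" "a \<le> b" "b \<le> T" and \<xi>: "bdd_meas a \<xi>"
  shows "expectation (\<lambda>w. mart al T w * (\<xi> w * (W b w - W a w))) = al * expectation (\<lambda>w. mart al a w * \<xi> w) * (b - a)"
proof (cases "a = b")
  case False
  then have ab': "a < b" using ab by simp
  have b0: "0 \<le> b" using ab by simp
  let ?Y = "\<lambda>w. \<xi> w * (W b w - W a w)"
  have YF: "?Y \<in> borel_measurable (F b)"
    using ab \<xi> by (intro bdd_meas_increment_F) (auto intro: bdd_meas_mono)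
  have Ysq: "sq_integrable M ?Y" using ab \<xi> by (intro bdd_meas_sq_integrable[of a] increment_sq_integrable) auto
  let ?g = "\<lambda>x. (x * exp (al * x)) * exp (- al\<^sup>2 * (b - a) / 2)"
  let ?Z = "\<lambda>w. mart al a w * \<xi> w"
  have Zsq: "sq_integrable M ?Z"
    using bdd_meas_sq_integrable[OF ab(1) \<xi> mart_moments(3)[OF ab(1), of al]] by (simp add: mult.commute)
  have one: "sq_integrable M (\<lambda>_. 1)" by (simp add: sq_integrable_def)
  have Zi: "integrable M ?Z" using sq_integrable_mult_integrable[OF Zsq one] by simp
  have ZF: "?Z \<in> borel_measurable (F a)" using mart_F[OF ab(1), of al] \<xi> by (auto simp: bdd_meas_def)
  have gm: "?g \<in> borel_measurable borel" by measurable
  have gi: "integrable M (\<lambda>w. ?g (W b w - W a w))" using increment_moments(7)[OF ab(1) ab', of al] by simp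
  have ge: "expectation (\<lambda>w. ?g (W b w - W a w)) = al * (b - a)"
    using increment_moments(7,8)[OF ab(1) ab', of al] by (simp add: exp_minus)
  have "expectation (\<lambda>w. mart al T w * ?Y w) = expectation (\<lambda>w. mart al b w * ?Y w)"
    by (rule mart_expectation_mult(2)[OF b0 ab(3) YF sq_integrable_mult_integrable[OF mart_moments(3)[OF b0] Ysq]])
  also have "\<dots> = expectation (\<lambda>w. ?Z w * ?g (W b w - W a w))"
  proof (rule integral_cong_AE)
    show "AE w in M. mart al b w * ?Y w = ?Z w * ?g (W b w - W a w)"
      using AE_mart_ratio[of al b a] by eventually_elim simp
    show "(\<lambda>w. ?Z w * ?g (W b w - W a w)) \<in> borel_measurable M"
      by (rule borel_measurable_integrable[OF increment_expectation_mult(1)[OF ab(1) ab' ZF gm Zi gi]])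
    show "(\<lambda>w. mart al b w * ?Y w) \<in> borel_measurable M"
      using sq_integrable_mult_integrable[OF mart_moments(3)[OF b0] Ysq] by auto
  qed
  also have "\<dots> = expectation ?Z * (al * (b - a))"
    unfolding increment_expectation_mult(2)[OF ab(1) ab' ZF gm Zi gi] ge ..
  finally show ?thesis by simp
qed simp

text \<open>For \<open>v\<close> in \<open>(a, b]\<close> the coefficient is already known at
  \<open>a\<close>, so the martingale property makes the integrand on the right constant in
  \<open>v\<close>; the length of the truncated interval is the only time dependence on both
  sides.\<close>

lemma step_term_girsanov:
  assumes ab: "0 \<le> a" "a \<le> b" and \<xi>: "bdd_meas a \<xi>" and T: "0 \<le> T"
  shows "expectation (\<lambda>w. mart al T w * (\<xi> w * (W (min T b) w - W (min T a) w)))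
    = al * (\<integral>(w, v). mart al v w * (\<xi> w * indicator {a<..b} v) \<partial>PM T)"
proof -
  interpret P: pair_sigma_finite M "leb T" by (rule pair_sigma_finite_leb)
  let ?k = "\<lambda>w v. mart al v w * (\<xi> w * indicator {a<..b} v)"
  have int: "integrable (PM T) (\<lambda>(w, v). ?k w v)"
    using sq_integrable_mult_integrable[OF mart_pair_sq_integrable[OF T] step_term_sq_integrable(2)[OF ab \<xi> T]]
    by (simp add: split_beta')
  have "(\<integral>(w, v). ?k w v \<partial>PM T) = (\<integral>v. expectation (\<lambda>w. ?k w v) \<partial>leb T)"
    by (rule P.integral_snd[OF int, symmetric])
  also have "\<dots> = (\<integral>v. expectation (\<lambda>w. mart al a w * \<xi> w) * indicator {a<..b} v \<partial>leb T)"
  proof (intro Bochner_Integration.integral_cong refl)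
    fix v assume "v \<in> space (leb T)"
    show "expectation (\<lambda>w. ?k w v) = expectation (\<lambda>w. mart al a w * \<xi> w) * indicator {a<..b} v"
    proof (cases "v \<in> {a<..b}")
      case True
      have one: "sq_integrable M (\<lambda>_. 1)" by (simp add: sq_integrable_def)
      have "integrable M (\<lambda>w. mart al a w * \<xi> w)"
        using sq_integrable_mult_integrable[OF bdd_meas_sq_integrable[OF ab(1) \<xi> mart_moments(3)[OF ab(1), of al]] one]
        by (simp add: mult.commute)
      with mart_expectation_mult(2)[OF ab(1), of v \<xi> al] \<xi> True show ?thesis by (simp add: bdd_meas_def)
    qed simp
  qed
  also have "\<dots> = expectation (\<lambda>w. mart al a w * \<xi> w) * max 0 (min T b - a)"
    by (simp only: integral_mult_right_zero integral_leb_indicator_Ioc[OF ab(1)])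
  finally have R: "(\<integral>(w, v). ?k w v \<partial>PM T) = expectation (\<lambda>w. mart al a w * \<xi> w) * max 0 (min T b - a)" .
  show ?thesis
  proof (cases "T \<le> a")
    case True
    then have "min T b \<le> a" by (rule min.coboundedI1)
    then have "max 0 (min T b - a) = 0" by (intro max_absorb1) (simp only: diff_le_0_iff_le)
    moreover have "min T a = T" "min T b = T" using True order_trans[OF True ab(2)] by (simp_all only: min_absorb1)
    ultimately show ?thesis unfolding R by simp
  next
    case False
    then have "min T a = a" "a \<le> min T b" using ab by auto
    moreover from this have "max 0 (min T b - a) = min T b - a" by (intro max_absorb2) simp
    ultimately show ?thesis unfolding R using increment_mart_expectation[OF ab(1) _ _ \<xi>, of "min T b" T al] by simp
  qed
qed

lemma step_girsanov:
  assumes A: "step_integrand M F n u \<xi>" and T: "0 \<le> T"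
  shows "expectation (\<lambda>w. mart al T w * step_integral W n u \<xi> T w)
    = al * (\<integral>(w, v). mart al v w * step_process n u \<xi> v w \<partial>PM T)"
proof -
  note A' = step_integrandD[OF A]
  let ?X = "\<lambda>i w. \<xi> i w * (W (min T (u (Suc i))) w - W (min T (u i)) w)"
  let ?x = "\<lambda>i (w, v). \<xi> i w * indicator {u i<..u (Suc i)} v"
  have i1: "integrable M (\<lambda>w. mart al T w * ?X i w)" if "i < n" for i
    using sq_integrable_mult_integrable[OF mart_moments(3)[OF T] step_term_sq_integrable(1)[OF A'[OF that] T]] .
  have i2: "integrable (PM T) (\<lambda>p. (case p of (w, v) \<Rightarrow> mart al v w) * ?x i p)" if "i < n" for i
    using sq_integrable_mult_integrable[OF mart_pair_sq_integrable[OF T] step_term_sq_integrable(2)[OF A'[OF that] T]] .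
  have "expectation (\<lambda>w. mart al T w * step_integral W n u \<xi> T w) = expectation (\<lambda>w. \<Sum>i<n. mart al T w * ?X i w)"
    by (simp add: step_integral_def sum_distrib_left)
  also have "\<dots> = (\<Sum>i<n. expectation (\<lambda>w. mart al T w * ?X i w))"
    using i1 by (intro Bochner_Integration.integral_sum) auto
  also have "\<dots> = (\<Sum>i<n. al * (\<integral>p. (case p of (w, v) \<Rightarrow> mart al v w) * ?x i p \<partial>PM T))"
  proof (intro sum.cong refl)
    fix i assume i: "i \<in> {..<n}"
    have "(\<lambda>p. (case p of (w, v) \<Rightarrow> mart al v w) * ?x i p) = (\<lambda>(w, v). mart al v w * (\<xi> i w * indicator {u i<..u (Suc i)} v))"
      by auto
    with step_term_girsanov[OF A' T, of i al] i
    show "expectation (\<lambda>w. mart al T w * ?X i w) = al * (\<integral>p. (case p of (w, v) \<Rightarrow> mart al v w) * ?x i p \<partial>PM T)"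
      by simp
  qed
  also have "\<dots> = al * (\<integral>p. (\<Sum>i<n. (case p of (w, v) \<Rightarrow> mart al v w) * ?x i p) \<partial>PM T)"
    using i2 by (subst Bochner_Integration.integral_sum) (auto simp: sum_distrib_left)
  also have "(\<integral>p. (\<Sum>i<n. (case p of (w, v) \<Rightarrow> mart al v w) * ?x i p) \<partial>PM T)
     = (\<integral>(w, v). mart al v w * step_process n u \<xi> v w \<partial>PM T)"
    by (intro Bochner_Integration.integral_cong refl) (simp only: step_process_def sum_distrib_left split_beta')
  finally show ?thesis .
qed

text \<open>The definition restated on the product space in real terms. The convergence is kept for
  all \<open>s \<le> T\<close>, because in the isometry the sequence chosen for the later time is
  also used on the earlier interval.\<close>

lemma ito_approx:
  assumes I: "ito_integral_L2 M F W H I" and T: "0 \<le> T"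
  obtains n u \<xi> where "\<And>k. step_integrand M F (n k) (u k) (\<xi> k)"
    and "\<And>s. s \<le> T \<Longrightarrow> sq_integrable (PM s) (\<lambda>(w, v). H v w)"
    and "\<And>s. s \<le> T \<Longrightarrow> (\<lambda>k. \<integral>p. ((case p of (w, v) \<Rightarrow> step_process (n k) (u k) (\<xi> k) v w) - (case p of (w, v) \<Rightarrow> H v w))\<^sup>2 \<partial>PM s) \<longlonglongrightarrow> 0"
    and "sq_integrable M (I T)"
    and "(\<lambda>k. expectation (\<lambda>w. (step_integral W (n k) (u k) (\<xi> k) T w - I T w)\<^sup>2)) \<longlonglongrightarrow> 0"
proof -
  from I T obtain n u \<xi> where st: "\<And>k. step_integrand M F (n k) (u k) (\<xi> k)"
    and l1: "(\<lambda>k. \<integral>\<^sup>+w. (\<integral>\<^sup>+t\<in>{0..T}. ennreal ((step_process (n k) (u k) (\<xi> k) t w - H t w)\<^sup>2) \<partial>lborel) \<partial>M) \<longlonglongrightarrow> 0"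
    and l2: "(\<lambda>k. \<integral>\<^sup>+w. ennreal ((step_integral W (n k) (u k) (\<xi> k) T w - I T w)\<^sup>2) \<partial>M) \<longlonglongrightarrow> 0"
    unfolding ito_integral_L2_def by meson
  have "I T \<in> borel_measurable (F T)" using I T by (auto simp: ito_integral_L2_def adapted_def)
  then have IM: "I T \<in> borel_measurable M" by (rule F_measurable_M[OF T])
  have HM: "measurable_process M H" using I by (auto simp: ito_integral_L2_def L2_loc_def)
  note Hm = measurable_process_leb[OF HM]
  note sq = step_sq_integrable[OF st T]
  have l1': "(\<lambda>k. \<integral>\<^sup>+p. ennreal (((case p of (w, v) \<Rightarrow> step_process (n k) (u k) (\<xi> k) v w) - (case p of (w, v) \<Rightarrow> H v w))\<^sup>2) \<partial>PM s) \<longlonglongrightarrow> 0"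
    if "s \<le> T" for s
  proof (rule tendsto_sandwich[OF _ _ tendsto_const l1])
    show "\<forall>\<^sub>F k in sequentially. (\<integral>\<^sup>+p. ennreal (((case p of (w, v) \<Rightarrow> step_process (n k) (u k) (\<xi> k) v w) - (case p of (w, v) \<Rightarrow> H v w))\<^sup>2) \<partial>PM s)
       \<le> (\<integral>\<^sup>+w. (\<integral>\<^sup>+t\<in>{0..T}. ennreal ((step_process (n k) (u k) (\<xi> k) t w - H t w)\<^sup>2) \<partial>lborel) \<partial>M)"
    proof (rule always_eventually, rule allI)
      fix k
      have "(\<integral>\<^sup>+p. ennreal (((case p of (w, v) \<Rightarrow> step_process (n k) (u k) (\<xi> k) v w) - (case p of (w, v) \<Rightarrow> H v w))\<^sup>2) \<partial>PM s)
        = (\<integral>\<^sup>+w. (\<integral>\<^sup>+t. ennreal ((step_process (n k) (u k) (\<xi> k) t w - H t w)\<^sup>2) \<partial>leb s) \<partial>M)"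
        using Hm[of s] sq_integrableD(1)[OF sq(2)[of s k]] by (subst leb.nn_integral_fst[symmetric]) auto
      also have "\<dots> \<le> (\<integral>\<^sup>+w. (\<integral>\<^sup>+t. ennreal ((step_process (n k) (u k) (\<xi> k) t w - H t w)\<^sup>2) \<partial>leb T) \<partial>M)"
        by (intro nn_integral_mono, subst nn_integral_leb_mono[OF that])
           (auto intro!: nn_integral_mono simp: indicator_def)
      finally show "(\<integral>\<^sup>+p. ennreal (((case p of (w, v) \<Rightarrow> step_process (n k) (u k) (\<xi> k) v w) - (case p of (w, v) \<Rightarrow> H v w))\<^sup>2) \<partial>PM s)
       \<le> (\<integral>\<^sup>+w. (\<integral>\<^sup>+t\<in>{0..T}. ennreal ((step_process (n k) (u k) (\<xi> k) t w - H t w)\<^sup>2) \<partial>lborel) \<partial>M)"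
        by (simp only: nn_integral_leb)
    qed
  qed auto
  note L1 = L2_limit_from_nn_integral[OF sq_integrableD(1)[OF sq(2)] Hm l1' sq(2)]
  note L2 = L2_limit_from_nn_integral[OF sq_integrableD(1)[OF sq(1)] IM l2 sq(1)]
  show ?thesis by (rule that[OF st L1 L2])
qed

lemma ito_sq_integrable:
  assumes I: "ito_integral_L2 M F W H I" and T: "0 \<le> T"
  shows "sq_integrable M (I T)" "sq_integrable (PM T) (\<lambda>(w, v). H v w)"
proof -
  show "sq_integrable M (I T)" by (rule ito_approx[OF assms])
  show "sq_integrable (PM T) (\<lambda>(w, v). H v w)" by (rule ito_approx[OF assms]) simp
qed

text \<open>Each time brings its own approximating sequence, and on \<open>[0, s]\<close> both
  converge to \<open>H\<close>, so the polarised step isometry has the square of \<open>H\<close> as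
  its limit.\<close>

lemma ito_isometry_pair:
  assumes I: "ito_integral_L2 M F W H I" and s: "0 \<le> s" "s \<le> t"
  shows "expectation (\<lambda>w. I s w * I t w) = (\<integral>(w, v). (H v w)\<^sup>2 \<partial>PM s)"
proof -
  have t: "0 \<le> t" using s by simp
  obtain n u \<xi> where A: "\<And>k. step_integrand M F (n k) (u k) (\<xi> k)"
    "\<And>r. r \<le> s \<Longrightarrow> sq_integrable (PM r) (\<lambda>(w, v). H v w)"
    "\<And>r. r \<le> s \<Longrightarrow> (\<lambda>k. \<integral>p. ((case p of (w, v) \<Rightarrow> step_process (n k) (u k) (\<xi> k) v w) - (case p of (w, v) \<Rightarrow> H v w))\<^sup>2 \<partial>PM r) \<longlonglongrightarrow> 0"
    "sq_integrable M (I s)"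
    "(\<lambda>k. expectation (\<lambda>w. (step_integral W (n k) (u k) (\<xi> k) s w - I s w)\<^sup>2)) \<longlonglongrightarrow> 0"
    by (fact ito_approx[OF I s(1)])
  obtain m u' \<eta> where B: "\<And>k. step_integrand M F (m k) (u' k) (\<eta> k)"
    "\<And>r. r \<le> t \<Longrightarrow> sq_integrable (PM r) (\<lambda>(w, v). H v w)"
    "\<And>r. r \<le> t \<Longrightarrow> (\<lambda>k. \<integral>p. ((case p of (w, v) \<Rightarrow> step_process (m k) (u' k) (\<eta> k) v w) - (case p of (w, v) \<Rightarrow> H v w))\<^sup>2 \<partial>PM r) \<longlonglongrightarrow> 0"
    "sq_integrable M (I t)"
    "(\<lambda>k. expectation (\<lambda>w. (step_integral W (m k) (u' k) (\<eta> k) t w - I t w)\<^sup>2)) \<longlonglongrightarrow> 0"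
    by (fact ito_approx[OF I t])
  have 1: "(\<lambda>k. expectation (\<lambda>w. step_integral W (n k) (u k) (\<xi> k) s w * step_integral W (m k) (u' k) (\<eta> k) t w)) \<longlonglongrightarrow> expectation (\<lambda>w. I s w * I t w)"
    by (rule tendsto_integral_mult_L2[OF step_sq_integrable(1)[OF A(1) s(1)] A(4) step_sq_integrable(1)[OF B(1) t] B(4) A(5) B(5)])
  have 2: "(\<lambda>k. \<integral>p. (case p of (w, v) \<Rightarrow> step_process (n k) (u k) (\<xi> k) v w) * (case p of (w, v) \<Rightarrow> step_process (m k) (u' k) (\<eta> k) v w) \<partial>PM s)
      \<longlonglongrightarrow> (\<integral>p. (case p of (w, v) \<Rightarrow> H v w) * (case p of (w, v) \<Rightarrow> H v w) \<partial>PM s)"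
    by (rule tendsto_integral_mult_L2[OF step_sq_integrable(2)[OF A(1) s(1)] A(2)[OF order_refl] step_sq_integrable(2)[OF B(1) s(1)] A(2)[OF order_refl] A(3)[OF order_refl] B(3)[OF s(2)]])
  have "(\<lambda>k. expectation (\<lambda>w. step_integral W (n k) (u k) (\<xi> k) s w * step_integral W (m k) (u' k) (\<eta> k) t w)) \<longlonglongrightarrow> (\<integral>p. (case p of (w, v) \<Rightarrow> H v w) * (case p of (w, v) \<Rightarrow> H v w) \<partial>PM s)"
    using 2 unfolding step_isometry[OF A(1) B(1) s] by (simp add: split_beta')
  from LIMSEQ_unique[OF 1 this] show ?thesis by (simp add: split_beta' power2_eq_square)
qed

text \<open>The limit is taken with the weight at time \<open>t\<close>; since \<open>I t\<close> is
  \<open>F t\<close>-measurable, the martingale property then raises the weight to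
  \<open>T\<close>.\<close>

lemma ito_girsanov_pair:
  assumes I: "ito_integral_L2 M F W H I" and t: "0 \<le> t" "t \<le> T"
  shows "expectation (\<lambda>w. mart al T w * I t w) = al * (\<integral>(w, v). mart al v w * H v w \<partial>PM t)"
proof -
  obtain n u \<xi> where A: "\<And>k. step_integrand M F (n k) (u k) (\<xi> k)"
    "\<And>r. r \<le> t \<Longrightarrow> sq_integrable (PM r) (\<lambda>(w, v). H v w)"
    "\<And>r. r \<le> t \<Longrightarrow> (\<lambda>k. \<integral>p. ((case p of (w, v) \<Rightarrow> step_process (n k) (u k) (\<xi> k) v w) - (case p of (w, v) \<Rightarrow> H v w))\<^sup>2 \<partial>PM r) \<longlonglongrightarrow> 0"
    "sq_integrable M (I t)"
    "(\<lambda>k. expectation (\<lambda>w. (step_integral W (n k) (u k) (\<xi> k) t w - I t w)\<^sup>2)) \<longlonglongrightarrow> 0"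
    by (fact ito_approx[OF I t(1)])
  have z: "(\<lambda>k. expectation (\<lambda>w. (mart al t w - mart al t w)\<^sup>2)) \<longlonglongrightarrow> 0"
    "(\<lambda>k. \<integral>p. ((case p of (w, v) \<Rightarrow> mart al v w) - (case p of (w, v) \<Rightarrow> mart al v w))\<^sup>2 \<partial>PM t) \<longlonglongrightarrow> 0" for al by auto
  have 1: "(\<lambda>k. expectation (\<lambda>w. mart al t w * step_integral W (n k) (u k) (\<xi> k) t w)) \<longlonglongrightarrow> expectation (\<lambda>w. mart al t w * I t w)"
    by (rule tendsto_integral_mult_L2[OF mart_moments(3)[OF t(1)] mart_moments(3)[OF t(1)] step_sq_integrable(1)[OF A(1) t(1)] A(4) z(1) A(5)])
  have 2: "(\<lambda>k. \<integral>p. (case p of (w, v) \<Rightarrow> mart al v w) * (case p of (w, v) \<Rightarrow> step_process (n k) (u k) (\<xi> k) v w) \<partial>PM t)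
      \<longlonglongrightarrow> (\<integral>p. (case p of (w, v) \<Rightarrow> mart al v w) * (case p of (w, v) \<Rightarrow> H v w) \<partial>PM t)"
    by (rule tendsto_integral_mult_L2[OF mart_pair_sq_integrable[OF t(1)] mart_pair_sq_integrable[OF t(1)] step_sq_integrable(2)[OF A(1) t(1)] A(2)[OF order_refl] z(2) A(3)[OF order_refl]])
  have "(\<lambda>k. expectation (\<lambda>w. mart al t w * step_integral W (n k) (u k) (\<xi> k) t w)) \<longlonglongrightarrow> al * (\<integral>p. (case p of (w, v) \<Rightarrow> mart al v w) * (case p of (w, v) \<Rightarrow> H v w) \<partial>PM t)"
    using tendsto_mult[OF tendsto_const[of al] 2] unfolding step_girsanov[OF A(1) t(1)] by (simp add: split_beta')
  from LIMSEQ_unique[OF 1 this]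
  have "expectation (\<lambda>w. mart al t w * I t w) = al * (\<integral>(w, v). mart al v w * H v w \<partial>PM t)"
    by (simp add: split_beta')
  moreover have "expectation (\<lambda>w. mart al T w * I t w) = expectation (\<lambda>w. mart al t w * I t w)"
    using I t by (intro mart_expectation_mult(2)[OF t] sq_integrable_mult_integrable[OF mart_moments(3)[OF t(1)] A(4)])
      (auto simp: ito_integral_L2_def adapted_def)
  ultimately show ?thesis by simp
qed

lemma
  assumes I: "ito_integral_L2 M F W H I" and T: "0 \<le> T"
  shows ito_integrable_square: "integrable (leb T) (\<lambda>v. expectation (\<lambda>w. (H v w)\<^sup>2))"
    and ito_integrable_mart: "integrable (leb T) (\<lambda>v. expectation (\<lambda>w. mart al v w * H v w))"
    and ito_isometry: "\<And>s. 0 \<le> s \<Longrightarrow> s \<le> T \<Longrightarrow> expectation (\<lambda>w. I s w * I T w) = (\<integral>v. expectation (\<lambda>w. (H v w)\<^sup>2) \<partial>leb s)"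
    and ito_girsanov: "\<And>s. 0 \<le> s \<Longrightarrow> s \<le> T \<Longrightarrow> expectation (\<lambda>w. mart al T w * I s w) = al * (\<integral>v. expectation (\<lambda>w. mart al v w * H v w) \<partial>leb s)"
proof -
  have P: "pair_sigma_finite M (leb s)" for s by (rule pair_sigma_finite_leb)
  have 1: "integrable (PM s) (\<lambda>(w, v). (H v w)\<^sup>2)" 
    and 2: "integrable (PM s) (\<lambda>(w, v). mart al v w * H v w)" if "0 \<le> s" for s
    using sq_integrableD(2)[OF ito_sq_integrable(2)[OF I that]]
      sq_integrable_mult_integrable[OF mart_pair_sq_integrable[OF that, of al] ito_sq_integrable(2)[OF I that]]
    by (auto simp: split_beta')
  show "integrable (leb T) (\<lambda>v. expectation (\<lambda>w. (H v w)\<^sup>2))"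
    "integrable (leb T) (\<lambda>v. expectation (\<lambda>w. mart al v w * H v w))"
    using pair_sigma_finite.integrable_snd[OF P 1[OF T]] pair_sigma_finite.integrable_snd[OF P 2[OF T]] by auto
  show "expectation (\<lambda>w. I s w * I T w) = (\<integral>v. expectation (\<lambda>w. (H v w)\<^sup>2) \<partial>leb s)"
    "expectation (\<lambda>w. mart al T w * I s w) = al * (\<integral>v. expectation (\<lambda>w. mart al v w * H v w) \<partial>leb s)"
    if "0 \<le> s" "s \<le> T" for s
    using ito_isometry_pair[OF I that] ito_girsanov_pair[OF I that, of al]
      pair_sigma_finite.integral_snd[OF P 1[OF that(1)]] pair_sigma_finite.integral_snd[OF P 2[OF that(1)]] by auto
qed

end

subsection \<open>Discounted Ito integrals\<close>

text \<open>The discounted equation at the random time \<open>min T \<tau>\<close>, with its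
  stochastic part rewritten over the deterministic horizon \<open>T\<close>.\<close>

lemma stopped_path:
  assumes X: "continuous_on {0..} X" and I: "continuous_on {0..} I"
    and h: "\<And>T. 0 \<le> T \<Longrightarrow> integrable (leb T) (\<lambda>s. b * X s + g s)"
    and eq: "\<And>t. 0 \<le> t \<Longrightarrow> X t = x + (\<integral>s. b * X s + g s \<partial>leb t) + I t"
    and T: "0 \<le> T" "0 \<le> \<tau>"
  shows "exp (- b * min T \<tau>) * X (min T \<tau>) = x + (\<integral>s. exp (- b * s) * g s \<partial>leb (min T \<tau>)) + disc b T (\<lambda>s. I (min s \<tau>))"
  unfolding disc_stopped[OF I T]
  by (rule disc_path(1)) (use T in \<open>auto intro!: continuous_on_subset[OF X] h eq\<close>)

context brownian_motion
begin

lemma stopping_time_measurable: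
  assumes "stopping_time F \<tau>" and nn: "\<And>w. w \<in> space M \<Longrightarrow> 0 \<le> \<tau> w"
  shows "\<tau> \<in> borel_measurable M"
proof (rule borel_measurableI_le)
  fix a :: real
  show "{w \<in> space M. \<tau> w \<le> a} \<in> sets M"
  proof (cases "0 \<le> a")
    case True
    have "Measurable.pred (F a) (\<lambda>w. \<tau> w \<le> a)" using assms(1) by (simp add: stopping_time_def)
    from F_measurable_M[OF True this] show ?thesis by (simp add: pred_def)
  next
    case False
    \<comment> \<open>The filtration is unconstrained at negative times; there the set is empty
      because \<open>\<tau>\<close> is nonnegative.\<close>
    then have "{w \<in> space M. \<tau> w \<le> a} = {}" using nn by force
    then show ?thesis by (simp only: sets.empty_sets)
  qed
qed

lemma stopped_indicator_measurable:
  assumes "\<tau> \<in> borel_measurable M"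
  shows "(\<lambda>(w, s). indicator {..\<tau> w} s :: real) \<in> borel_measurable (PM T)"
proof -
  have [measurable]: "snd \<in> borel_measurable (PM T)"
    by (rule measurable_compose[OF measurable_snd borel_measurable_leb[where f="\<lambda>x. x"]]) simp
  have [measurable]: "(\<lambda>p. \<tau> (fst p)) \<in> borel_measurable (PM T)"
    by (rule measurable_compose[OF measurable_fst assms])
  have eq: "(\<lambda>(w, s). indicator {..\<tau> w} s :: real) = (\<lambda>p. if snd p \<le> \<tau> (fst p) then 1 else 0)"
    by (auto simp: indicator_def)
  have "Measurable.pred (PM T) (\<lambda>p. snd p \<le> \<tau> (fst p))" by measurable
  then show ?thesis by (subst eq, intro measurable_If) auto
qed

lemma exp_leb_measurable: "(\<lambda>p. exp (b * snd p)) \<in> borel_measurable (PM T)"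
  by (rule measurable_compose[OF measurable_snd borel_measurable_leb]) measurable

context
  fixes H I and T :: real
  assumes I: "ito_integral_L2 M F W H I" and T: "0 \<le> T"
begin

lemma ito_cv:
  assumes s: "0 \<le> s"
  shows "AE w in M. cv I s w = I s w" "sq_integrable M (cv I s)"
    and "K \<in> borel_measurable M \<Longrightarrow> expectation (\<lambda>w. K w * cv I s w) = expectation (\<lambda>w. K w * I s w)"
    and "s \<le> t \<Longrightarrow> expectation (\<lambda>w. cv I s w * cv I t w) = (\<integral>v. expectation (\<lambda>w. (H v w)\<^sup>2) \<partial>leb s)"
proof -
  have a: "adapted F I" "continuous_paths M I" using I by (auto simp: ito_integral_L2_def)
  have ae: "AE w in M. cv I t w = I t w" for t using AE_cv[OF a(2)] by eventually_elim simp
  have m: "cv I t \<in> borel_measurable M" if "0 \<le> t" for t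
    using measurable_process_section[OF measurable_process_cv[OF a] that] .
  note sq = ito_sq_integrable(1)[OF I]
  show "AE w in M. cv I s w = I s w" by (rule ae)
  have "AE w in M. (I s w)\<^sup>2 = (cv I s w)\<^sup>2" using ae[of s] by eventually_elim simp
  then have "integrable M (\<lambda>w. (cv I s w)\<^sup>2)"
    using sq[OF s] m[OF s] by (subst integrable_cong_AE[where g="\<lambda>w. (I s w)\<^sup>2"]) (auto simp: sq_integrable_def)
  with m[OF s] show "sq_integrable M (cv I s)" by (simp add: sq_integrable_def)
  show "expectation (\<lambda>w. K w * cv I s w) = expectation (\<lambda>w. K w * I s w)" if [measurable]: "K \<in> borel_measurable M"
  proof (rule integral_cong_AE)
    show "AE w in M. K w * cv I s w = K w * I s w" using ae[of s] by eventually_elim simp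
  qed (use m[OF s] sq_integrableD(1)[OF sq[OF s]] in auto)
  show "expectation (\<lambda>w. cv I s w * cv I t w) = (\<integral>v. expectation (\<lambda>w. (H v w)\<^sup>2) \<partial>leb s)" if "s \<le> t"
  proof -
    have t: "0 \<le> t" using s that by simp
    have "expectation (\<lambda>w. cv I s w * cv I t w) = expectation (\<lambda>w. I s w * I t w)"
    proof (rule integral_cong_AE)
      show "AE w in M. cv I s w * cv I t w = I s w * I t w" using ae[of s] ae[of t] by eventually_elim simp
    qed (use m[OF s] m[OF t] sq_integrableD(1)[OF sq[OF s]] sq_integrableD(1)[OF sq[OF t]] in auto)
    then show ?thesis using ito_isometry[OF I t s that] by simp
  qed
qed

abbreviation "e2 v \<equiv> expectation (\<lambda>w. (H v w)\<^sup>2)"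

text \<open>The second moment of the integral grows with time, so its value at \<open>T\<close> is
  the uniform bound required by \<open>disc_expectation\<close>.\<close>

lemma ito_cv_bound:
  assumes "0 \<le> s" "s \<le> T"
  shows "expectation (\<lambda>w. (cv I s w)\<^sup>2) \<le> (\<integral>v. e2 v \<partial>leb T)"
proof -
  have "expectation (\<lambda>w. (cv I s w)\<^sup>2) = (\<integral>v. e2 v \<partial>leb s)"
    using ito_cv(4)[OF assms(1) order_refl] by (simp add: power2_eq_square)
  also have "\<dots> = (\<integral>v. indicator {..s} v * e2 v \<partial>leb T)" by (rule integral_leb_mono[OF assms(2)])
  also have "\<dots> \<le> (\<integral>v. e2 v \<partial>leb T)"
  proof (rule integral_mono)
    show i: "integrable (leb T) e2" by (rule ito_integrable_square[OF I T])
    show "integrable (leb T) (\<lambda>v. indicator {..s} v * e2 v)"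
      unfolding integrable_leb_mono_iff[OF assms(2), symmetric] by (rule integrable_leb_subset[OF i assms(2)])
  qed (auto simp: indicator_def)
  finally show ?thesis .
qed

lemma disc_ito_expectation:
  assumes K: "sq_integrable M K"
  shows "integrable M (\<lambda>w. K w * disc b T (\<lambda>s. cv I s w))"
    and "expectation (\<lambda>w. K w * disc b T (\<lambda>s. cv I s w)) = disc b T (\<lambda>s. expectation (\<lambda>w. K w * cv I s w))"
proof -
  have a: "adapted F I" "continuous_paths M I" using I by (auto simp: ito_integral_L2_def)
  have b: "expectation (\<lambda>w. \<bar>K w * cv I s w\<bar>) \<le> sqrt (expectation (\<lambda>w. (K w)\<^sup>2)) * sqrt (\<integral>v. e2 v \<partial>leb T)"
    if "0 \<le> s" "s \<le> T" for s
    by (rule order_trans[OF abs_integral_mult_le(2)[OF K ito_cv(2)[OF that(1)]]])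
       (use ito_cv_bound[OF that] in \<open>auto intro!: mult_left_mono\<close>)
  note D = disc_expectation[OF measurable_process_cv[OF a] sq_integrableD(1)[OF K] T
      sq_integrable_mult_integrable[OF K ito_cv(2)] b]
  show "integrable M (\<lambda>w. K w * disc b T (\<lambda>s. cv I s w))" by (rule D(1))
  show "expectation (\<lambda>w. K w * disc b T (\<lambda>s. cv I s w)) = disc b T (\<lambda>s. expectation (\<lambda>w. K w * cv I s w))"
    by (rule D(2))
qed

text \<open>The Girsanov identity for the integrand \<open>exp (- b * v) * H v\<close>, reached
  without constructing that integral: the identity holds at each fixed time and \<open>disc\<close>
  is applied to it.\<close>

lemma disc_ito_mart:
  shows "expectation (\<lambda>w. mart al T w * disc b T (\<lambda>s. cv I s w)) =
    al * (\<integral>v. exp (- b * v) * expectation (\<lambda>w. mart al v w * H v w) \<partial>leb T)"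
proof -
  have "expectation (\<lambda>w. mart al T w * disc b T (\<lambda>s. cv I s w)) = disc b T (\<lambda>s. expectation (\<lambda>w. mart al T w * cv I s w))"
    by (rule disc_ito_expectation(2)[OF mart_moments(3)[OF T]])
  also have "\<dots> = disc b T (\<lambda>s. al * (\<integral>v. expectation (\<lambda>w. mart al v w * H v w) \<partial>leb s))"
    using T by (intro disc_cong) (auto simp: ito_cv(3) ito_girsanov[OF I T])
  also have "\<dots> = al * disc b T (\<lambda>s. \<integral>v. expectation (\<lambda>w. mart al v w * H v w) \<partial>leb s)"
    by (rule disc_cmult)
  also have "\<dots> = al * (\<integral>v. exp (- b * v) * expectation (\<lambda>w. mart al v w * H v w) \<partial>leb T)"
    by (subst disc_integral[OF ito_integrable_mart[OF I T] T]) simp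
  finally show ?thesis .
qed

text \<open>Needed so that the discounted integral can itself serve as the weight \<open>K\<close>.
  The time integral inside \<open>disc\<close> is controlled by Cauchy-Schwarz in time.\<close>

lemma disc_ito_sq_integrable: "sq_integrable M (\<lambda>w. disc b T (\<lambda>s. cv I s w))"
proof -
  interpret P: pair_sigma_finite M "leb T" by (rule pair_sigma_finite_leb)
  have a: "adapted F I" "continuous_paths M I" using I by (auto simp: ito_integral_L2_def)
  note m = measurable_process_leb[OF measurable_process_cv[OF a], of T]
  have one: "sq_integrable M (\<lambda>_. 1)" by (simp add: sq_integrable_def)
  have J[measurable]: "(\<lambda>w. disc b T (\<lambda>s. cv I s w)) \<in> borel_measurable M"
    using disc_ito_expectation(1)[OF one, of b] by auto
  have int: "integrable (PM T) (\<lambda>(w, s). (cv I s w)\<^sup>2)"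
  proof (rule integrable_pairI)
    show "(\<lambda>(w, s). (cv I s w)\<^sup>2) \<in> borel_measurable (PM T)"
      using m unfolding split_beta' by measurable
    fix s assume s: "0 \<le> s" "s \<le> T"
    show "(\<integral>\<^sup>+w. ennreal (norm ((cv I s w)\<^sup>2)) \<partial>M) \<le> ennreal (\<integral>v. e2 v \<partial>leb T)"
      using sq_integrableD(2)[OF ito_cv(2)[OF s(1)]] ito_cv_bound[OF s]
      by (subst nn_integral_eq_integral) (auto intro!: ennreal_leI)
  qed
  define C where "C = (\<integral>s. (exp (- b * s))\<^sup>2 \<partial>leb T)"
  have C0: "0 \<le> C" by (simp add: C_def)
  have bd: "(disc b T (\<lambda>s. cv I s w))\<^sup>2 \<le> 2 * (exp (- b * T) * cv I T w)\<^sup>2 + (2 * b\<^sup>2 * C) * (\<integral>s. (cv I s w)\<^sup>2 \<partial>leb T)" for w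
  proof -
    let ?A = "exp (- b * T) * cv I T w" and ?B = "\<integral>s. exp (- b * s) * cv I s w \<partial>leb T"
    have c: "continuous_on {0..T} (\<lambda>s. cv I s w)" by (rule continuous_on_subset[OF continuous_on_cv]) auto
    have "sq_integrable (leb T) (\<lambda>s. cv I s w)"
      unfolding sq_integrable_def
      using integrable_leb_continuous[OF c] integrable_leb_continuous[OF continuous_on_power[OF c]] by auto
    moreover have "sq_integrable (leb T) (\<lambda>s. exp (- b * s))"
      unfolding sq_integrable_def
    proof
      have c: "continuous_on {0..T} (\<lambda>s. exp (- b * s))" by (intro continuous_intros)
      show "(\<lambda>s. exp (- b * s)) \<in> borel_measurable (leb T)" "integrable (leb T) (\<lambda>s. (exp (- b * s))\<^sup>2)"
        using integrable_leb_continuous[OF c] integrable_leb_continuous[OF continuous_on_power[OF c]] by auto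
    qed
    ultimately have "\<bar>?B\<bar> \<le> sqrt C * sqrt (\<integral>s. (cv I s w)\<^sup>2 \<partial>leb T)"
      unfolding C_def by (rule abs_integral_mult_le(1)[rotated])
    then have "\<bar>?B\<bar>\<^sup>2 \<le> (sqrt C * sqrt (\<integral>s. (cv I s w)\<^sup>2 \<partial>leb T))\<^sup>2"
      by (rule power_mono) simp
    then have B: "?B\<^sup>2 \<le> C * (\<integral>s. (cv I s w)\<^sup>2 \<partial>leb T)"
      using C0 by (simp add: power_mult_distrib)
    have "(?A + b * ?B)\<^sup>2 \<le> 2 * ?A\<^sup>2 + 2 * (b * ?B)\<^sup>2"
      using sum_squares_bound[of ?A "b * ?B"] by (simp add: power2_sum)
    also have "2 * (b * ?B)\<^sup>2 \<le> (2 * b\<^sup>2 * C) * (\<integral>s. (cv I s w)\<^sup>2 \<partial>leb T)"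
      using mult_left_mono[OF B, of "2 * b\<^sup>2"] by (simp add: power_mult_distrib mult.assoc)
    finally show ?thesis by (simp add: disc_def)
  qed
  have "integrable M (\<lambda>w. (disc b T (\<lambda>s. cv I s w))\<^sup>2)"
  proof (rule Bochner_Integration.integrable_bound)
    show "integrable M (\<lambda>w. 2 * (exp (- b * T) * cv I T w)\<^sup>2 + (2 * b\<^sup>2 * C) * (\<integral>s. (cv I s w)\<^sup>2 \<partial>leb T))"
      using P.integrable_fst[OF int] sq_integrableD(2)[OF ito_cv(2)[OF T]] by (auto simp: power_mult_distrib)
    show "AE w in M. norm ((disc b T (\<lambda>s. cv I s w))\<^sup>2) \<le> norm (2 * (exp (- b * T) * cv I T w)\<^sup>2 + (2 * b\<^sup>2 * C) * (\<integral>s. (cv I s w)\<^sup>2 \<partial>leb T))"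
      using bd by (intro AE_I2) (auto intro: order_trans[OF _ abs_ge_self])
  qed measurable
  with J show ?thesis by (simp add: sq_integrable_def)
qed

text \<open>The isometry for the discounted integral, by discounting the covariance in each time
  variable in turn: first with weight \<open>cv I t\<close>, then with the discounted integral as
  its own weight. Each pass contributes one factor \<open>exp (- b * v)\<close>.\<close>

lemma disc_ito_square:
  shows "expectation (\<lambda>w. (disc b T (\<lambda>s. cv I s w))\<^sup>2) = (\<integral>v. exp (- b * v) * (exp (- b * v) * e2 v) \<partial>leb T)"
proof -
  let ?J = "\<lambda>w. disc b T (\<lambda>s. cv I s w)"
  note e2i = ito_integrable_square[OF I T]
  have h: "expectation (\<lambda>w. ?J w * cv I t w) = (\<integral>v. exp (- b * v) * e2 v \<partial>leb t)" if t: "0 \<le> t" "t \<le> T" for t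
  proof -
    have i: "integrable (leb T) (\<lambda>v. indicator {..t} v * e2 v)"
      unfolding integrable_leb_mono_iff[OF t(2), symmetric] by (rule integrable_leb_subset[OF e2i t(2)])
    have "expectation (\<lambda>w. ?J w * cv I t w) = expectation (\<lambda>w. cv I t w * ?J w)" by (simp add: mult.commute)
    also have "\<dots> = disc b T (\<lambda>s. expectation (\<lambda>w. cv I t w * cv I s w))"
      by (rule disc_ito_expectation(2)[OF ito_cv(2)[OF t(1)]])
    \<comment> \<open>The covariance is an integral up to the smaller of the two times; cutting the
      integrand off at \<open>t\<close> makes it a primitive in \<open>s\<close>, to which
      \<open>disc_integral\<close> applies.\<close>
    also have "\<dots> = disc b T (\<lambda>s. \<integral>v. indicator {..t} v * e2 v \<partial>leb s)"
    proof (rule disc_cong[OF _ T])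
      fix s assume s: "0 \<le> s" "s \<le> T"
      show "expectation (\<lambda>w. cv I t w * cv I s w) = (\<integral>v. indicator {..t} v * e2 v \<partial>leb s)"
      proof (cases "t \<le> s")
        case True
        then show ?thesis using ito_cv(4)[OF t(1) True] integral_leb_mono[OF True, of e2] by simp
      next
        case False
        then have st: "s \<le> t" by simp
        have "expectation (\<lambda>w. cv I t w * cv I s w) = (\<integral>v. e2 v \<partial>leb s)"
          using ito_cv(4)[OF s(1) st] by (simp add: mult.commute)
        also have "\<dots> = (\<integral>v. indicator {..t} v * e2 v \<partial>leb s)"
          using st by (intro Bochner_Integration.integral_cong) (auto simp: indicator_def)
        finally show ?thesis .
      qed
    qed
    also have "\<dots> = (\<integral>v. exp (- b * v) * (indicator {..t} v * e2 v) \<partial>leb T)"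
      by (rule disc_integral[OF i T])
    also have "\<dots> = (\<integral>v. exp (- b * v) * e2 v \<partial>leb t)"
      using integral_leb_mono[OF t(2), of "\<lambda>v. exp (- b * v) * e2 v"] by (simp add: mult.left_commute)
    finally show ?thesis .
  qed
  have "expectation (\<lambda>w. (?J w)\<^sup>2) = disc b T (\<lambda>t. expectation (\<lambda>w. ?J w * cv I t w))"
    unfolding power2_eq_square by (rule disc_ito_expectation(2)[OF disc_ito_sq_integrable])
  also have "\<dots> = disc b T (\<lambda>t. \<integral>v. exp (- b * v) * e2 v \<partial>leb t)"
    using h by (intro disc_cong T) auto
  also have "\<dots> = (\<integral>v. exp (- b * v) * (exp (- b * v) * e2 v) \<partial>leb T)"
    by (rule disc_integral[OF integrable_leb_exp_mult[OF e2i] T])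
  finally show ?thesis .
qed

text \<open>The drift counterpart of \<open>disc_ito_mart\<close>: the two expectations differ
  exactly by the factor \<open>al\<close>, which is why the drift cancels in the budget when
  \<open>al\<close> is \<open>- lam\<close>.\<close>

lemma mart_time_integral:
  shows "integrable M (\<lambda>w. mart al T w * (\<integral>s. exp (- b * s) * H s w \<partial>leb T))"
    and "expectation (\<lambda>w. mart al T w * (\<integral>s. exp (- b * s) * H s w \<partial>leb T))
      = (\<integral>v. exp (- b * v) * expectation (\<lambda>w. mart al v w * H v w) \<partial>leb T)"
proof -
  interpret P: pair_sigma_finite M "leb T" by (rule pair_sigma_finite_leb)
  note Hsq = ito_sq_integrable(2)[OF I T]
  have H: "adapted F H" "measurable_process M H" using I by (auto simp: ito_integral_L2_def L2_loc_def)
  have Ksq: "sq_integrable (PM T) (\<lambda>(w, s). mart al T w * exp (- b * s))"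
  proof -
    have "integrable (leb T) (\<lambda>s. (exp (- b * s))\<^sup>2)" "integrable (leb T) (\<lambda>s. exp (- b * s))"
      by (auto intro!: integrable_leb_continuous continuous_intros)
    from integrable_pair_mult[OF sq_integrableD(2)[OF mart_moments(3)[OF T]] this(1)]
      integrable_pair_mult[OF mart_moments(1)[OF T] this(2)]
    show ?thesis by (auto simp: sq_integrable_def power_mult_distrib split_beta')
  qed
  have int: "integrable (PM T) (\<lambda>(w, s). (mart al T w * exp (- b * s)) * H s w)"
    using sq_integrable_mult_integrable[OF Ksq Hsq] by (simp add: split_beta')
  have int2: "integrable (PM T) (\<lambda>(w, s). mart al s w * H s w)"
    using sq_integrable_mult_integrable[OF mart_pair_sq_integrable[OF T] Hsq] by (simp add: split_beta')
  have eq: "mart al T w * (\<integral>s. exp (- b * s) * H s w \<partial>leb T) = (\<integral>s. (mart al T w * exp (- b * s)) * H s w \<partial>leb T)" for w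
    by (simp add: mult.assoc)
  show "integrable M (\<lambda>w. mart al T w * (\<integral>s. exp (- b * s) * H s w \<partial>leb T))"
    unfolding eq by (rule P.integrable_fst[OF int])
  have "expectation (\<lambda>w. mart al T w * (\<integral>s. exp (- b * s) * H s w \<partial>leb T)) = (\<integral>s. expectation (\<lambda>w. (mart al T w * exp (- b * s)) * H s w) \<partial>leb T)"
    unfolding eq by (rule P.Fubini_integral[OF int, symmetric])
  also have "\<dots> = (\<integral>v. exp (- b * v) * expectation (\<lambda>w. mart al v w * H v w) \<partial>leb T)"
  proof (rule integral_cong_AE)
    show "(\<lambda>s. expectation (\<lambda>w. (mart al T w * exp (- b * s)) * H s w)) \<in> borel_measurable (leb T)"
      using P.integrable_snd[OF int] by (rule borel_measurable_integrable)
    show "(\<lambda>v. exp (- b * v) * expectation (\<lambda>w. mart al v w * H v w)) \<in> borel_measurable (leb T)"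
      using integrable_leb_exp_mult[OF P.integrable_snd[OF int2]] by (rule borel_measurable_integrable)
    \<comment> \<open>Only for almost every \<open>s\<close> is \<open>mart al s w * H s w\<close>
      integrable in \<open>w\<close>, so the martingale property is available only there.\<close>
    show "AE s in leb T. expectation (\<lambda>w. (mart al T w * exp (- b * s)) * H s w) = exp (- b * s) * expectation (\<lambda>w. mart al s w * H s w)"
      using P.AE_integrable_snd[OF int2] AE_space
    proof eventually_elim
      case (elim s)
      then have s: "0 \<le> s" "s \<le> T" by auto
      have "expectation (\<lambda>w. mart al T w * H s w) = expectation (\<lambda>w. mart al s w * H s w)"
        using H(1) s by (intro mart_expectation_mult(2)[OF s _ elim(1)]) (auto simp: adapted_def)
      moreover have "expectation (\<lambda>w. (mart al T w * exp (- b * s)) * H s w) = expectation (\<lambda>w. exp (- b * s) * (mart al T w * H s w))"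
        by (simp add: mult_ac)
      ultimately show ?case by simp
    qed
  qed
  finally show "expectation (\<lambda>w. mart al T w * (\<integral>s. exp (- b * s) * H s w \<partial>leb T))
      = (\<integral>v. exp (- b * v) * expectation (\<lambda>w. mart al v w * H v w) \<partial>leb T)" .
qed

end

subsection \<open>The budget inequality\<close>

lemma ito_integralE:
  assumes "ito_integral M F W H I"
  obtains \<tau> :: "nat \<Rightarrow> 'a \<Rightarrow> real"
  where "\<And>n. \<tau> n \<in> borel_measurable M" "\<And>n w. w \<in> space M \<Longrightarrow> 0 \<le> \<tau> n w"
    "AE w in M. filterlim (\<lambda>n. \<tau> n w) at_top sequentially"
    "\<And>n. ito_integral_L2 M F W (\<lambda>t w. if t \<le> \<tau> n w then H t w else 0) (\<lambda>t w. I (min t (\<tau> n w)) w)"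
    "AE w in M. continuous_on {0..} (\<lambda>t. I t w)"
proof -
  from assms obtain \<tau> :: "nat \<Rightarrow> 'a \<Rightarrow> real" where \<tau>: "\<forall>n. stopping_time F (\<tau> n) \<and> (\<forall>w\<in>space M. 0 \<le> \<tau> n w)"
    "AE w in M. incseq (\<lambda>n. \<tau> n w) \<and> filterlim (\<lambda>n. \<tau> n w) at_top sequentially"
    "\<forall>n. ito_integral_L2 M F W (\<lambda>t w. if t \<le> \<tau> n w then H t w else 0) (\<lambda>t w. I (min t (\<tau> n w)) w)"
    unfolding ito_integral_def by auto
  show ?thesis
  proof (rule that)
    show "\<tau> n \<in> borel_measurable M" for n using \<tau>(1) stopping_time_measurable by auto
    show "0 \<le> \<tau> n w" if "w \<in> space M" for n w using \<tau>(1) that by auto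
    show "AE w in M. filterlim (\<lambda>n. \<tau> n w) at_top sequentially" using \<tau>(2) by eventually_elim simp
    show "ito_integral_L2 M F W (\<lambda>t w. if t \<le> \<tau> n w then H t w else 0) (\<lambda>t w. I (min t (\<tau> n w)) w)" for n
      using \<tau>(3) by auto
    show "AE w in M. continuous_on {0..} (\<lambda>t. I t w)"
      using assms by (simp add: ito_integral_def continuous_paths_def)
  qed
qed

lemma L1_loc_path_integrable:
  assumes "c \<in> L1_loc_nonneg M F"
  shows "AE w in M. integrable (leb T) (\<lambda>s. c s w)"
proof -
  \<comment> \<open>The space bounds the integral only for positive horizons, hence the maximum with
    1.\<close>
  define R where "R = max T 1"
  have R: "R > 0" "T \<le> R" by (auto simp: R_def)
  have m: "measurable_process M c" and fin: "(\<integral>\<^sup>+w. (\<integral>\<^sup>+t\<in>{0..R}. ennreal \<bar>c t w\<bar> \<partial>lborel) \<partial>M) < \<infinity>"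
    using assms R by (auto simp: L1_loc_nonneg_def)
  note cm = measurable_process_leb[OF m, of R]
  have "(\<lambda>w. \<integral>\<^sup>+t. ennreal \<bar>c t w\<bar> \<partial>leb R) \<in> borel_measurable M"
    using leb.borel_measurable_nn_integral_fst[of "\<lambda>(w, t). ennreal \<bar>c t w\<bar>" M R] cm by (simp add: split_beta')
  from nn_integral_PInf_AE[OF this] fin have "AE w in M. (\<integral>\<^sup>+t. ennreal \<bar>c t w\<bar> \<partial>leb R) \<noteq> \<infinity>"
    by (simp add: nn_integral_leb)
  then show ?thesis
    using AE_space
  proof eventually_elim
    case (elim w)
    have "(\<lambda>s. c s w) \<in> borel_measurable (leb R)"
      using measurable_compose[OF measurable_Pair1'[OF elim(2)] cm] by simp
    then have "integrable (leb R) (\<lambda>s. c s w)" using elim(1) by (intro integrableI_bounded) (auto simp: less_top)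
    then show ?case using R(2) by (rule integrable_leb_subset)
  qed
qed

lemma AE_leb_of_lborel:
  assumes "AE t in lborel. 0 \<le> t \<longrightarrow> P t" shows "AE t in leb T. P t"
  unfolding leb_def by (subst AE_restrict_space_iff) (use assms in \<open>auto elim!: eventually_mono\<close>)

text \<open>Discounted wealth plus discounted consumption up to the stopping time has expectation
  \<open>x\<close> under the weight \<open>mart (- lam) T\<close>. Nonnegative wealth leaves
  consumption below it, and Fatou's lemma removes the stopping. A single terminal weight serves all
  paths; it is exchanged for the weight at time \<open>s\<close> at the end.\<close>

lemma budget_constraint:
  assumes c: "c \<in> L1_loc_nonneg M F" and X: "wealth_process M F W r \<sigma> lam x c \<pi> X"
    and nn: "AE w in M. \<forall>t\<ge>0. 0 \<le> X t w" and T: "0 \<le> T"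
  shows "(\<integral>\<^sup>+s. \<integral>\<^sup>+w. ennreal (exp (- r * s) * mart (- lam) s w) * ennreal (c s w) \<partial>M \<partial>leb T) \<le> ennreal x"
proof -
  interpret P: pair_sigma_finite M "leb T" by (rule pair_sigma_finite_leb)
  let ?m = "mart (- lam)"
  let ?b = "\<lambda>s w. r * X s w + \<sigma> * lam * \<pi> s w - c s w"
  from X obtain I where I: "ito_integral M F W (\<lambda>t w. \<sigma> * \<pi> t w) I"
    and eq: "AE w in M. \<forall>t\<ge>0. X t w = x + (LBINT s:{0..t}. ?b s w) + I t w"
    unfolding wealth_process_def solves_SDE_def by auto
  have Xc: "AE w in M. continuous_on {0..} (\<lambda>t. X t w)"
    and bi: "AE w in M. \<forall>T\<ge>0. set_integrable lborel {0..T} (\<lambda>s. ?b s w)"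
    using X by (auto simp: wealth_process_def solves_SDE_def continuous_paths_def)
  obtain \<tau> where \<tau>: "\<And>n. \<tau> n \<in> borel_measurable M" "\<And>n w. w \<in> space M \<Longrightarrow> 0 \<le> \<tau> n w"
    "AE w in M. filterlim (\<lambda>n. \<tau> n w) at_top sequentially"
    "\<And>n. ito_integral_L2 M F W (\<lambda>t w. if t \<le> \<tau> n w then \<sigma> * \<pi> t w else 0) (\<lambda>t w. I (min t (\<tau> n w)) w)"
    and Ic: "AE w in M. continuous_on {0..} (\<lambda>t. I t w)"
    using ito_integralE[OF I] by blast
  define Hn where "Hn n t w = (if t \<le> \<tau> n w then \<sigma> * \<pi> t w else 0)" for n t w
  define In where "In n t w = I (min t (\<tau> n w)) w" for n t w
  have ito: "ito_integral_L2 M F W (Hn n) (In n)" for n using \<tau>(4)[of n] unfolding Hn_def In_def .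
  \<comment> \<open>Discounted wealth at \<open>min T (\<tau> n w)\<close> plus consumption
    discounted up to then. \<open>Hn\<close> vanishes after \<open>\<tau> n\<close>, so the time
    integral may run to \<open>T\<close>.\<close>
  define R where "R n w = x + lam * (\<integral>s. exp (- r * s) * Hn n s w \<partial>leb T) + disc r T (\<lambda>s. cv (In n) s w)" for n w
  define f where "f s w = ennreal (exp (- r * s) * c s w)" for s w
  define G where "G w = ennreal (?m T w) * (\<integral>\<^sup>+s. f s w \<partial>leb T)" for w
  define Gn where "Gn n w = ennreal (?m T w) * (\<integral>\<^sup>+s. indicator {..\<tau> n w} s * f s w \<partial>leb T)" for n w
  have cmp: "measurable_process M c" and cad: "adapted F c"
    and c0: "AE w in M. AE t in lborel. 0 \<le> t \<longrightarrow> 0 \<le> c t w"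
    using c by (auto simp: L1_loc_nonneg_def)
  have fm: "(\<lambda>(w, s). f s w) \<in> borel_measurable (PM T)"
    using measurable_process_leb[OF cmp, of T] exp_leb_measurable[of "- r" T] unfolding f_def split_beta' by measurable
  \<comment> \<open>The drift contributes \<open>lam\<close> times a time integral and the Girsanov
    term \<open>- lam\<close> times the same integral.\<close>
  have R_int: "integrable M (\<lambda>w. ?m T w * R n w)" and R_exp: "expectation (\<lambda>w. ?m T w * R n w) = x" for n
  proof -
    note i1 = mart_moments(1)[OF T, of "- lam"] and e1 = mart_moments(2)[OF T, of "- lam"]
    note i2 = mart_time_integral(1)[OF ito[of n] T, of "- lam" r] and e2 = mart_time_integral(2)[OF ito[of n] T, of "- lam" r]
    note i3 = disc_ito_expectation(1)[OF ito[of n] T mart_moments(3)[OF T], of "- lam" r] and e3 = disc_ito_mart[OF ito[of n] T, of "- lam" r]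
    have R: "?m T w * R n w = (x * ?m T w + lam * (?m T w * (\<integral>s. exp (- r * s) * Hn n s w \<partial>leb T)))
        + ?m T w * disc r T (\<lambda>s. cv (In n) s w)" for w
      by (simp add: R_def algebra_simps)
    show "integrable M (\<lambda>w. ?m T w * R n w)"
      unfolding R by (intro Bochner_Integration.integrable_add integrable_mult_right i1 i2 i3)
    show "expectation (\<lambda>w. ?m T w * R n w) = x"
    proof -
      have a: "integrable M (\<lambda>w. x * ?m T w + lam * (?m T w * (\<integral>s. exp (- r * s) * Hn n s w \<partial>leb T)))"
        by (intro Bochner_Integration.integrable_add integrable_mult_right i1 i2)
      show ?thesis
        unfolding R Bochner_Integration.integral_add[OF a i3]
          Bochner_Integration.integral_add[OF integrable_mult_right[OF i1] integrable_mult_right[OF i2]]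
          integral_mult_right_zero e1 e2 e3 by simp
    qed
  qed
  have key: "AE w in M. Gn n w \<le> ennreal (?m T w * R n w)" and Rnn: "AE w in M. 0 \<le> R n w" for n
  proof -
    have cvI: "AE w in M. \<forall>t. cv (In n) t w = In n t w"
      using ito[of n] by (intro AE_cv) (auto simp: ito_integral_L2_def)
    have "AE w in M. Gn n w \<le> ennreal (?m T w * R n w) \<and> 0 \<le> R n w"
      using eq Xc bi Ic nn c0 L1_loc_path_integrable[OF c, of T] cvI AE_space
    proof eventually_elim
      case (elim w)
      let ?th = "min T (\<tau> n w)"
      have th: "0 \<le> ?th" "?th \<le> T" using T \<tau>(2)[OF elim(9)] by auto
      have ci: "integrable (leb ?th) (\<lambda>s. c s w)" by (rule integrable_leb_subset[OF elim(7) th(2)])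
      have b': "?b s w = r * X s w + (\<sigma> * lam * \<pi> s w - c s w)" for s by simp
      have hi: "integrable (leb t) (\<lambda>s. r * X s w + (\<sigma> * lam * \<pi> s w - c s w))" if "0 \<le> t" for t
        using elim(3) that unfolding b' set_integrable_leb by auto
      have eq': "X t w = x + (\<integral>s. r * X s w + (\<sigma> * lam * \<pi> s w - c s w) \<partial>leb t) + I t w" if "0 \<le> t" for t
        using elim(1) that unfolding b' LBINT_leb by auto
      have gi: "integrable (leb ?th) (\<lambda>s. \<sigma> * lam * \<pi> s w - c s w)"
        by (rule disc_path(2)[OF continuous_on_subset[OF elim(2)] hi[OF th(1)] th(1) eq']) auto
      \<comment> \<open>The equation provides integrability only of the whole drift; removing the
        wealth part and then the consumption isolates the portfolio term.\<close>
      have pi: "integrable (leb ?th) (\<lambda>s. \<sigma> * lam * \<pi> s w)"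
        using Bochner_Integration.integrable_add[OF gi ci] by simp
      have eci: "integrable (leb ?th) (\<lambda>s. exp (- r * s) * c s w)" by (rule integrable_leb_exp_mult[OF ci])
      have "(\<integral>s. exp (- r * s) * (\<sigma> * lam * \<pi> s w - c s w) \<partial>leb ?th) =
          (\<integral>s. exp (- r * s) * (\<sigma> * lam * \<pi> s w) \<partial>leb ?th) - (\<integral>s. exp (- r * s) * c s w \<partial>leb ?th)"
        using integrable_leb_exp_mult[OF pi, of "- r"] eci by (simp add: right_diff_distrib)
      also have "(\<integral>s. exp (- r * s) * (\<sigma> * lam * \<pi> s w) \<partial>leb ?th) = (\<integral>s. lam * (exp (- r * s) * Hn n s w) \<partial>leb T)"
        unfolding integral_leb_mono[OF th(2)]
        by (intro Bochner_Integration.integral_cong) (auto simp: Hn_def indicator_def)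
      finally have "exp (- r * ?th) * X ?th w = R n w - (\<integral>s. exp (- r * s) * c s w \<partial>leb ?th)"
        using stopped_path[OF elim(2,4) hi eq' T \<tau>(2)[OF elim(9)], of n] elim(8) by (simp add: R_def In_def)
      moreover have "0 \<le> exp (- r * ?th) * X ?th w" using elim(5) th(1) by simp
      ultimately have le: "(\<integral>s. exp (- r * s) * c s w \<partial>leb ?th) \<le> R n w" by linarith
      have ec0: "AE s in leb ?th. 0 \<le> exp (- r * s) * c s w"
        using AE_leb_of_lborel[OF elim(6), of ?th] by eventually_elim simp
      have "0 \<le> (\<integral>s. exp (- r * s) * c s w \<partial>leb ?th)" by (rule integral_nonneg_AE[OF ec0])
      then have R0: "0 \<le> R n w" using le by simp
      have "(\<integral>\<^sup>+s. indicator {..\<tau> n w} s * f s w \<partial>leb T) = (\<integral>\<^sup>+s. f s w \<partial>leb ?th)"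
        unfolding nn_integral_leb_mono[OF th(2)] by (intro nn_integral_cong) (auto simp: indicator_def)
      also have "\<dots> = ennreal (\<integral>s. exp (- r * s) * c s w \<partial>leb ?th)"
        unfolding f_def by (rule nn_integral_eq_integral[OF eci ec0])
      also have "\<dots> \<le> ennreal (R n w)" using le by (rule ennreal_leI)
      finally have "Gn n w \<le> ennreal (?m T w) * ennreal (R n w)"
        unfolding Gn_def by (rule mult_left_mono) simp
      then show ?case using R0 by (simp add: ennreal_mult)
    qed
    then show "AE w in M. Gn n w \<le> ennreal (?m T w * R n w)" "AE w in M. 0 \<le> R n w" by auto
  qed
  have Gn_le: "(\<integral>\<^sup>+w. Gn n w \<partial>M) \<le> ennreal x" for n
  proof -
    have "(\<integral>\<^sup>+w. Gn n w \<partial>M) \<le> (\<integral>\<^sup>+w. ennreal (?m T w * R n w) \<partial>M)" by (rule nn_integral_mono_AE[OF key])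
    also have "\<dots> = ennreal x"
      using Rnn[of n] R_exp[of n] by (subst nn_integral_eq_integral[OF R_int]) (auto elim!: eventually_mono)
    finally show ?thesis .
  qed
  have Gn_m: "Gn n \<in> borel_measurable M" for n
  proof -
    have "(\<lambda>(w, s). ennreal (indicator {..\<tau> n w} s) * f s w) \<in> borel_measurable (PM T)"
      using stopped_indicator_measurable[OF \<tau>(1), of n T] fm unfolding split_beta' by measurable
    from leb.borel_measurable_nn_integral_fst[OF this] show ?thesis
      unfolding Gn_def using mart_M[OF T, of "- lam"] by (simp add: ennreal_indicator)
  qed
  \<comment> \<open>Fatou's lemma applies with equality inside: on almost every path
    \<open>\<tau> n\<close> eventually exceeds \<open>T\<close>, and \<open>Gn n\<close> then equals
    \<open>G\<close>.\<close>
  have "(\<integral>\<^sup>+w. G w \<partial>M) = (\<integral>\<^sup>+w. liminf (\<lambda>n. Gn n w) \<partial>M)"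
  proof (rule nn_integral_cong_AE)
    show "AE w in M. G w = liminf (\<lambda>n. Gn n w)"
      using \<tau>(3)
    proof eventually_elim
      case (elim w)
      have "\<forall>\<^sub>F n in sequentially. T \<le> \<tau> n w" using elim unfolding filterlim_at_top by blast
      then have "\<forall>\<^sub>F n in sequentially. Gn n w = G w"
      proof eventually_elim
        case (elim n)
        then show ?case unfolding Gn_def G_def
          by (intro arg_cong2[where f="(*)"] nn_integral_cong) (auto simp: indicator_def)
      qed
      from lim_imp_Liminf[OF _ tendsto_eventually[OF this]] show ?case by simp
    qed
  qed
  also have "\<dots> \<le> liminf (\<lambda>n. \<integral>\<^sup>+w. Gn n w \<partial>M)" by (rule nn_integral_liminf[OF Gn_m])
  also have "\<dots> \<le> ennreal x" using Gn_le by (intro Liminf_le) auto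
  finally have G_le: "(\<integral>\<^sup>+w. G w \<partial>M) \<le> ennreal x" .
  have "(\<integral>\<^sup>+s. \<integral>\<^sup>+w. ennreal (exp (- r * s) * ?m s w) * ennreal (c s w) \<partial>M \<partial>leb T)
      = (\<integral>\<^sup>+s. \<integral>\<^sup>+w. ennreal (?m T w) * f s w \<partial>M \<partial>leb T)"
  proof (rule nn_integral_cong)
    fix s assume "s \<in> space (leb T)"
    then have s: "0 \<le> s" "s \<le> T" by auto
    have [measurable]: "c s \<in> borel_measurable (F s)" using cad s by (auto simp: adapted_def)
    have "f s \<in> borel_measurable (F s)" unfolding f_def by measurable
    from mart_nn_integral_mult[OF s this, of "- lam"]
    have "(\<integral>\<^sup>+w. ennreal (?m T w) * f s w \<partial>M) = (\<integral>\<^sup>+w. ennreal (?m s w) * f s w \<partial>M)" .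
    also have "\<dots> = (\<integral>\<^sup>+w. ennreal (exp (- r * s) * ?m s w) * ennreal (c s w) \<partial>M)"
      by (intro nn_integral_cong) (simp add: f_def ennreal_mult', simp add: mult_ac)
    finally show "(\<integral>\<^sup>+w. ennreal (exp (- r * s) * ?m s w) * ennreal (c s w) \<partial>M) = (\<integral>\<^sup>+w. ennreal (?m T w) * f s w \<partial>M)" by simp
  qed
  also have "\<dots> = (\<integral>\<^sup>+w. \<integral>\<^sup>+s. ennreal (?m T w) * f s w \<partial>leb T \<partial>M)"
    using fm mart_M[OF T, of "- lam"] by (intro P.Fubini') (auto simp: split_beta')
  also have "\<dots> = (\<integral>\<^sup>+w. G w \<partial>M)"
  proof (rule nn_integral_cong)
    fix w assume wM: "w \<in> space M"
    have "(\<lambda>s. f s w) \<in> borel_measurable (leb T)"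
      using measurable_compose[OF measurable_Pair1'[OF wM] fm] by simp
    then show "(\<integral>\<^sup>+s. ennreal (?m T w) * f s w \<partial>leb T) = G w" unfolding G_def by (rule nn_integral_cmult)
  qed
  finally show ?thesis using G_le by simp
qed

end

subsection \<open>Uniqueness of geometric Brownian motion\<close>

lemma gronwall_leb:
  assumes D: "\<And>t. 0 \<le> t \<Longrightarrow> t \<le> T \<Longrightarrow> 0 \<le> D t \<and> D t \<le> C" and int: "integrable (leb T) D"
    and le: "\<And>t. 0 \<le> t \<Longrightarrow> t \<le> T \<Longrightarrow> D t \<le> e + K * (\<integral>s. D s \<partial>leb t)" and K: "0 \<le> K" and T: "0 \<le> T"
  shows "D T \<le> 2 * e * exp ((2 * K + 1) * T)"
proof -
  define k where "k = 2 * K + 1"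
  have k: "k > 0" "K / k \<le> 1 / 2" using K by (auto simp: k_def field_simps)
  define S where "S = (SUP t\<in>{0..T}. D t * exp (- k * t))"
  have "D t * exp (- k * t) \<le> C" if "t \<in> {0..T}" for t
    using D[of t] that k mult_mono[of "D t" C "exp (- k * t)" 1] by auto
  then have bdd: "bdd_above ((\<lambda>t. D t * exp (- k * t)) ` {0..T})" by (intro bdd_aboveI2)
  have S: "D t * exp (- k * t) \<le> S" if "0 \<le> t" "t \<le> T" for t
    unfolding S_def using that by (intro cSUP_upper[OF _ bdd]) auto
  have "0 \<le> S" using S[OF order_refl T] D[OF order_refl T] by simp
  have "S \<le> e + S / 2"
    unfolding S_def
  proof (rule cSUP_least)
    fix t assume "t \<in> {0..T}"
    then have t: "0 \<le> t" "t \<le> T" by auto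
    have Ds: "D s \<le> S * exp (k * s)" if "s \<in> space (leb t)" for s
      using S[of s] that t by (simp add: exp_minus field_simps)
    have e1: "k * (\<integral>s. exp (k * s) \<partial>leb t) = exp (k * t) - 1"
    proof -
      have "(\<integral>s. indicator {0..} s * exp (- (- k) * s) \<partial>leb t) = (\<integral>s. exp (k * s) \<partial>leb t)"
        by (intro Bochner_Integration.integral_cong) auto
      then show ?thesis using integral_leb_exp[of 0 t "- k"] t by simp
    qed
    have "(\<integral>s. D s \<partial>leb t) \<le> (\<integral>s. S * exp (k * s) \<partial>leb t)"
      by (rule integral_mono[OF integrable_leb_subset[OF int t(2)] _ Ds])
         (auto intro!: integrable_leb_continuous continuous_intros)
    also have "\<dots> = S * ((exp (k * t) - 1) / k)"
    proof -
      have "(\<integral>s. exp (k * s) \<partial>leb t) = (exp (k * t) - 1) / k" unfolding e1[symmetric] using k by simp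
      then show ?thesis by simp
    qed
    also have "\<dots> \<le> S * (exp (k * t) / k)" using k \<open>0 \<le> S\<close> by (intro mult_left_mono divide_right_mono) auto
    finally have "D t \<le> e + K * (S * (exp (k * t) / k))" using le[OF t] K mult_left_mono[OF _ K] by (meson add_left_mono order_trans)
    then have "D t * exp (- k * t) \<le> (e + K * (S * (exp (k * t) / k))) * exp (- k * t)"
      by (intro mult_right_mono) auto
    also have "\<dots> = e * exp (- k * t) + K / k * S" by (simp add: field_simps exp_minus)
    also have "\<dots> \<le> e * 1 + 1 / 2 * S"
    proof (intro add_mono mult_left_mono mult_right_mono k \<open>0 \<le> S\<close>)
      show "exp (- k * t) \<le> 1" using k t by simp
      have "(\<integral>s. D s \<partial>leb 0) = 0"
        using integral_leb_mono[of 0 0 D] by (simp add: leb_def integral_restrict_space) (rule integral_eq_zero_AE, rule AE_mp[OF AE_lborel_singleton[of 0]], auto simp: indicator_def)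
      then show "0 \<le> e" using le[OF order_refl T] D[OF order_refl T] by simp
    qed
    finally show "D t * exp (- k * t) \<le> e + (SUP t\<in>{0..T}. D t * exp (- k * t)) / 2" by (simp add: S_def)
  qed (use T in auto)
  then have "S \<le> 2 * e" by simp
  then have "D T * exp (- k * T) \<le> 2 * e" using S[OF T order_refl] by simp
  then show ?thesis unfolding k_def[symmetric] by (simp add: exp_minus field_simps)
qed

context brownian_motion
begin

context
  fixes X I and b be x :: real and \<tau> :: "'a \<Rightarrow> real"
  assumes Xp: "measurable_process M X" "adapted F X"
    and path: "AE w in M. continuous_on {0..} (\<lambda>t. X t w) \<and> continuous_on {0..} (\<lambda>t. I t w) \<and>
      (\<forall>T\<ge>0. integrable (leb T) (\<lambda>s. b * X s w)) \<and> (\<forall>t\<ge>0. X t w = x + (\<integral>s. b * X s w \<partial>leb t) + I t w)"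
    and \<tau>m: "\<tau> \<in> borel_measurable M" and \<tau>0: "\<And>w. w \<in> space M \<Longrightarrow> 0 \<le> \<tau> w"
    and ito: "ito_integral_L2 M F W (\<lambda>t w. if t \<le> \<tau> w then be * X t w else 0) (\<lambda>t w. I (min t (\<tau> w)) w)"
begin

abbreviation "Hs t w \<equiv> if t \<le> \<tau> w then be * X t w else 0"
abbreviation "Is t w \<equiv> I (min t (\<tau> w)) w"

text \<open>\<open>gbm_error\<close> is the difference between the stopped discounted solution and the candidate \<open>x * mart be\<close>.
  It is an Ito integral whose integrand has second moment \<open>phi\<close>; that integrand is again \<open>be\<close> times
  the error before \<open>\<tau>\<close>, which closes the Gronwall loop.\<close>

definition "gbm_error t w = disc b t (\<lambda>s. cv Is s w) - x * (mart be t w - 1)"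

lemma gbm_error_eq:
  assumes "0 \<le> t"
  shows "AE w in M. gbm_error t w = exp (- b * min t (\<tau> w)) * X (min t (\<tau> w)) w - x * mart be t w"
proof -
  have cvI: "AE w in M. \<forall>t. cv Is t w = Is t w"
    using ito by (intro AE_cv) (auto simp: ito_integral_L2_def)
  show ?thesis
    using path cvI AE_space
  proof eventually_elim
    case (elim w)
    have "exp (- b * min t (\<tau> w)) * X (min t (\<tau> w)) w
      = x + (\<integral>s. exp (- b * s) * 0 \<partial>leb (min t (\<tau> w))) + disc b t (\<lambda>s. I (min s (\<tau> w)) w)"
      by (rule stopped_path) (use elim assms \<tau>0 in auto)
    then show ?case using elim(2) by (simp add: gbm_error_def algebra_simps)
  qed
qed

lemma gbm_error_sq_integrable:
  assumes "0 \<le> t" shows "sq_integrable M (gbm_error t)"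
proof -
  have one: "sq_integrable M (\<lambda>_. 1)" by (simp add: sq_integrable_def)
  show ?thesis unfolding gbm_error_def
    by (intro sq_integrable_diff sq_integrable_cmult disc_ito_sq_integrable[OF ito assms] mart_moments(3)[OF assms] one)
qed

abbreviation "phi v \<equiv> exp (- b * v) * (exp (- b * v) * expectation (\<lambda>w. (Hs v w)\<^sup>2))
   - 2 * x * be * (exp (- b * v) * expectation (\<lambda>w. mart be v w * Hs v w)) + x\<^sup>2 * be\<^sup>2 * exp (be\<^sup>2 * v)"

lemma phi_integrable:
  assumes t: "0 \<le> t" shows "integrable (leb t) phi"
  by (intro Bochner_Integration.integrable_add Bochner_Integration.integrable_diff integrable_mult_right
      integrable_leb_exp_mult ito_integrable_square[OF ito t] ito_integrable_mart[OF ito t] integrable_leb_continuous continuous_intros)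

lemma gbm_error_square:
  assumes t: "0 \<le> t" shows "expectation (\<lambda>w. (gbm_error t w)\<^sup>2) = (\<integral>v. phi v \<partial>leb t)"
proof -
  let ?J = "\<lambda>w. disc b t (\<lambda>s. cv Is s w)"
  note Jsq = disc_ito_sq_integrable[OF ito t, of b] and msq = mart_moments(3)[OF t, of be]
  have one: "sq_integrable M (\<lambda>_. 1)" by (simp add: sq_integrable_def)
  have m0: "mart 0 s w = 1" for s w by (simp add: mart_def)
  have e0: "expectation ?J = 0" using disc_ito_mart[OF ito t, of 0 b] by (simp add: m0)
  have J1: "integrable M ?J" using sq_integrable_mult_integrable[OF Jsq one] by simp
  note mJ = sq_integrable_mult_integrable[OF msq Jsq]
  have eq: "(gbm_error t w)\<^sup>2 = ((?J w)\<^sup>2 - 2 * x * (mart be t w * ?J w)) + (2 * x * ?J w + (x\<^sup>2 * (mart be t w)\<^sup>2 - 2 * x\<^sup>2 * mart be t w + x\<^sup>2))" for w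
    by (simp add: gbm_error_def power2_eq_square algebra_simps)
  have "expectation (\<lambda>w. (gbm_error t w)\<^sup>2) = (expectation (\<lambda>w. (?J w)\<^sup>2) - 2 * x * expectation (\<lambda>w. mart be t w * ?J w))
      + (2 * x * expectation ?J + (x\<^sup>2 * expectation (\<lambda>w. (mart be t w)\<^sup>2) - 2 * x\<^sup>2 * expectation (mart be t) + x\<^sup>2))"
    unfolding eq using sq_integrableD(2)[OF Jsq] mJ J1 mart_moments(1)[OF t, of be] sq_integrableD(2)[OF msq]
    by (simp add: prob_space)
  also have "\<dots> = expectation (\<lambda>w. (?J w)\<^sup>2) - 2 * x * expectation (\<lambda>w. mart be t w * ?J w) + x\<^sup>2 * (exp (be\<^sup>2 * t) - 1)"
    unfolding e0 mart_moments(2)[OF t] mart_moments(4)[OF t] by (simp add: algebra_simps)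
  also have "exp (be\<^sup>2 * t) - 1 = be\<^sup>2 * (\<integral>v. exp (be\<^sup>2 * v) \<partial>leb t)"
  proof -
    have "(\<integral>s. indicator {0..} s * exp (- (- be\<^sup>2) * s) \<partial>leb t) = (\<integral>s. exp (be\<^sup>2 * s) \<partial>leb t)"
      by (intro Bochner_Integration.integral_cong) auto
    then show ?thesis using integral_leb_exp[of 0 t "- be\<^sup>2"] t by simp
  qed
  also have "expectation (\<lambda>w. (?J w)\<^sup>2) - 2 * x * expectation (\<lambda>w. mart be t w * ?J w) + x\<^sup>2 * (be\<^sup>2 * (\<integral>v. exp (be\<^sup>2 * v) \<partial>leb t))
     = (\<integral>v. phi v \<partial>leb t)"
  proof -
    note i1 = integrable_leb_exp_mult[OF integrable_leb_exp_mult[OF ito_integrable_square[OF ito t]], of "- b" "- b"]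
    note i2 = integrable_mult_right[OF integrable_leb_exp_mult[OF ito_integrable_mart[OF ito t]], of "2 * x * be" "- b" be]
    have i3: "integrable (leb t) (\<lambda>v. x\<^sup>2 * be\<^sup>2 * exp (be\<^sup>2 * v))"
      by (intro integrable_leb_continuous continuous_intros)
    show ?thesis
      unfolding disc_ito_square[OF ito t] disc_ito_mart[OF ito t]
        Bochner_Integration.integral_add[OF Bochner_Integration.integrable_diff[OF i1 i2] i3] Bochner_Integration.integral_diff[OF i1 i2]
      by simp
  qed
  finally show ?thesis .
qed

abbreviation "tail v \<equiv> expectation (\<lambda>w. (if v \<le> \<tau> w then 0 else 1) * (mart be v w)\<^sup>2)"

lemma phi_le:
  assumes T: "0 \<le> T"
  shows "AE v in leb T. 0 \<le> phi v \<and> phi v \<le> be\<^sup>2 * (expectation (\<lambda>w. (gbm_error v w)\<^sup>2) + x\<^sup>2 * tail v)"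
proof -
  interpret P: pair_sigma_finite M "leb T" by (rule pair_sigma_finite_leb)
  have Hi: "integrable (PM T) (\<lambda>(w, v). (Hs v w)\<^sup>2)"
    using sq_integrableD(2)[OF ito_sq_integrable(2)[OF ito T]] by (simp add: split_beta')
  have Hm: "measurable_process M Hs" using ito by (auto simp: ito_integral_L2_def L2_loc_def)
  show ?thesis
    using P.AE_integrable_snd[OF Hi] AE_space
  proof eventually_elim
    case (elim v)
    then have v: "0 \<le> v" by simp
    have Hsq: "sq_integrable M (Hs v)"
      using elim(1) measurable_process_section[OF Hm v] by (simp add: sq_integrable_def)
    note msq = mart_moments(3)[OF v, of be]
    note mH = sq_integrable_mult_integrable[OF msq Hsq]
    have "phi v = expectation (\<lambda>w. exp (- b * v) * (exp (- b * v) * (Hs v w)\<^sup>2) - 2 * x * be * (exp (- b * v) * (mart be v w * Hs v w)) + x\<^sup>2 * be\<^sup>2 * (mart be v w)\<^sup>2)"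
      using elim(1) mH sq_integrableD(2)[OF msq] by (simp add: mart_moments(4)[OF v])
    also have "\<dots> = expectation (\<lambda>w. (exp (- b * v) * Hs v w - x * be * mart be v w)\<^sup>2)"
      by (intro Bochner_Integration.integral_cong refl) (simp only: power2_eq_square algebra_simps)
    finally have phi: "phi v = expectation (\<lambda>w. (exp (- b * v) * Hs v w - x * be * mart be v w)\<^sup>2)" .
    have sq: "sq_integrable M (\<lambda>w. exp (- b * v) * Hs v w - x * be * mart be v w)"
      by (intro sq_integrable_diff sq_integrable_cmult Hsq msq)
    have tm: "(\<lambda>w. if v \<le> \<tau> w then 0 else 1 :: real) \<in> borel_measurable M" using \<tau>m by measurable
    have ti: "integrable M (\<lambda>w. (if v \<le> \<tau> w then 0 else 1) * (mart be v w)\<^sup>2)"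
      by (rule Bochner_Integration.integrable_bound[OF sq_integrableD(2)[OF msq]])
         (use tm msq in \<open>auto simp: sq_integrable_def\<close>)
    have "expectation (\<lambda>w. (exp (- b * v) * Hs v w - x * be * mart be v w)\<^sup>2)
       \<le> expectation (\<lambda>w. be\<^sup>2 * (gbm_error v w)\<^sup>2 + be\<^sup>2 * x\<^sup>2 * ((if v \<le> \<tau> w then 0 else 1) * (mart be v w)\<^sup>2))"
    proof (rule integral_mono_AE)
      show "integrable M (\<lambda>w. (exp (- b * v) * Hs v w - x * be * mart be v w)\<^sup>2)" using sq by (simp add: sq_integrable_def)
      show "integrable M (\<lambda>w. be\<^sup>2 * (gbm_error v w)\<^sup>2 + be\<^sup>2 * x\<^sup>2 * ((if v \<le> \<tau> w then 0 else 1) * (mart be v w)\<^sup>2))"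
        using sq_integrableD(2)[OF gbm_error_sq_integrable[OF v]] ti by (intro Bochner_Integration.integrable_add integrable_mult_right)
      show "AE w in M. (exp (- b * v) * Hs v w - x * be * mart be v w)\<^sup>2
        \<le> be\<^sup>2 * (gbm_error v w)\<^sup>2 + be\<^sup>2 * x\<^sup>2 * ((if v \<le> \<tau> w then 0 else 1) * (mart be v w)\<^sup>2)"
        using gbm_error_eq[OF v]
      proof eventually_elim
        case (elim w)
        show ?case
        proof (cases "v \<le> \<tau> w")
          case True
          then have ev: "gbm_error v w = exp (- b * v) * X v w - x * mart be v w" using elim by simp
          have "exp (- b * v) * Hs v w - x * be * mart be v w = be * gbm_error v w"
            unfolding ev using True by (simp add: algebra_simps)
          then show ?thesis using True by (simp add: power_mult_distrib)
        next
          case False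
          then show ?thesis by (simp add: power_mult_distrib)
        qed
      qed
    qed
    also have "\<dots> = be\<^sup>2 * (expectation (\<lambda>w. (gbm_error v w)\<^sup>2) + x\<^sup>2 * tail v)"
      using sq_integrableD(2)[OF gbm_error_sq_integrable[OF v]] ti
      by (subst Bochner_Integration.integral_add) (auto simp: algebra_simps)
    finally show ?case unfolding phi by auto
  qed
qed

lemma tail_integral:
  assumes T: "0 \<le> T"
  shows "integrable (leb T) tail"
    and "(\<integral>v. tail v \<partial>leb T) = expectation (\<lambda>w. \<integral>v. (if v \<le> \<tau> w then 0 else 1) * (mart be v w)\<^sup>2 \<partial>leb T)"
    and "(\<lambda>w. \<integral>v. (if v \<le> \<tau> w then 0 else 1) * (mart be v w)\<^sup>2 \<partial>leb T) \<in> borel_measurable M"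
proof -
  interpret P: pair_sigma_finite M "leb T" by (rule pair_sigma_finite_leb)
  have m: "(\<lambda>(w, v). if v \<le> \<tau> w then 0 else 1 :: real) \<in> borel_measurable (PM T)"
  proof -
    have "(\<lambda>(w, v). if v \<le> \<tau> w then 0 else 1 :: real) = (\<lambda>p. 1 - (case p of (w, v) \<Rightarrow> indicator {..\<tau> w} v))"
      by (auto simp: indicator_def)
    then show ?thesis using stopped_indicator_measurable[OF \<tau>m, of T] by simp
  qed
  have int: "integrable (PM T) (\<lambda>(w, v). (if v \<le> \<tau> w then 0 else 1) * (mart be v w)\<^sup>2)"
  proof (rule Bochner_Integration.integrable_bound[OF sq_integrableD(2)[OF mart_pair_sq_integrable[OF T, of be]]])
    show "(\<lambda>(w, v). (if v \<le> \<tau> w then 0 else 1) * (mart be v w)\<^sup>2) \<in> borel_measurable (PM T)"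
      using m measurable_process_leb[OF measurable_process_mart, of be T] unfolding split_beta'
      by (intro borel_measurable_times borel_measurable_power)
  qed (auto simp: split_beta')
  show "integrable (leb T) tail" by (rule P.integrable_snd[OF int])
  show "(\<integral>v. tail v \<partial>leb T) = expectation (\<lambda>w. \<integral>v. (if v \<le> \<tau> w then 0 else 1) * (mart be v w)\<^sup>2 \<partial>leb T)"
    by (rule P.Fubini_integral[OF int])
  show "(\<lambda>w. \<integral>v. (if v \<le> \<tau> w then 0 else 1) * (mart be v w)\<^sup>2 \<partial>leb T) \<in> borel_measurable M"
    using P.integrable_fst[OF int] by auto
qed

lemma gbm_error_bound:
  assumes T: "0 \<le> T"
  shows "expectation (\<lambda>w. (gbm_error T w)\<^sup>2) \<le> 2 * (be\<^sup>2 * x\<^sup>2 * (\<integral>v. tail v \<partial>leb T)) * exp ((2 * be\<^sup>2 + 1) * T)"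
proof -
  define D where "D t = expectation (\<lambda>w. (gbm_error t w)\<^sup>2)" for t
  note pi = phi_integrable[OF T] and ph = phi_le[OF T]
  have AEt: "AE v in leb t. P v" if "AE v in leb T. P v" "t \<le> T" for P t
    using that unfolding leb_def by (subst AE_restrict_space_iff; (subst (asm) AE_restrict_space_iff)?) (auto elim!: eventually_mono)
  have Dm: "D t = (\<integral>v. indicator {..t} v * phi v \<partial>leb T)" if "0 \<le> t" "t \<le> T" for t
    unfolding D_def gbm_error_square[OF that(1)] by (rule integral_leb_mono[OF that(2)])
  have ii: "integrable (leb T) (\<lambda>v. indicator {..t} v * phi v)" if "0 \<le> t" "t \<le> T" for t
    unfolding integrable_leb_mono_iff[OF that(2), symmetric] by (rule phi_integrable[OF that(1)])
  have Dmono: "D s \<le> D t" if "0 \<le> s" "s \<le> t" "t \<le> T" for s t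
    unfolding Dm[OF that(1) order_trans[OF that(2,3)]] Dm[OF order_trans[OF that(1,2)] that(3)]
  proof (rule integral_mono_AE)
    show "AE v in leb T. indicator {..s} v * phi v \<le> indicator {..t} v * phi v"
      using ph by eventually_elim (use that in \<open>auto simp: indicator_def\<close>)
  qed (use ii that in auto)
  have D0: "0 \<le> D t" for t unfolding D_def by simp
  have Dint: "integrable (leb T) D"
  proof -
    have "mono_on {0..T} D" using Dmono by (auto intro!: mono_onI)
    then have "D \<in> borel_measurable (restrict_space borel {0..T})" by (rule borel_measurable_mono_on_fnc)
    then have "D \<in> borel_measurable (leb T)" by (simp cong: measurable_cong_sets add: sets_leb)
    then show ?thesis
      by (intro leb.integrable_const_bound[of _ "D T"]) (use Dmono D0 in auto)
  qed
  have ti: "integrable (leb T) tail" by (rule tail_integral(1)[OF T])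
  have t0: "0 \<le> tail v" for v by (intro Bochner_Integration.integral_nonneg) auto
  have "D T \<le> 2 * (be\<^sup>2 * x\<^sup>2 * (\<integral>v. tail v \<partial>leb T)) * exp ((2 * be\<^sup>2 + 1) * T)"
  proof (rule gronwall_leb[OF _ Dint _ _ T])
    show "0 \<le> D t \<and> D t \<le> D T" if "0 \<le> t" "t \<le> T" for t using D0 Dmono[OF that order_refl] by auto
    show "D t \<le> be\<^sup>2 * x\<^sup>2 * (\<integral>v. tail v \<partial>leb T) + be\<^sup>2 * (\<integral>s. D s \<partial>leb t)" if t: "0 \<le> t" "t \<le> T" for t
    proof -
      note Di = integrable_leb_subset[OF Dint t(2)] and tti = integrable_leb_subset[OF ti t(2)]
      have "D t = (\<integral>v. phi v \<partial>leb t)" unfolding D_def by (rule gbm_error_square[OF t(1)])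
      also have "\<dots> \<le> (\<integral>v. be\<^sup>2 * D v + be\<^sup>2 * x\<^sup>2 * tail v \<partial>leb t)"
      proof (rule integral_mono_AE[OF phi_integrable[OF t(1)]])
        show "integrable (leb t) (\<lambda>v. be\<^sup>2 * D v + be\<^sup>2 * x\<^sup>2 * tail v)"
          using Di tti by (intro Bochner_Integration.integrable_add integrable_mult_right)
        show "AE v in leb t. phi v \<le> be\<^sup>2 * D v + be\<^sup>2 * x\<^sup>2 * tail v"
          using AEt[OF ph t(2)] by eventually_elim (simp add: D_def algebra_simps)
      qed
      also have "\<dots> = be\<^sup>2 * (\<integral>v. D v \<partial>leb t) + be\<^sup>2 * x\<^sup>2 * (\<integral>v. tail v \<partial>leb t)"
        using Di tti by (subst Bochner_Integration.integral_add) auto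
      also have "(\<integral>v. tail v \<partial>leb t) \<le> (\<integral>v. tail v \<partial>leb T)"
        unfolding integral_leb_mono[OF t(2), of tail]
        using ti tti t0 integrable_leb_mono_iff[OF t(2), of tail] by (intro integral_mono) (auto simp: indicator_def)
      finally show ?thesis by (simp add: mult_left_mono)
    qed
  qed simp
  then show ?thesis by (simp add: D_def)
qed

end

lemma gbm_unique:
  assumes S: "solves_SDE M F W x (\<lambda>t w. b * X t w) (\<lambda>t w. be * X t w) X" and T: "0 \<le> T"
  shows "AE w in M. X T w = x * exp (b * T) * mart be T w"
proof -
  from S obtain I where I: "ito_integral M F W (\<lambda>t w. be * X t w) I"
    and eq: "AE w in M. \<forall>t\<ge>0. X t w = x + (LBINT s:{0..t}. b * X s w) + I t w"
    unfolding solves_SDE_def by auto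
  have Xp: "measurable_process M X" "adapted F X" and Xc: "AE w in M. continuous_on {0..} (\<lambda>t. X t w)"
    and bi: "AE w in M. \<forall>T\<ge>0. set_integrable lborel {0..T} (\<lambda>s. b * X s w)"
    using S by (auto simp: solves_SDE_def continuous_paths_def)
  obtain \<tau> where \<tau>: "\<And>n. \<tau> n \<in> borel_measurable M" "\<And>n w. w \<in> space M \<Longrightarrow> 0 \<le> \<tau> n w"
    "AE w in M. filterlim (\<lambda>n. \<tau> n w) at_top sequentially"
    "\<And>n. ito_integral_L2 M F W (\<lambda>t w. if t \<le> \<tau> n w then be * X t w else 0) (\<lambda>t w. I (min t (\<tau> n w)) w)"
    and Ic: "AE w in M. continuous_on {0..} (\<lambda>t. I t w)"
    using ito_integralE[OF I] by blast
  have path: "AE w in M. continuous_on {0..} (\<lambda>t. X t w) \<and> continuous_on {0..} (\<lambda>t. I t w) \<and>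
      (\<forall>T\<ge>0. integrable (leb T) (\<lambda>s. b * X s w)) \<and> (\<forall>t\<ge>0. X t w = x + (\<integral>s. b * X s w \<partial>leb t) + I t w)"
    using Xc Ic bi eq by eventually_elim (auto simp: set_integrable_leb LBINT_leb)
  define h where "h n w = (\<integral>v. (if v \<le> \<tau> n w then 0 else 1) * (mart be v w)\<^sup>2 \<partial>leb T)" for n w
  define e where "e n = gbm_error I b be x (\<tau> n) T" for n
  note ctx = Xp path \<tau>(1,2,4)
  have esq: "sq_integrable M (e n)" for n unfolding e_def by (rule gbm_error_sq_integrable[OF ctx T])
  have eeq: "AE w in M. e n w = exp (- b * min T (\<tau> n w)) * X (min T (\<tau> n w)) w - x * mart be T w" for n
    unfolding e_def by (rule gbm_error_eq[OF ctx T])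
  have eb: "expectation (\<lambda>w. (e n w)\<^sup>2) \<le> 2 * (be\<^sup>2 * x\<^sup>2 * expectation (h n)) * exp ((2 * be\<^sup>2 + 1) * T)" for n
    using gbm_error_bound[OF ctx T, of n] tail_integral(2)[OF ctx T, of n] unfolding e_def h_def by simp
  have hm: "h n \<in> borel_measurable M" for n unfolding h_def by (rule tail_integral(3)[OF ctx T])
  have ev: "AE w in M. \<forall>\<^sub>F n in sequentially. T \<le> \<tau> n w"
    using \<tau>(3) by eventually_elim (auto simp: filterlim_at_top)
  interpret P: pair_sigma_finite M "leb T" by (rule pair_sigma_finite_leb)
  have mi: "integrable (PM T) (\<lambda>(w, v). (mart be v w)\<^sup>2)"
    using sq_integrableD(2)[OF mart_pair_sq_integrable[OF T, of be]] by (simp add: split_beta')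
  have hlim: "(\<lambda>n. expectation (h n)) \<longlonglongrightarrow> expectation (\<lambda>_. 0)"
  proof (rule integral_dominated_convergence[where w="\<lambda>w. \<integral>v. (mart be v w)\<^sup>2 \<partial>leb T"])
    show "integrable M (\<lambda>w. \<integral>v. (mart be v w)\<^sup>2 \<partial>leb T)" by (rule P.integrable_fst[OF mi])
    show "AE w in M. (\<lambda>n. h n w) \<longlonglongrightarrow> 0"
      using ev
    proof eventually_elim
      case (elim w)
      then have "\<forall>\<^sub>F n in sequentially. h n w = 0"
      proof eventually_elim
        case (elim n)
        then have "h n w = (\<integral>v. 0 \<partial>leb T)" unfolding h_def by (intro Bochner_Integration.integral_cong) auto
        then show ?case by simp
      qed
      then show ?case by (rule tendsto_eventually)
    qed
    show "AE w in M. norm (h n w) \<le> (\<integral>v. (mart be v w)\<^sup>2 \<partial>leb T)" for n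
      using P.AE_integrable_fst[OF mi]
    proof eventually_elim
      case (elim w)
      have "\<bar>h n w\<bar> \<le> (\<integral>v. \<bar>(if v \<le> \<tau> n w then 0 else 1) * (mart be v w)\<^sup>2\<bar> \<partial>leb T)"
        unfolding h_def by (rule integral_abs_bound)
      also have "\<dots> \<le> (\<integral>v. (mart be v w)\<^sup>2 \<partial>leb T)"
        by (rule integral_mono_AE') (use elim in auto)
      finally show ?case by simp
    qed
  qed (use hm in auto)
  have "(\<integral>\<^sup>+w. ennreal ((exp (- b * T) * X T w - x * mart be T w)\<^sup>2) \<partial>M) = (\<integral>\<^sup>+w. liminf (\<lambda>n. ennreal ((e n w)\<^sup>2)) \<partial>M)"
  proof (rule nn_integral_cong_AE)
    have "AE w in M. \<forall>n. e n w = exp (- b * min T (\<tau> n w)) * X (min T (\<tau> n w)) w - x * mart be T w"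
      using eeq by (simp add: AE_all_countable)
    with ev show "AE w in M. ennreal ((exp (- b * T) * X T w - x * mart be T w)\<^sup>2) = liminf (\<lambda>n. ennreal ((e n w)\<^sup>2))"
    proof eventually_elim
      case (elim w)
      have "\<forall>\<^sub>F n in sequentially. ennreal ((e n w)\<^sup>2) = ennreal ((exp (- b * T) * X T w - x * mart be T w)\<^sup>2)"
        using elim(1) by eventually_elim (simp add: elim(2) min_absorb1)
      from lim_imp_Liminf[OF _ tendsto_eventually[OF this]] show ?case by simp
    qed
  qed
  also have "\<dots> \<le> liminf (\<lambda>n. \<integral>\<^sup>+w. ennreal ((e n w)\<^sup>2) \<partial>M)"
    using sq_integrableD(1)[OF esq] by (intro nn_integral_liminf) auto
  also have "\<dots> = liminf (\<lambda>n. ennreal (expectation (\<lambda>w. (e n w)\<^sup>2)))"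
    using sq_integrableD(2)[OF esq] by (simp add: nn_integral_eq_integral)
  also have "\<dots> \<le> liminf (\<lambda>n. ennreal (2 * (be\<^sup>2 * x\<^sup>2 * expectation (h n)) * exp ((2 * be\<^sup>2 + 1) * T)))"
    by (intro Liminf_mono always_eventually allI ennreal_leI eb)
  also have "\<dots> = 0"
  proof (rule lim_imp_Liminf)
    have "(\<lambda>n. 2 * (be\<^sup>2 * x\<^sup>2 * expectation (h n)) * exp ((2 * be\<^sup>2 + 1) * T)) \<longlonglongrightarrow> 2 * (be\<^sup>2 * x\<^sup>2 * expectation (\<lambda>_. 0)) * exp ((2 * be\<^sup>2 + 1) * T)"
      by (intro tendsto_intros hlim)
    then have "(\<lambda>n. ennreal (2 * (be\<^sup>2 * x\<^sup>2 * expectation (h n)) * exp ((2 * be\<^sup>2 + 1) * T))) \<longlonglongrightarrow> ennreal 0"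
      by (intro tendsto_ennrealI) simp
    then show "(\<lambda>n. ennreal (2 * (be\<^sup>2 * x\<^sup>2 * expectation (h n)) * exp ((2 * be\<^sup>2 + 1) * T))) \<longlonglongrightarrow> 0" by simp
  qed simp
  finally have "(\<integral>\<^sup>+w. ennreal ((exp (- b * T) * X T w - x * mart be T w)\<^sup>2) \<partial>M) = 0" by simp
  moreover have "(\<lambda>w. ennreal ((exp (- b * T) * X T w - x * mart be T w)\<^sup>2)) \<in> borel_measurable M"
    using measurable_process_section[OF Xp(1) T] mart_M[OF T, of be] by measurable
  ultimately have "AE w in M. ennreal ((exp (- b * T) * X T w - x * mart be T w)\<^sup>2) = 0"
    by (simp add: nn_integral_0_iff_AE)
  then show ?thesis
  proof eventually_elim
    case (elim w)
    then have "exp (- b * T) * X T w = x * mart be T w" by (simp add: ennreal_eq_0_iff)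
    then have "exp (b * T) * (exp (- b * T) * X T w) = exp (b * T) * (x * mart be T w)" by simp
    then show ?case by (simp add: mult.assoc[symmetric] exp_add[symmetric])
  qed
qed

end

subsection \<open>Optimality\<close>

lemma continuous_nonneg_of_Rats:
  fixes f :: "real \<Rightarrow> real"
  assumes f: "continuous_on {0..} f" and q: "\<And>q. q \<in> \<rat> \<Longrightarrow> 0 \<le> q \<Longrightarrow> 0 \<le> f q" and t: "0 \<le> t"
  shows "0 \<le> f t"
proof (rule ccontr)
  assume neg: "\<not> 0 \<le> f t"
  then obtain d where d: "d > 0" "\<And>s. s \<in> {0..} \<Longrightarrow> dist s t < d \<Longrightarrow> dist (f s) (f t) < - f t"
    using f t unfolding continuous_on_iff by (metis atLeast_iff neg_0_less_iff_less not_le)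
  obtain q where "q \<in> \<rat>" "t < q" "q < t + d" using Rats_dense_in_real[of t "t + d"] d by auto
  with d(2)[of q] assms(2)[of q] t neg show False by (auto simp: dist_real_def)
qed

lemma crra_tangent:
  fixes c d \<gamma> :: real
  assumes "0 < c" "0 < d" "1 < \<gamma>"
  shows "\<gamma> / (\<gamma> - 1) * (d powr (- \<gamma>) * d) \<le> c powr (1 - \<gamma>) / (\<gamma> - 1) + d powr (- \<gamma>) * c"
proof -
  define z where "z = c / d"
  have z: "z > 0" "c = d * z" using assms by (auto simp: z_def)
  have "1 + (1 - \<gamma>) * ln z \<le> z powr (1 - \<gamma>)"
    using exp_ge_add_one_self[of "(1 - \<gamma>) * ln z"] z by (simp add: powr_def)
  moreover have "(1 - \<gamma>) * (z - 1) \<le> (1 - \<gamma>) * ln z"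
    using ln_le_minus_one[OF z(1)] assms by (intro mult_left_mono_neg) auto
  ultimately have "1 + (1 - \<gamma>) * (z - 1) \<le> z powr (1 - \<gamma>)" by linarith
  then have "\<gamma> \<le> z powr (1 - \<gamma>) + (\<gamma> - 1) * z" by (simp add: algebra_simps)
  then have "\<gamma> / (\<gamma> - 1) \<le> (z powr (1 - \<gamma>) + (\<gamma> - 1) * z) / (\<gamma> - 1)"
    using assms by (intro divide_right_mono) auto
  then have "\<gamma> / (\<gamma> - 1) \<le> z powr (1 - \<gamma>) / (\<gamma> - 1) + z" using assms by (simp add: add_divide_distrib)
  then have "(d powr (- \<gamma>) * d) * (\<gamma> / (\<gamma> - 1)) \<le> (d powr (- \<gamma>) * d) * (z powr (1 - \<gamma>) / (\<gamma> - 1) + z)"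
    using assms by (intro mult_left_mono) auto
  moreover have "d powr (- \<gamma>) * d * z powr (1 - \<gamma>) = c powr (1 - \<gamma>)"
  proof -
    have "d powr (1 - \<gamma>) = d powr (- \<gamma>) * d" using powr_add[of d "- \<gamma>" 1] assms by simp
    then show ?thesis using z assms by (simp add: powr_mult)
  qed
  ultimately show ?thesis using z by (simp add: algebra_simps)
qed

lemma crra_disutility_pos:
  assumes "0 < c" "1 < \<gamma>"
  shows "e2ennreal (- (ereal (exp (- \<rho> * s)) * crra_utility \<gamma> c)) = ennreal (exp (- \<rho> * s) * (c powr (1 - \<gamma>) / (\<gamma> - 1)))"
proof -
  have "- (exp (- \<rho> * s) * (c powr (1 - \<gamma>) / (1 - \<gamma>))) = exp (- \<rho> * s) * (c powr (1 - \<gamma>) / (\<gamma> - 1))"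
    by (metis minus_diff_eq minus_divide_right mult_minus_right)
  then show ?thesis using assms by (simp add: crra_utility_def e2ennreal_ereal)
qed

lemma crra_disutility_nonpos:
  assumes "c \<le> 0"
  shows "e2ennreal (- (ereal (exp (- \<rho> * s)) * crra_utility \<gamma> c)) = \<top>"
  using assms by (simp add: crra_utility_def e2ennreal_infty)

lemma crra_utility_measurable [measurable]: "crra_utility \<gamma> \<in> borel_measurable borel"
  unfolding crra_utility_def by measurable

lemma nn_integral_leb_exp_decay:
  assumes "0 < k" "0 \<le> T" "0 \<le> C"
  shows "(\<integral>\<^sup>+s. ennreal (C * (k * exp (- k * s))) \<partial>leb T) = ennreal (C * (1 - exp (- k * T)))"
proof -
  have c: "continuous_on {0..T} (\<lambda>s. C * (k * exp (- k * s)))" by (intro continuous_intros)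
  have "(\<integral>s. indicator {0..} s * exp (- k * s) \<partial>leb T) = (\<integral>s. exp (- k * s) \<partial>leb T)"
    by (intro Bochner_Integration.integral_cong) auto
  then have e: "k * (\<integral>s. exp (- k * s) \<partial>leb T) = 1 - exp (- k * T)" using integral_leb_exp[of 0 T k] assms by simp
  show ?thesis
    using assms e by (subst nn_integral_eq_integral[OF integrable_leb_continuous[OF c]]) auto
qed

lemma nn_integral_exp_decay:
  assumes "0 < k" "0 \<le> C"
  shows "(\<integral>\<^sup>+s\<in>{0..}. ennreal (C * (k * exp (- k * s))) \<partial>lborel) = ennreal C"
proof -
  have l: "((\<lambda>s. - C * exp (- k * s)) \<longlongrightarrow> 0) at_top"
  proof -
    have "filterlim (\<lambda>s. - k * s) at_bot at_top"
      using assms by (intro filterlim_tendsto_neg_mult_at_bot[OF tendsto_const]) (auto intro: filterlim_ident)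
    from filterlim_compose[OF exp_at_bot this] show ?thesis by (intro tendsto_mult_right_zero)
  qed
  have "(\<integral>\<^sup>+s. ennreal (C * (k * exp (- k * s))) * indicator {0..} s \<partial>lborel) = ennreal (0 - (- C * exp (- k * 0)))"
    by (rule nn_integral_FTC_atLeast[OF _ _ _ l]) (use assms in \<open>auto intro!: derivative_eq_intros\<close>)
  then show ?thesis by simp
qed

context brownian_motion
begin

lemma time_integral_finite:
  assumes Z: "measurable_process M Z" and g: "g \<in> borel_measurable borel"
    and b: "\<And>t. 0 \<le> t \<Longrightarrow> t \<le> R \<Longrightarrow> (\<integral>\<^sup>+w. ennreal (g (Z t w)) \<partial>M) \<le> ennreal C"
  shows "(\<integral>\<^sup>+w. (\<integral>\<^sup>+t\<in>{0..R}. ennreal (g (Z t w)) \<partial>lborel) \<partial>M) < \<infinity>"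
proof -
  interpret P: pair_sigma_finite M "leb R" by (rule pair_sigma_finite_leb)
  note [measurable] = measurable_process_leb[OF Z, of R] g
  have "(\<integral>\<^sup>+w. (\<integral>\<^sup>+t\<in>{0..R}. ennreal (g (Z t w)) \<partial>lborel) \<partial>M) = (\<integral>\<^sup>+w. (\<integral>\<^sup>+t. ennreal (g (Z t w)) \<partial>leb R) \<partial>M)"
    by (simp only: nn_integral_leb)
  also have "\<dots> = (\<integral>\<^sup>+t. (\<integral>\<^sup>+w. ennreal (g (Z t w)) \<partial>M) \<partial>leb R)"
    using measurable_compose[OF measurable_process_leb[OF Z, of R], of "\<lambda>z. ennreal (g z)" borel] g
    by (intro P.Fubini'[symmetric]) (simp add: split_beta')
  also have "\<dots> \<le> (\<integral>\<^sup>+t. ennreal C \<partial>leb R)" using b by (intro nn_integral_mono) auto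
  also have "\<dots> < \<infinity>" using leb.emeasure_finite[of R "{0..R}"] by (simp add: ennreal_mult_eq_top_iff less_top[symmetric])
  finally show ?thesis .
qed

lemma gbm_admissibility:
  assumes S: "solves_SDE M F W x (\<lambda>t w. b * X t w) (\<lambda>t w. be * X t w) X" and x: "0 < x"
  shows "AE w in M. \<forall>t\<ge>0. 0 \<le> X t w" "0 \<le> k \<Longrightarrow> (\<lambda>t w. k * X t w) \<in> L1_loc_nonneg M F" "(\<lambda>t w. p * X t w) \<in> L2_loc M F"
proof -
  note eq = gbm_unique[OF S]
  have Xp: "measurable_process M X" "adapted F X" and Xc: "AE w in M. continuous_on {0..} (\<lambda>t. X t w)"
    using S by (auto simp: solves_SDE_def continuous_paths_def)
  have "AE w in M. \<forall>q\<in>{q\<in>\<rat>. 0 \<le> q}. X q w = x * exp (b * q) * mart be q w"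
    using eq by (subst AE_ball_countable) (auto intro: countable_subset[OF _ countable_rat])
  with Xc show nn: "AE w in M. \<forall>t\<ge>0. 0 \<le> X t w"
  proof eventually_elim
    case (elim w)
    show ?case
    proof (intro allI impI)
      fix t :: real assume t: "0 \<le> t"
      show "0 \<le> X t w"
      proof (rule continuous_nonneg_of_Rats[OF elim(1) _ t])
        fix q :: real assume "q \<in> \<rat>" "0 \<le> q"
        then have "X q w = x * exp (b * q) * mart be q w" using elim(2) by simp
        then show "0 \<le> X q w" using x by simp
      qed
    qed
  qed
  have mp: "measurable_process M (\<lambda>t w. q * X t w)" "adapted F (\<lambda>t w. q * X t w)" for q
    using Xp by (auto simp: measurable_process_def adapted_def split_beta')
  have e: "exp (c * t) \<le> exp (\<bar>c\<bar> * R)" if "0 \<le> t" "t \<le> R" for c t R :: real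
    using mult_le_abs_mult[OF that, of c] by simp
  show "(\<lambda>t w. k * X t w) \<in> L1_loc_nonneg M F" if k: "0 \<le> k"
  proof -
    have 1: "AE w in M. AE t in lborel. 0 \<le> t \<longrightarrow> 0 \<le> k * X t w"
      using nn by eventually_elim (use k in auto)
    have "(\<integral>\<^sup>+w. ennreal \<bar>k * X t w\<bar> \<partial>M) \<le> ennreal (k * x * exp (\<bar>b\<bar> * R))" if t: "0 \<le> t" "t \<le> R" for t R
    proof -
      have "(\<integral>\<^sup>+w. ennreal \<bar>k * X t w\<bar> \<partial>M) = (\<integral>\<^sup>+w. ennreal (k * x * exp (b * t) * mart be t w) \<partial>M)"
      proof (rule nn_integral_cong_AE)
        show "AE w in M. ennreal \<bar>k * X t w\<bar> = ennreal (k * x * exp (b * t) * mart be t w)"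
          using eq[OF t(1)] by eventually_elim (use k x in \<open>simp add: abs_mult\<close>)
      qed
      also have "\<dots> = ennreal (k * x * exp (b * t))"
        using mart_moments(1,2)[OF t(1), of be] k x by (subst nn_integral_eq_integral) auto
      also have "\<dots> \<le> ennreal (k * x * exp (\<bar>b\<bar> * R))"
        using e[OF t, of b] k x by (intro ennreal_leI mult_left_mono) auto
      finally show ?thesis .
    qed
    from time_integral_finite[where g=abs, OF mp(1) _ this]
    have "(\<integral>\<^sup>+w. (\<integral>\<^sup>+t\<in>{0..R}. ennreal \<bar>k * X t w\<bar> \<partial>lborel) \<partial>M) < \<infinity>" for R by simp
    then show ?thesis unfolding L1_loc_nonneg_def using mp 1 by simp
  qed
  have "(\<integral>\<^sup>+w. ennreal (\<bar>p * X t w\<bar>\<^sup>2) \<partial>M) \<le> ennreal ((p * x)\<^sup>2 * exp (\<bar>2 * b + be\<^sup>2\<bar> * R))" if t: "0 \<le> t" "t \<le> R" for t R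
  proof -
    have "(\<integral>\<^sup>+w. ennreal (\<bar>p * X t w\<bar>\<^sup>2) \<partial>M) = (\<integral>\<^sup>+w. ennreal ((p * x)\<^sup>2 * exp (2 * b * t) * (mart be t w)\<^sup>2) \<partial>M)"
    proof (rule nn_integral_cong_AE)
      have e2: "exp (2 * b * t) = (exp (b * t))\<^sup>2" by (simp add: exp_double[symmetric] mult.assoc)
      show "AE w in M. ennreal (\<bar>p * X t w\<bar>\<^sup>2) = ennreal ((p * x)\<^sup>2 * exp (2 * b * t) * (mart be t w)\<^sup>2)"
        using eq[OF t(1)] unfolding e2 by eventually_elim (simp add: power_mult_distrib mult.assoc)
    qed
    also have "\<dots> = ennreal ((p * x)\<^sup>2 * exp (2 * b * t) * exp (be\<^sup>2 * t))"
      using sq_integrableD(2)[OF mart_moments(3)[OF t(1), of be]] mart_moments(4)[OF t(1), of be]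
      by (subst nn_integral_eq_integral) auto
    also have "\<dots> \<le> ennreal ((p * x)\<^sup>2 * exp (\<bar>2 * b + be\<^sup>2\<bar> * R))"
      using e[OF t, of "2 * b + be\<^sup>2"]
      by (simp only: mult.assoc exp_add[symmetric]) (auto intro!: ennreal_leI mult_left_mono simp: algebra_simps)
    finally show ?thesis .
  qed
  from time_integral_finite[where g="\<lambda>z. \<bar>z\<bar>\<^sup>2", OF mp(1) _ this]
  have "(\<integral>\<^sup>+w. (\<integral>\<^sup>+t\<in>{0..R}. ennreal (\<bar>p * X t w\<bar>\<^sup>2) \<partial>lborel) \<partial>M) < \<infinity>" for R by simp
  then show "(\<lambda>t w. p * X t w) \<in> L2_loc M F"
    unfolding L2_loc_def using mp by simp
qed

lemma disutility_measurable:
  assumes c: "measurable_process M c"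
  shows "(\<lambda>(w, s). e2ennreal (- (ereal (exp (- \<rho> * s)) * crra_utility \<gamma> (c s w)))) \<in> borel_measurable (M \<Otimes>\<^sub>M restrict_space borel {0..})"
proof -
  have [measurable]: "snd \<in> borel_measurable (M \<Otimes>\<^sub>M restrict_space borel {0::real..})"
    by (rule measurable_compose[OF measurable_snd measurable_restrict_space1]) simp
  have [measurable]: "(\<lambda>p. c (snd p) (fst p)) \<in> borel_measurable (M \<Otimes>\<^sub>M restrict_space borel {0::real..})"
    using c by (simp add: measurable_process_def split_beta')
  show ?thesis unfolding split_beta' by measurable
qed

context
  fixes r \<rho> lam \<gamma> k x :: real
  assumes g: "1 < \<gamma>" and k0: "0 < k" and x0: "0 < x"
    and gk: "\<gamma> * k = \<rho> - (1 - \<gamma>) * (r + lam\<^sup>2 / (2 * \<gamma>))"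
begin

text \<open>\<open>copt\<close> is the optimal consumption and \<open>spd\<close> the state price density; the first-order
  condition says that the discounted marginal utility of \<open>copt\<close> is \<open>shadow_price * spd\<close>.\<close>

definition "copt s w = k * (x * exp ((r + lam\<^sup>2 / \<gamma> - k) * s) * mart (lam / \<gamma>) s w)"
definition "spd s w = exp (- r * s) * mart (- lam) s w"
definition "shadow_price = (k * x) powr (- \<gamma>)"

lemma copt_pos: "0 < copt s w" and spd_pos: "0 < spd s w" and shadow_price_pos: "0 < shadow_price"
  using g k0 x0 by (auto simp: copt_def spd_def shadow_price_def)

lemma first_order_condition: "exp (- \<rho> * s) * copt s w powr (- \<gamma>) = shadow_price * spd s w"
proof -
  let ?w = "cv W s w"
  have "copt s w = (k * x) * exp ((r + lam\<^sup>2 / \<gamma> - k) * s + (lam / \<gamma> * ?w - (lam / \<gamma>)\<^sup>2 * s / 2))"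
    by (simp add: copt_def mart_def exp_add)
  then have "copt s w powr (- \<gamma>) = shadow_price * exp (- \<gamma> * ((r + lam\<^sup>2 / \<gamma> - k) * s + (lam / \<gamma> * ?w - (lam / \<gamma>)\<^sup>2 * s / 2)))"
    using k0 x0 by (simp add: powr_mult shadow_price_def exp_powr_real mult.commute)
  then have "exp (- \<rho> * s) * copt s w powr (- \<gamma>) =
     shadow_price * exp (- \<rho> * s + - \<gamma> * ((r + lam\<^sup>2 / \<gamma> - k) * s + (lam / \<gamma> * ?w - (lam / \<gamma>)\<^sup>2 * s / 2)))"
    by (simp only: exp_add mult.left_commute)
  also have "- \<rho> * s + - \<gamma> * ((r + lam\<^sup>2 / \<gamma> - k) * s + (lam / \<gamma> * ?w - (lam / \<gamma>)\<^sup>2 * s / 2))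
      = - r * s + (- lam * ?w - (- lam)\<^sup>2 * s / 2)"
  proof -
    have "\<gamma> * ((r + lam\<^sup>2 / \<gamma> - k) * s + (lam / \<gamma> * ?w - (lam / \<gamma>)\<^sup>2 * s / 2)) = (\<gamma> * r + lam\<^sup>2 - \<gamma> * k) * s + (lam * ?w - lam\<^sup>2 / \<gamma> * s / 2)"
      using g by (simp add: field_simps power2_eq_square)
    also have "\<dots> = (\<gamma> * r + lam\<^sup>2 - (\<rho> - (1 - \<gamma>) * (r + lam\<^sup>2 / (2 * \<gamma>)))) * s + (lam * ?w - lam\<^sup>2 / \<gamma> * s / 2)"
      by (simp only: gk)
    also have "\<dots> = - \<rho> * s + r * s + lam * ?w + lam\<^sup>2 * s / 2"
      using g by (simp add: field_simps)
    finally show ?thesis by simp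
  qed
  also have "exp (- r * s + (- lam * ?w - (- lam)\<^sup>2 * s / 2)) = spd s w"
    by (simp only: spd_def mart_def exp_add)
  finally show ?thesis .
qed

lemma spd_copt_expectation:
  assumes "0 \<le> s" "0 \<le> C"
  shows "(\<integral>\<^sup>+w. ennreal (C * (spd s w * copt s w)) \<partial>M) = ennreal (C * x * (k * exp (- k * s)))"
proof -
  have eq: "C * (spd s w * copt s w) = C * x * (k * exp (- k * s)) * mart (- lam + lam / \<gamma>) s w" for w
  proof -
    have "spd s w * copt s w = k * x * (exp (- r * s + (r + lam\<^sup>2 / \<gamma> - k) * s) * (mart (- lam) s w * mart (lam / \<gamma>) s w))"
      by (simp only: spd_def copt_def exp_add mult_ac)
    also have "\<dots> = k * x * (exp (- r * s + (r + lam\<^sup>2 / \<gamma> - k) * s + - lam * (lam / \<gamma>) * s) * mart (- lam + lam / \<gamma>) s w)"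
      by (simp only: mart_mult exp_add mult_ac)
    also have "- r * s + (r + lam\<^sup>2 / \<gamma> - k) * s + - lam * (lam / \<gamma>) * s = - k * s"
      by (simp add: algebra_simps power2_eq_square)
    finally show ?thesis by (simp add: mult_ac)
  qed
  show ?thesis
    unfolding eq using mart_moments(1,2)[OF assms(1), of "- lam + lam / \<gamma>"] assms(2) x0 k0
    by (subst nn_integral_eq_integral) auto
qed

abbreviation "disutility c s w \<equiv> e2ennreal (- (ereal (exp (- \<rho> * s)) * crra_utility \<gamma> (c s w)))"

lemma tangent_bound:
  "ennreal (\<gamma> / (\<gamma> - 1) * shadow_price * (spd s w * copt s w)) \<le> disutility c s w + ennreal shadow_price * (ennreal (spd s w) * ennreal (c s w))"
proof (cases "c s w \<le> 0")
  case True
  show ?thesis unfolding crra_disutility_nonpos[OF True] by simp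
next
  case False
  then have c: "0 < c s w" by simp
  have "\<gamma> / (\<gamma> - 1) * shadow_price * (spd s w * copt s w) = \<gamma> / (\<gamma> - 1) * ((shadow_price * spd s w) * copt s w)"
    by (simp only: mult.assoc)
  also have "\<dots> = exp (- \<rho> * s) * (\<gamma> / (\<gamma> - 1) * (copt s w powr (- \<gamma>) * copt s w))"
    unfolding first_order_condition[symmetric] by (simp only: mult_ac)
  also have "\<dots> \<le> exp (- \<rho> * s) * (c s w powr (1 - \<gamma>) / (\<gamma> - 1) + copt s w powr (- \<gamma>) * c s w)"
    by (intro mult_left_mono crra_tangent c copt_pos g) simp
  also have "\<dots> = exp (- \<rho> * s) * (c s w powr (1 - \<gamma>) / (\<gamma> - 1)) + (exp (- \<rho> * s) * copt s w powr (- \<gamma>)) * c s w"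
    by (simp only: distrib_left mult.assoc)
  also have "(exp (- \<rho> * s) * copt s w powr (- \<gamma>)) * c s w = shadow_price * (spd s w * c s w)"
    by (simp only: first_order_condition mult.assoc)
  finally have "ennreal (\<gamma> / (\<gamma> - 1) * shadow_price * (spd s w * copt s w)) \<le>
     ennreal (exp (- \<rho> * s) * (c s w powr (1 - \<gamma>) / (\<gamma> - 1)) + shadow_price * (spd s w * c s w))" by (rule ennreal_leI)
  also have "\<dots> = ennreal (exp (- \<rho> * s) * (c s w powr (1 - \<gamma>) / (\<gamma> - 1))) + ennreal shadow_price * (ennreal (spd s w) * ennreal (c s w))"
    using c g shadow_price_pos spd_pos[of s w] by (subst ennreal_plus) (auto simp: ennreal_mult less_imp_le)
  finally show ?thesis by (simp only: crra_disutility_pos[OF c g])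
qed

lemma disutility_lower_bound:
  assumes c: "measurable_process M c" and budget: "\<And>T. 0 \<le> T \<Longrightarrow> (\<integral>\<^sup>+s. \<integral>\<^sup>+w. ennreal (spd s w) * ennreal (c s w) \<partial>M \<partial>leb T) \<le> ennreal x"
  shows "ennreal (shadow_price * x / (\<gamma> - 1)) \<le> (\<integral>\<^sup>+w. (\<integral>\<^sup>+s\<in>{0..}. disutility c s w \<partial>lborel) \<partial>M)" (is "_ \<le> ?L")
proof -
  have main: "ennreal (\<gamma> / (\<gamma> - 1) * shadow_price * x * (1 - exp (- k * T))) \<le> ?L + ennreal (shadow_price * x)" if T: "0 \<le> T" for T
  proof -
    interpret P: pair_sigma_finite M "leb T" by (rule pair_sigma_finite_leb)
    have idm: "(\<lambda>t. t) \<in> leb T \<rightarrow>\<^sub>M restrict_space borel {0..}"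
      by (rule measurable_restrict_space2) (auto intro: borel_measurable_leb)
    have dm: "(\<lambda>(w, s). disutility c s w) \<in> borel_measurable (PM T)"
    proof -
      have "(\<lambda>p. (fst p, snd p)) \<in> PM T \<rightarrow>\<^sub>M M \<Otimes>\<^sub>M restrict_space borel {0..}"
        by (intro measurable_Pair measurable_compose[OF measurable_snd idm]) simp
      from measurable_compose[OF this disutility_measurable[OF c]] show ?thesis by (simp add: split_beta')
    qed
    have sm: "(\<lambda>w. ennreal (spd s w) * ennreal (c s w)) \<in> borel_measurable M" if "0 \<le> s" for s
      using mart_M[OF that, of "- lam"] measurable_process_section[OF c that] unfolding spd_def by measurable
    have dsm: "disutility c s \<in> borel_measurable M" if "0 \<le> s" for s
      using measurable_process_section[OF c that] by measurable
    have pm: "(\<lambda>(w, s). ennreal (spd s w) * ennreal (c s w)) \<in> borel_measurable (PM T)"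
      using measurable_process_leb[OF c, of T] measurable_process_leb[OF measurable_process_mart, of "- lam" T] exp_leb_measurable[of "- r" T]
      unfolding spd_def split_beta' by measurable
    have sw: "(\<lambda>s. \<integral>\<^sup>+w. f s w \<partial>M) \<in> borel_measurable (leb T)"
      if "(\<lambda>(w, s). f s w) \<in> borel_measurable (PM T)" for f :: "real \<Rightarrow> 'a \<Rightarrow> ennreal"
      using measurable_pair_swap[OF that] by (intro borel_measurable_nn_integral) (simp add: split_beta')
    have "ennreal (\<gamma> / (\<gamma> - 1) * shadow_price * x * (1 - exp (- k * T))) = (\<integral>\<^sup>+s. ennreal (\<gamma> / (\<gamma> - 1) * shadow_price * x * (k * exp (- k * s))) \<partial>leb T)"
      using T g shadow_price_pos x0 by (intro nn_integral_leb_exp_decay[OF k0, symmetric]) auto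
    also have "\<dots> = (\<integral>\<^sup>+s. \<integral>\<^sup>+w. ennreal (\<gamma> / (\<gamma> - 1) * shadow_price * (spd s w * copt s w)) \<partial>M \<partial>leb T)"
      using g shadow_price_pos by (intro nn_integral_cong spd_copt_expectation[symmetric]) auto
    also have "\<dots> \<le> (\<integral>\<^sup>+s. \<integral>\<^sup>+w. disutility c s w + ennreal shadow_price * (ennreal (spd s w) * ennreal (c s w)) \<partial>M \<partial>leb T)"
      by (intro nn_integral_mono tangent_bound)
    also have "\<dots> = (\<integral>\<^sup>+s. (\<integral>\<^sup>+w. disutility c s w \<partial>M) + ennreal shadow_price * (\<integral>\<^sup>+w. ennreal (spd s w) * ennreal (c s w) \<partial>M) \<partial>leb T)"
      using sm dsm by (intro nn_integral_cong) (simp add: nn_integral_add nn_integral_cmult)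
    also have "\<dots> = (\<integral>\<^sup>+s. \<integral>\<^sup>+w. disutility c s w \<partial>M \<partial>leb T) + ennreal shadow_price * (\<integral>\<^sup>+s. \<integral>\<^sup>+w. ennreal (spd s w) * ennreal (c s w) \<partial>M \<partial>leb T)"
      using sw[OF dm] sw[OF pm] by (subst nn_integral_add) (auto simp: nn_integral_cmult)
    also have "(\<integral>\<^sup>+s. \<integral>\<^sup>+w. disutility c s w \<partial>M \<partial>leb T) = (\<integral>\<^sup>+w. \<integral>\<^sup>+s. disutility c s w \<partial>leb T \<partial>M)"
      by (rule P.Fubini'[OF dm])
    also have "\<dots> \<le> ?L"
      unfolding nn_integral_leb[symmetric] by (intro nn_integral_mono) (auto simp: indicator_def)
    also have "ennreal shadow_price * (\<integral>\<^sup>+s. \<integral>\<^sup>+w. ennreal (spd s w) * ennreal (c s w) \<partial>M \<partial>leb T) \<le> ennreal shadow_price * ennreal x"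
      by (intro mult_left_mono budget T) simp
    also have "ennreal shadow_price * ennreal x = ennreal (shadow_price * x)" using shadow_price_pos x0 by (simp add: ennreal_mult)
    finally show ?thesis by (simp add: add_mono)
  qed
  show ?thesis
  proof (cases "?L")
    case (real l)
    have "((\<lambda>T. \<gamma> / (\<gamma> - 1) * shadow_price * x * (1 - exp (- k * T))) \<longlongrightarrow> \<gamma> / (\<gamma> - 1) * shadow_price * x * (1 - 0)) at_top"
    proof (intro tendsto_intros)
      have "filterlim (\<lambda>s. - k * s) at_bot at_top"
        using k0 by (intro filterlim_tendsto_neg_mult_at_bot[OF tendsto_const]) (auto intro: filterlim_ident)
      from filterlim_compose[OF exp_at_bot this] show "((\<lambda>T. exp (- k * T)) \<longlongrightarrow> 0) at_top" .
    qed
    moreover have "\<forall>\<^sub>F T in at_top. \<gamma> / (\<gamma> - 1) * shadow_price * x * (1 - exp (- k * T)) \<le> l + shadow_price * x"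
      using eventually_ge_at_top[of 0]
    proof eventually_elim
      case (elim T)
      from main[OF elim] real shadow_price_pos x0 show ?case by (simp add: ennreal_plus[symmetric] del: ennreal_plus)
    qed
    ultimately have "\<gamma> / (\<gamma> - 1) * shadow_price * x * (1 - 0) \<le> l + shadow_price * x"
      by (intro tendsto_upperbound) auto
    moreover have "\<gamma> / (\<gamma> - 1) * shadow_price * x = shadow_price * x / (\<gamma> - 1) + shadow_price * x" using g by (simp add: field_simps)
    ultimately have "shadow_price * x / (\<gamma> - 1) \<le> l" by simp
    then show ?thesis using real by (simp add: ennreal_leI)
  qed simp
qed

lemma disutility_optimal:
  assumes c: "measurable_process M c" and eq: "\<And>s. 0 \<le> s \<Longrightarrow> AE w in M. c s w = copt s w"
  shows "(\<integral>\<^sup>+w. (\<integral>\<^sup>+s\<in>{0..}. disutility c s w \<partial>lborel) \<partial>M) = ennreal (shadow_price * x / (\<gamma> - 1))"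
proof -
  let ?N = "restrict_space lborel {0::real..}"
  interpret N: sigma_finite_measure ?N
    by (rule sigma_finite_measure_restrict_space) (auto intro: lborel.sigma_finite_measure_axioms)
  interpret P: pair_sigma_finite M ?N by (simp add: pair_sigma_finite_def N.sigma_finite_measure_axioms sigma_finite_measure_axioms)
  have dm: "(\<lambda>(w, s). disutility c s w) \<in> borel_measurable (M \<Otimes>\<^sub>M ?N)"
  proof -
    have "sets (M \<Otimes>\<^sub>M ?N) = sets (M \<Otimes>\<^sub>M restrict_space borel {0..})"
      by (intro sets_pair_measure_cong refl sets_restrict_space_cong) simp
    with disutility_measurable[OF c] show ?thesis by (simp cong: measurable_cong_sets)
  qed
  have d: "(\<integral>\<^sup>+w. disutility c s w \<partial>M) = ennreal (shadow_price / (\<gamma> - 1) * x * (k * exp (- k * s)))" if s: "0 \<le> s" for s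
  proof -
    have "(\<integral>\<^sup>+w. disutility c s w \<partial>M) = (\<integral>\<^sup>+w. ennreal (shadow_price / (\<gamma> - 1) * (spd s w * copt s w)) \<partial>M)"
    proof (rule nn_integral_cong_AE)
      show "AE w in M. disutility c s w = ennreal (shadow_price / (\<gamma> - 1) * (spd s w * copt s w))"
        using eq[OF s]
      proof eventually_elim
        case (elim w)
        have "copt s w powr (1 - \<gamma>) = copt s w powr (- \<gamma>) * copt s w"
          using powr_add[of "copt s w" "- \<gamma>" 1] copt_pos[of s w] by simp
        then have "exp (- \<rho> * s) * (copt s w powr (1 - \<gamma>) / (\<gamma> - 1)) = (exp (- \<rho> * s) * copt s w powr (- \<gamma>)) * copt s w / (\<gamma> - 1)" by simp
        also have "\<dots> = shadow_price / (\<gamma> - 1) * (spd s w * copt s w)" unfolding first_order_condition by simp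
        finally have e: "exp (- \<rho> * s) * (copt s w powr (1 - \<gamma>) / (\<gamma> - 1)) = shadow_price / (\<gamma> - 1) * (spd s w * copt s w)" .
        show ?case unfolding elim crra_disutility_pos[OF copt_pos g] e ..
      qed
    qed
    also have "\<dots> = ennreal (shadow_price / (\<gamma> - 1) * x * (k * exp (- k * s)))"
      using shadow_price_pos g by (intro spd_copt_expectation[OF s]) auto
    finally show ?thesis .
  qed
  have "(\<integral>\<^sup>+w. (\<integral>\<^sup>+s\<in>{0..}. disutility c s w \<partial>lborel) \<partial>M) = (\<integral>\<^sup>+w. \<integral>\<^sup>+s. disutility c s w \<partial>?N \<partial>M)"
    by (simp add: nn_integral_restrict_space)
  also have "\<dots> = (\<integral>\<^sup>+s. \<integral>\<^sup>+w. disutility c s w \<partial>M \<partial>?N)" by (rule P.Fubini'[OF dm, symmetric])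
  also have "\<dots> = (\<integral>\<^sup>+s. ennreal (shadow_price / (\<gamma> - 1) * x * (k * exp (- k * s))) \<partial>?N)"
    by (intro nn_integral_cong d) (simp add: space_restrict_space)
  also have "\<dots> = (\<integral>\<^sup>+s\<in>{0..}. ennreal (shadow_price / (\<gamma> - 1) * x * (k * exp (- k * s))) \<partial>lborel)"
    by (simp add: nn_integral_restrict_space)
  also have "\<dots> = ennreal (shadow_price / (\<gamma> - 1) * x)"
    using shadow_price_pos g x0 by (intro nn_integral_exp_decay[OF k0]) auto
  finally show ?thesis by simp
qed

end

end

theorem theorem3p6:
  fixes M :: "'a measure" and F :: "real \<Rightarrow> 'a measure" and W :: "real \<Rightarrow> 'a \<Rightarrow> real"
    and r \<mu> \<rho> \<sigma> lam \<gamma> a x :: real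
    and Xhat chat pihat :: "real \<Rightarrow> 'a \<Rightarrow> real"
  assumes "brownian_motion M F W"
    and "\<sigma> > 0" and "lam = (\<mu> - r) / \<sigma>" and "\<gamma> > 1"
    and "\<rho> > (1 - \<gamma>) * (r + lam\<^sup>2 / (2 * \<gamma>))"
    and "a = ((\<rho> - (1 - \<gamma>) * (r + lam\<^sup>2 / (2 * \<gamma>))) / \<gamma>) powr (- \<gamma>)"
    and "x > 0"
    and "solves_SDE M F W x
           (\<lambda>t \<omega>. (r + lam\<^sup>2 / \<gamma> - a powr (- 1 / \<gamma>)) * Xhat t \<omega>)
           (\<lambda>t \<omega>. lam / \<gamma> * Xhat t \<omega>) Xhat"
    and "chat = (\<lambda>t \<omega>. a powr (- 1 / \<gamma>) * Xhat t \<omega>)"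
    and "pihat = (\<lambda>t \<omega>. lam / (\<sigma> * \<gamma>) * Xhat t \<omega>)"
  shows "(chat, pihat) \<in> admissible M F W r \<sigma> lam x \<and>
         value_function M F W r \<sigma> lam \<rho> \<gamma> x = objective M \<rho> \<gamma> chat"
proof -
  interpret brownian_motion M F W by fact
  define k where "k = (\<rho> - (1 - \<gamma>) * (r + lam\<^sup>2 / (2 * \<gamma>))) / \<gamma>"
  have k0: "0 < k" using assms(4,5) by (auto simp: k_def intro!: divide_pos_pos)
  have gk: "\<gamma> * k = \<rho> - (1 - \<gamma>) * (r + lam\<^sup>2 / (2 * \<gamma>))" using assms(4) by (simp add: k_def)
  have ak: "a powr (- 1 / \<gamma>) = k"
    using assms(4) k0 by (simp add: assms(6) k_def[symmetric] powr_powr)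
  note S = assms(8)[unfolded ak]
  note adm = gbm_admissibility[OF S assms(7)]
  have chat: "chat = (\<lambda>t w. k * Xhat t w)" using assms(9) ak by simp
  have drift: "r * Xhat t w + \<sigma> * lam * pihat t w - chat t w = (r + lam\<^sup>2 / \<gamma> - k) * Xhat t w"
    and vol: "\<sigma> * pihat t w = lam / \<gamma> * Xhat t w" for t w
    using assms(2) by (simp_all add: chat assms(10) algebra_simps power2_eq_square)
  have cL1: "chat \<in> L1_loc_nonneg M F" unfolding chat using k0 by (intro adm(2)) simp
  have pL2: "pihat \<in> L2_loc M F" unfolding assms(10) by (rule adm(3))
  have "wealth_process M F W r \<sigma> lam x chat pihat Xhat"
    unfolding wealth_process_def drift vol by (rule S)
  then have A: "(chat, pihat) \<in> admissible M F W r \<sigma> lam x"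
    unfolding admissible_def using adm(1) cL1 pL2 by auto
  have opt: "(\<integral>\<^sup>+w. (\<integral>\<^sup>+s\<in>{0..}. e2ennreal (- (ereal (exp (- \<rho> * s)) * crra_utility \<gamma> (chat s w))) \<partial>lborel) \<partial>M) = ennreal (shadow_price \<gamma> k x * x / (\<gamma> - 1))"
  proof (rule disutility_optimal[OF assms(4) k0 assms(7) gk])
    show "measurable_process M chat" using cL1 by (simp add: L1_loc_nonneg_def)
    show "AE w in M. chat s w = copt r lam \<gamma> k x s w" if "0 \<le> s" for s
      using gbm_unique[OF S that] by eventually_elim (simp add: chat copt_def[OF assms(4) k0 assms(7) gk])
  qed
  have le: "objective M \<rho> \<gamma> c \<le> objective M \<rho> \<gamma> chat" if cp: "(c, \<pi>) \<in> admissible M F W r \<sigma> lam x" for c \<pi>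
  proof -
    from cp obtain X where c: "c \<in> L1_loc_nonneg M F" and X: "wealth_process M F W r \<sigma> lam x c \<pi> X"
      and nn: "AE w in M. \<forall>t\<ge>0. 0 \<le> X t w" by (auto simp: admissible_def)
    have "ennreal (shadow_price \<gamma> k x * x / (\<gamma> - 1)) \<le> (\<integral>\<^sup>+w. (\<integral>\<^sup>+s\<in>{0..}. e2ennreal (- (ereal (exp (- \<rho> * s)) * crra_utility \<gamma> (c s w))) \<partial>lborel) \<partial>M)"
    proof (rule disutility_lower_bound[OF assms(4) k0 assms(7) gk])
      show "measurable_process M c" using c by (simp add: L1_loc_nonneg_def)
      show "(\<integral>\<^sup>+s. \<integral>\<^sup>+w. ennreal (spd r lam s w) * ennreal (c s w) \<partial>M \<partial>leb T) \<le> ennreal x" if "0 \<le> T" for T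
        unfolding spd_def[OF assms(4) k0 assms(7) gk] using budget_constraint[OF c X nn that] by simp
    qed
    then show ?thesis
      unfolding objective_def opt by (simp add: less_eq_ennreal.rep_eq)
  qed
  have "value_function M F W r \<sigma> lam \<rho> \<gamma> x = objective M \<rho> \<gamma> chat"
    unfolding value_function_def
  proof (rule antisym)
    show "(SUP (c, \<pi>)\<in>admissible M F W r \<sigma> lam x. objective M \<rho> \<gamma> c) \<le> objective M \<rho> \<gamma> chat"
      using le by (auto intro!: SUP_least)
    show "objective M \<rho> \<gamma> chat \<le> (SUP (c, \<pi>)\<in>admissible M F W r \<sigma> lam x. objective M \<rho> \<gamma> c)"
      by (rule SUP_upper2[OF A]) simp
  qed
  with A show ?thesis by blast
qed

end
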